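(* Let $\mathcal{P} \subset \mathbb{R}^2$ be any parallelogram and let $L (\mathcal{P})$ denote its perimeter. Then $$\mu_2 (\mathcal{P})\, L (\mathcal{P})^2 \leq 16 \pi^2.$$ Equality holds if and only if $\mathcal{P}$ is a square.
   Context: A parallelogram is understood as a (non-degenerate) open bounded planar domain. For a bounded, connected Lipschitz domain $\Omega\subset\mathbb{R}^2$, $0=\mu_1(\Omega)<\mu_2(\Omega)\le\mu_3(\Omega)\le\dots$ denote the eigenvalues, counted with multiplicities, of the Neumann Laplacian on $\Omega$, that is, of the self-adjoint operator in $L^2(\Omega)$ associated with the quadratic form $u\mapsto\int_\Omega|\nabla u|^2$ with domain $H^1(\Omega)$. *)

theory Defs
  imports "HOL-Analysis.Analysis"
begin

primrec C_k :: "nat \<Rightarrow> ('a::euclidean_space \<Rightarrow> real) \<Rightarrow> bool" where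
  "C_k 0 f \<longleftrightarrow> continuous_on UNIV f"
| "C_k (Suc k) f \<longleftrightarrow>
     (\<exists>Df. (\<forall>x. GDERIV f x :> Df x) \<and> (\<forall>b\<in>Basis. C_k k (\<lambda>x. Df x \<bullet> b)))"

definition test_function :: "'a::euclidean_space set \<Rightarrow> ('a \<Rightarrow> real) \<Rightarrow> bool" where
  "test_function \<Omega> \<phi> \<longleftrightarrow>
     (\<forall>k. C_k k \<phi>) \<and> (\<exists>K. compact K \<and> K \<subseteq> \<Omega> \<and> (\<forall>x. x \<notin> K \<longrightarrow> \<phi> x = 0))"

text \<open>Elements of \<open>L\<^sup>2\<close> are represented by functions, not by classes modulo null sets; values
  outside \<open>\<Omega>\<close> are irrelevant throughout.\<close>

definition L2 :: "'a::euclidean_space set \<Rightarrow> ('a \<Rightarrow> 'b::euclidean_space) \<Rightarrow> bool" where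
  "L2 \<Omega> u \<longleftrightarrow> u \<in> borel_measurable (lebesgue_on \<Omega>) \<and>
     integrable (lebesgue_on \<Omega>) (\<lambda>x. (norm (u x))\<^sup>2)"

definition weak_gradient :: "'a::euclidean_space set \<Rightarrow> ('a \<Rightarrow> real) \<Rightarrow> ('a \<Rightarrow> 'a) \<Rightarrow> bool" where
  "weak_gradient \<Omega> u g \<longleftrightarrow>
     (\<forall>\<phi> D\<phi>. test_function \<Omega> \<phi> \<longrightarrow> (\<forall>x. GDERIV \<phi> x :> D\<phi> x) \<longrightarrow>
        (LINT x|lebesgue_on \<Omega>. u x *\<^sub>R D\<phi> x) = - (LINT x|lebesgue_on \<Omega>. \<phi> x *\<^sub>R g x))"

text \<open>\<open>H1 \<Omega> u g\<close>: the function \<open>u\<close> lies in \<open>H\<^sup>1(\<Omega>)\<close> and \<open>g\<close> is a representative of its weak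
  gradient (which is unique almost everywhere).\<close>

definition H1 :: "'a::euclidean_space set \<Rightarrow> ('a \<Rightarrow> real) \<Rightarrow> ('a \<Rightarrow> 'a) \<Rightarrow> bool" where
  "H1 \<Omega> u g \<longleftrightarrow> L2 \<Omega> u \<and> L2 \<Omega> g \<and> weak_gradient \<Omega> u g"

text \<open>The graph of the operator associated with the form \<open>\<integral> |\<nabla>u|\<^sup>2\<close> on \<open>H\<^sup>1(\<Omega>)\<close>: the function \<open>u\<close> is
  in its domain and is mapped to \<open>f\<close>.\<close>

definition neumann_laplacian ::
  "'a::euclidean_space set \<Rightarrow> ('a \<Rightarrow> real) \<Rightarrow> ('a \<Rightarrow> real) \<Rightarrow> bool" where
  "neumann_laplacian \<Omega> u f \<longleftrightarrow> L2 \<Omega> f \<and>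
     (\<exists>g. H1 \<Omega> u g \<and>
        (\<forall>v h. H1 \<Omega> v h \<longrightarrow>
           (LINT x|lebesgue_on \<Omega>. g x \<bullet> h x) = (LINT x|lebesgue_on \<Omega>. f x * v x)))"

definition neumann_eigenspace :: "'a::euclidean_space set \<Rightarrow> real \<Rightarrow> ('a \<Rightarrow> real) set" where
  "neumann_eigenspace \<Omega> \<mu> = {u. neumann_laplacian \<Omega> u (\<lambda>x. \<mu> * u x)}"

definition ae_independent :: "'a::euclidean_space set \<Rightarrow> ('a \<Rightarrow> real) set \<Rightarrow> bool" where
  "ae_independent \<Omega> F \<longleftrightarrow>
     (\<forall>c. (AE x in lebesgue_on \<Omega>. (\<Sum>f\<in>F. c f * f x) = 0) \<longrightarrow> (\<forall>f\<in>F. c f = 0))"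

text \<open>The dimension of the eigenspace as a subspace of \<open>L\<^sup>2(\<Omega>)\<close>; it is 0 iff \<open>\<mu>\<close> is not an
  eigenvalue.\<close>

definition neumann_multiplicity :: "'a::euclidean_space set \<Rightarrow> real \<Rightarrow> enat" where
  "neumann_multiplicity \<Omega> \<mu> =
     (SUP F\<in>{F. finite F \<and> F \<subseteq> neumann_eigenspace \<Omega> \<mu> \<and> ae_independent \<Omega> F}. enat (card F))"

text \<open>The number of eigenvalues in \<open>(-\<infinity>, t]\<close>, counted with multiplicities.\<close>

definition neumann_counting :: "'a::euclidean_space set \<Rightarrow> real \<Rightarrow> enat" where
  "neumann_counting \<Omega> t =
     (SUP S\<in>{S. finite S \<and> S \<subseteq> {..t}}. \<Sum>\<mu>\<in>S. neumann_multiplicity \<Omega> \<mu>)"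

text \<open>The \<open>k\<close>-th eigenvalue \<open>\<mu>\<^sub>k(\<Omega>)\<close>, \<open>k \<ge> 1\<close>, in the nondecreasing enumeration with
  multiplicities; thus \<open>\<mu>\<^sub>1(\<Omega>) = 0\<close> and \<open>\<mu>\<^sub>2(\<Omega>)\<close> is the first positive eigenvalue if \<open>\<Omega>\<close> is a
  bounded connected Lipschitz domain.\<close>

definition neumann_eigenvalue :: "'a::euclidean_space set \<Rightarrow> nat \<Rightarrow> real" where
  "neumann_eigenvalue \<Omega> k = (LEAST t. enat k \<le> neumann_counting \<Omega> t)"

text \<open>The open parallelogram with vertex \<open>p\<close> and side vectors \<open>a\<close>, \<open>b\<close>; it is non-degenerate iff
  \<open>0\<close>, \<open>a\<close>, \<open>b\<close> are not collinear.\<close>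

definition parallelogram :: "real^2 \<Rightarrow> real^2 \<Rightarrow> real^2 \<Rightarrow> (real^2) set" where
  "parallelogram p a b = {p + s *\<^sub>R a + t *\<^sub>R b | s t. 0 < s \<and> s < 1 \<and> 0 < t \<and> t < 1}"

definition parallelogram_perimeter :: "real^2 \<Rightarrow> real^2 \<Rightarrow> real" where
  "parallelogram_perimeter a b = 2 * (norm a + norm b)"

definition is_square :: "(real^2) set \<Rightarrow> bool" where
  "is_square P \<longleftrightarrow>
     (\<exists>p a b. P = parallelogram p a b \<and> a \<noteq> 0 \<and> norm a = norm b \<and> a \<bullet> b = 0)"

end

theory Submission
  imports Defs
begin

text \<open>In the affine coordinates \<open>(s, t)\<close> in which the parallelogram \<open>P\<close> is the unit square, the
  functions \<open>cos (m \<pi> s) cos (n \<pi> t)\<close> form a complete orthogonal system of \<open>L\<^sup>2(P)\<close>, and integration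
  by parts turns weak derivatives of \<open>u\<close> into multiples of its Fourier coefficients. Hence all modes
  outside a finite set are controlled by the Dirichlet energy. This compactness shows that the
  Rayleigh quotient has a minimizer among functions of mean zero, so \<open>\<mu>\<^sub>2(P)\<close> is that minimum, and on a
  square of side \<open>l\<close> it gives the sharp bound \<open>\<mu>\<^sub>2 \<ge> \<pi>\<^sup>2 / l\<^sup>2\<close>. The upper bound follows by testing with
  affine functions if \<open>P\<close> is far from a square and with \<open>x cos (\<pi> s) + y cos (\<pi> t)\<close> otherwise.
  A square satisfies equality whatever sides \<open>a\<close>, \<open>b\<close> describe it: its area \<open>l\<^sup>2\<close> is at most
  \<open>|a| |b| \<le> (|a| + |b|)\<^sup>2 / 4\<close>.\<close>

section \<open>Square-integrable functions\<close>

text \<open>Products of cosines are Neumann eigenfunctions only on rectangles. On a general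
  parallelogram they merely serve as an orthogonal system in which the derivatives of
  \<open>u\<close> along the two sides, \<open>g \<bullet> a\<close> and
  \<open>g \<bullet> b\<close>, have computable coefficients. The obstacle is the boundary: a weak
  gradient may be tested only with functions compactly supported in \<open>P\<close>, whereas the
  cosines reach the boundary. For the derivative along \<open>a\<close> the partner of cos (m pi s)
  cos (n pi t) is sin (m pi s) cos (n pi t). It vanishes to first order on the sides s = 0 and s =
  1, so it absorbs the blow-up of the derivative of a cutoff in s. On the other two sides it does
  not vanish, but \<open>a\<close> is parallel to them, so the cutoff in t is never differentiated.
  Hence neither traces nor approximation by functions smooth up to the boundary enter. Neither trial
  family suffices alone. On a square of side l affine functions give only 12 / l^2, which exceeds
  pi^2 / l^2; for strongly sheared parallelograms the mixed term 8 of the trigonometric family is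
  too small against pi^2 and its bound blows up after division by the squared area.\<close>

lemma L2_inner_integrable:
  assumes "L2 \<Omega> u" "L2 \<Omega> v"
  shows "integrable (lebesgue_on \<Omega>) (\<lambda>x. u x \<bullet> v x)"
proof (rule Bochner_Integration.integrable_bound)
  show "integrable (lebesgue_on \<Omega>) (\<lambda>x. (norm (u x))\<^sup>2 + (norm (v x))\<^sup>2)"
    using assms by (auto simp: L2_def)
  show "(\<lambda>x. u x \<bullet> v x) \<in> borel_measurable (lebesgue_on \<Omega>)"
    using assms by (auto simp: L2_def)
  have "\<bar>a \<bullet> b\<bar> \<le> (norm a)\<^sup>2 + (norm b)\<^sup>2" for a b :: 'b
  proof -
    have "\<bar>a \<bullet> b\<bar> \<le> norm a * norm b" by (rule Cauchy_Schwarz_ineq2)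
    also have "\<dots> \<le> (norm a)\<^sup>2 + (norm b)\<^sup>2"
      using sum_squares_bound[of "norm a" "norm b"]
        mult_nonneg_nonneg[OF norm_ge_zero[of a] norm_ge_zero[of b]] by linarith
    finally show ?thesis .
  qed
  then show "AE x in lebesgue_on \<Omega>. norm (u x \<bullet> v x) \<le> norm ((norm (u x))\<^sup>2 + (norm (v x))\<^sup>2)"
    by (simp add: abs_of_nonneg)
qed

lemma L2_mult_integrable:
  fixes u v :: "'a::euclidean_space \<Rightarrow> real"
  assumes "L2 \<Omega> u" "L2 \<Omega> v"
  shows "integrable (lebesgue_on \<Omega>) (\<lambda>x. u x * v x)"
  using L2_inner_integrable[OF assms] by (simp add: inner_real_def)

lemma L2_dominated:
  fixes v :: "'a::euclidean_space \<Rightarrow> 'b::euclidean_space"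
  assumes "v \<in> borel_measurable (lebesgue_on \<Omega>)" "integrable (lebesgue_on \<Omega>) w"
    "\<And>x. (norm (v x))\<^sup>2 \<le> w x"
  shows "L2 \<Omega> v"
  unfolding L2_def
proof
  show "integrable (lebesgue_on \<Omega>) (\<lambda>x. (norm (v x))\<^sup>2)"
  proof (rule Bochner_Integration.integrable_bound[OF assms(2)])
    show "AE x in lebesgue_on \<Omega>. norm ((norm (v x))\<^sup>2) \<le> norm (w x)"
      using assms(3) by (intro AE_I2) (auto intro: order_trans[OF _ abs_ge_self])
  qed (use assms(1) in measurable)
qed (rule assms(1))

lemma L2_add:
  assumes "L2 \<Omega> u" "L2 \<Omega> v"
  shows "L2 \<Omega> (\<lambda>x. u x + v x)"
proof (rule L2_dominated)
  show "integrable (lebesgue_on \<Omega>) (\<lambda>x. 2 * (norm (u x))\<^sup>2 + 2 * (norm (v x))\<^sup>2)"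
    using assms by (auto simp: L2_def)
  show "(norm (u x + v x))\<^sup>2 \<le> 2 * (norm (u x))\<^sup>2 + 2 * (norm (v x))\<^sup>2" for x
    using inner_ge_zero[of "u x - v x"]
    by (simp add: power2_norm_eq_inner inner_simps inner_commute)
qed (use assms in \<open>auto simp: L2_def\<close>)

lemma L2_scaleR:
  assumes "L2 \<Omega> u"
  shows "L2 \<Omega> (\<lambda>x. c *\<^sub>R u x)"
  using assms by (auto simp: L2_def power_mult_distrib)

lemma L2_cmult:
  fixes u :: "'a::euclidean_space \<Rightarrow> real"
  assumes "L2 \<Omega> u"
  shows "L2 \<Omega> (\<lambda>x. c * u x)"
  using L2_scaleR[OF assms, of c] by simp

lemma L2_diff:
  assumes "L2 \<Omega> u" "L2 \<Omega> v"
  shows "L2 \<Omega> (\<lambda>x. u x - v x)"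
  using L2_add[OF assms(1) L2_scaleR[OF assms(2), of "-1"]] by simp

lemma L2_zero: "L2 \<Omega> (\<lambda>x. 0)"
  by (simp add: L2_def)

lemma L2_sum:
  assumes "\<And>i. i \<in> I \<Longrightarrow> L2 \<Omega> (u i)"
  shows "L2 \<Omega> (\<lambda>x. \<Sum>i\<in>I. u i x)"
  using assms by (induction I rule: infinite_finite_induct) (auto intro: L2_add L2_zero)

lemma L2_inner_const:
  assumes "L2 \<Omega> u"
  shows "L2 \<Omega> (\<lambda>x. u x \<bullet> a)"
proof (rule L2_dominated)
  show "integrable (lebesgue_on \<Omega>) (\<lambda>x. (norm (u x))\<^sup>2 * (norm a)\<^sup>2)"
    using assms by (auto simp: L2_def)
  show "(norm (u x \<bullet> a))\<^sup>2 \<le> (norm (u x))\<^sup>2 * (norm a)\<^sup>2" for x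
    using Cauchy_Schwarz_ineq[of "u x" a] by (simp add: power2_norm_eq_inner)
qed (use assms in \<open>auto simp: L2_def\<close>)

lemma L2_bounded:
  assumes "\<Omega> \<in> lmeasurable" "u \<in> borel_measurable (lebesgue_on \<Omega>)" "\<And>x. x \<in> \<Omega> \<Longrightarrow> norm (u x) \<le> B"
  shows "L2 \<Omega> u"
  unfolding L2_def
proof
  interpret finite_measure "lebesgue_on \<Omega>"
    using assms(1) by (rule finite_measure_lebesgue_on)
  show "integrable (lebesgue_on \<Omega>) (\<lambda>x. (norm (u x))\<^sup>2)"
    by (rule integrable_const_bound[of _ "B\<^sup>2"])
      (use assms(2,3) in \<open>auto intro!: AE_I2 power_mono\<close>)
qed (rule assms(2))

lemma L2_integrable:
  assumes "\<Omega> \<in> lmeasurable" "L2 \<Omega> u"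
  shows "integrable (lebesgue_on \<Omega>) u"
proof (rule Bochner_Integration.integrable_bound)
  interpret finite_measure "lebesgue_on \<Omega>"
    using assms(1) by (rule finite_measure_lebesgue_on)
  show "integrable (lebesgue_on \<Omega>) (\<lambda>x. 1 + (norm (u x))\<^sup>2)"
    using assms(2) by (auto simp: L2_def)
  have "r \<le> 1 + r\<^sup>2" for r :: real
    using zero_le_power2[of "r - 1/2"] by (simp add: power2_eq_square algebra_simps)
  then show "AE x in lebesgue_on \<Omega>. norm (u x) \<le> norm (1 + (norm (u x))\<^sup>2)"
    by (intro AE_I2) (simp add: abs_of_nonneg add_nonneg_nonneg)
qed (use assms(2) in \<open>auto simp: L2_def\<close>)

text \<open>Monotone convergence identifies the integral of the sum of the norms with the sum of the
  L1 norms; being finite, it forces the sum to be finite almost everywhere.\<close>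

lemma AE_summable_norm:
  fixes d :: "nat \<Rightarrow> 'a \<Rightarrow> 'b::{banach, second_countable_topology}"
  assumes "\<And>k. integrable M (d k)" "summable (\<lambda>k. LINT x|M. norm (d k x))"
  shows "AE x in M. summable (\<lambda>k. norm (d k x))"
proof -
  have [measurable]: "d k \<in> borel_measurable M" for k
    using assms(1) by auto
  have "(\<integral>\<^sup>+x. (\<Sum>k. ennreal (norm (d k x))) \<partial>M) = (\<Sum>k. \<integral>\<^sup>+x. ennreal (norm (d k x)) \<partial>M)"
    by (rule nn_integral_suminf) measurable
  also have "\<dots> = (\<Sum>k. ennreal (LINT x|M. norm (d k x)))"
    using assms(1) by (intro suminf_cong nn_integral_eq_integral) auto
  also have "\<dots> = ennreal (\<Sum>k. LINT x|M. norm (d k x))"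
    by (rule suminf_ennreal2) (auto simp: assms(2))
  finally have "(\<integral>\<^sup>+x. (\<Sum>k. ennreal (norm (d k x))) \<partial>M) \<noteq> \<infinity>" by simp
  then have "AE x in M. (\<Sum>k. ennreal (norm (d k x))) \<noteq> \<infinity>"
    by (intro nn_integral_PInf_AE) auto
  then show ?thesis
    by eventually_elim (rule summable_suminf_not_top, auto)
qed

text \<open>Riesz-Fischer: a rapidly Cauchy subsequence converges almost everywhere by telescoping,
  and Fatou's lemma turns the Cauchy estimate into an estimate against the pointwise limit.\<close>

lemma L2_complete:
  fixes u :: "nat \<Rightarrow> 'a::euclidean_space \<Rightarrow> 'b::euclidean_space"
  assumes \<Omega>: "\<Omega> \<in> lmeasurable" and u: "\<And>k. L2 \<Omega> (u k)"
    and cauchy: "\<And>e. e > 0 \<Longrightarrow>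
      \<exists>N. \<forall>m\<ge>N. \<forall>n\<ge>N. (LINT x|lebesgue_on \<Omega>. (norm (u m x - u n x))\<^sup>2) < e"
  obtains v where "L2 \<Omega> v" "(\<lambda>n. LINT x|lebesgue_on \<Omega>. (norm (u n x - v x))\<^sup>2) \<longlonglongrightarrow> 0"
proof -
  let ?M = "lebesgue_on \<Omega>"
  interpret finite_measure ?M
    using \<Omega> by (rule finite_measure_lebesgue_on)
  have [measurable]: "u k \<in> borel_measurable ?M" for k
    using u by (auto simp: L2_def)
  have "\<exists>N. \<forall>m\<ge>N. \<forall>n\<ge>N. (LINT x|?M. (norm (u m x - u n x))\<^sup>2) < (1/4)^k" for k
    by (rule cauchy) simp
  then obtain N where N: "\<And>k m n. m \<ge> N k \<Longrightarrow> n \<ge> N k \<Longrightarrow>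
      (LINT x|?M. (norm (u m x - u n x))\<^sup>2) < (1/4::real)^k"
    by metis
  \<comment> \<open>The sum makes \<open>r\<close> monotone and at least \<open>N k\<close>; the
    summand \<open>k\<close> forces the indices to infinity.\<close>
  define r where "r k = (\<Sum>i\<le>k. N i) + k" for k :: nat
  have rN: "N k \<le> r k" for k
    unfolding r_def using member_le_sum[of k "{..k}" N] by auto
  have r_mono: "r k \<le> r (Suc k)" for k
    by (simp add: r_def)
  have r_ge: "k \<le> r k" for k
    by (simp add: r_def)
  define d where "d k x = u (r (Suc k)) x - u (r k) x" for k x
  have dL2: "L2 \<Omega> (d k)" for k
    unfolding d_def by (intro L2_diff u)
  have d_int: "integrable ?M (d k)" for k
    by (rule L2_integrable[OF \<Omega> dL2])
  have d_le: "(LINT x|?M. norm (d k x)) \<le> (1 + measure ?M (space ?M)) * (1/2)^k" for k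
  proof -
    \<comment> \<open>Young's inequality with weight 2^k: the squares integrate to less than 4^(-k)
      and the measure is finite, so both resulting terms are of order 2^(-k).\<close>
    have pw: "norm (d k x) \<le> 2^k * (norm (d k x))\<^sup>2 + (1/2)^k" for x
    proof -
      let ?p = "norm (d k x)" and ?t = "2^k :: real"
      have "0 \<le> (?t * ?p - 1/2)\<^sup>2" by simp
      then have "?t * ?p \<le> ?t * (?t * ?p\<^sup>2 + (1/2)^k)"
        by (simp add: power2_eq_square algebra_simps power_divide)
      then show ?thesis by simp
    qed
    have sq: "integrable ?M (\<lambda>x. (norm (d k x))\<^sup>2)"
      using dL2 by (auto simp: L2_def)
    have "(LINT x|?M. norm (d k x)) \<le> (LINT x|?M. 2^k * (norm (d k x))\<^sup>2 + (1/2)^k)"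
      using d_int sq pw by (intro integral_mono) auto
    also have "\<dots> = 2^k * (LINT x|?M. (norm (d k x))\<^sup>2) + measure ?M (space ?M) * (1/2)^k"
      using sq by simp
    also have "\<dots> \<le> 2^k * (1/4)^k + measure ?M (space ?M) * (1/2)^k"
      using N[of k "r (Suc k)" "r k"] rN[of k] r_mono[of k]
      by (intro add_mono mult_left_mono) (auto simp: d_def intro: less_imp_le)
    also have "2^k * (1/4)^k = (1/2::real)^k"
      by (simp flip: power_mult_distrib)
    finally show ?thesis by (simp add: algebra_simps)
  qed
  have "summable (\<lambda>k. (1 + measure ?M (space ?M)) * (1/2::real)^k)"
    by (intro summable_mult summable_geometric) simp
  then have "summable (\<lambda>k. LINT x|?M. norm (d k x))"
    by (rule summable_comparison_test'[where N = 0]) (use d_le in auto)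
  then have "AE x in ?M. summable (\<lambda>k. norm (d k x))"
    by (intro AE_summable_norm d_int)
  then have conv: "AE x in ?M. convergent (\<lambda>k. u (r k) x)"
  proof eventually_elim
    case (elim x)
    have "summable (\<lambda>k. d k x)" using elim by (rule summable_norm_cancel)
    then have "convergent (\<lambda>k. \<Sum>i<k. d i x)" by (simp add: summable_iff_convergent)
    moreover have "(\<Sum>i<k. d i x) = u (r k) x - u (r 0) x" for k
      unfolding d_def by (rule sum_lessThan_telescope)
    ultimately have "convergent (\<lambda>k. u (r k) x - u (r 0) x)" by simp
    then have "convergent (\<lambda>k. (u (r k) x - u (r 0) x) + u (r 0) x)"
      by (rule convergent_add) (rule convergent_const)
    then show ?case by simp
  qed
  \<comment> \<open>Where the subsequence diverges, \<open>lim\<close> has an arbitrary value; this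
    concerns a null set only.\<close>
  define v where "v x = lim (\<lambda>k. u (r k) x)" for x
  have [measurable]: "v \<in> borel_measurable ?M"
    unfolding v_def by (rule borel_measurable_lim_metric) measurable
  have fatou: "L2 \<Omega> (\<lambda>x. u n x - v x) \<and> (LINT x|?M. (norm (u n x - v x))\<^sup>2) \<le> e"
    if e: "e > 0" and n: "\<And>m. m \<ge> K \<Longrightarrow> (LINT x|?M. (norm (u n x - u m x))\<^sup>2) < e" for n K e
  proof -
    have "(\<integral>\<^sup>+x. ennreal ((norm (u n x - v x))\<^sup>2) \<partial>?M)
        = (\<integral>\<^sup>+x. liminf (\<lambda>k. ennreal ((norm (u n x - u (r k) x))\<^sup>2)) \<partial>?M)"
    proof (rule nn_integral_cong_AE, use conv in eventually_elim)
      case (elim x)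
      have "(\<lambda>k. u (r k) x) \<longlonglongrightarrow> v x"
        unfolding v_def using elim by (simp add: convergent_LIMSEQ_iff)
      then have "(\<lambda>k. ennreal ((norm (u n x - u (r k) x))\<^sup>2)) \<longlonglongrightarrow> ennreal ((norm (u n x - v x))\<^sup>2)"
        by (intro tendsto_intros tendsto_ennrealI)
      from lim_imp_Liminf[OF trivial_limit_sequentially this] show ?case
        by (rule sym)
    qed
    also have "\<dots> \<le> liminf (\<lambda>k. \<integral>\<^sup>+x. ennreal ((norm (u n x - u (r k) x))\<^sup>2) \<partial>?M)"
      by (rule nn_integral_liminf) measurable
    also have "\<dots> \<le> liminf (\<lambda>k. ennreal e)"
    proof (rule Liminf_mono, rule eventually_sequentiallyI[of K])
      fix k assume "K \<le> k"
      have "integrable ?M (\<lambda>x. (norm (u n x - u (r k) x))\<^sup>2)"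
        using L2_diff[OF u[of n] u[of "r k"]] by (auto simp: L2_def)
      then have "(\<integral>\<^sup>+x. ennreal ((norm (u n x - u (r k) x))\<^sup>2) \<partial>?M)
          = ennreal (LINT x|?M. (norm (u n x - u (r k) x))\<^sup>2)"
        by (rule nn_integral_eq_integral) simp
      also have "\<dots> \<le> ennreal e"
        using n[of "r k"] r_ge[of k] \<open>K \<le> k\<close> by (intro ennreal_leI) auto
      finally show "(\<integral>\<^sup>+x. ennreal ((norm (u n x - u (r k) x))\<^sup>2) \<partial>?M) \<le> ennreal e" .
    qed
    also have "\<dots> = ennreal e"
      by (simp add: Liminf_const)
    finally have le: "(\<integral>\<^sup>+x. ennreal ((norm (u n x - v x))\<^sup>2) \<partial>?M) \<le> ennreal e" .
    then have "(\<integral>\<^sup>+x. ennreal ((norm (u n x - v x))\<^sup>2) \<partial>?M) < \<infinity>"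
      by (rule le_less_trans) simp
    then have int: "integrable ?M (\<lambda>x. (norm (u n x - v x))\<^sup>2)"
      by (intro integrableI_bounded) auto
    then have "ennreal (LINT x|?M. (norm (u n x - v x))\<^sup>2) \<le> ennreal e"
      using le by (subst (asm) nn_integral_eq_integral) auto
    then show ?thesis
      using int e by (auto simp: L2_def)
  qed
  obtain K where K: "\<forall>m\<ge>K. \<forall>n\<ge>K. (LINT x|?M. (norm (u m x - u n x))\<^sup>2) < 1"
    using cauchy[of 1] by auto
  have "L2 \<Omega> (\<lambda>x. u K x - v x)"
    using fatou[of 1 K K] K by auto
  from L2_diff[OF u[of K] this] have vL2: "L2 \<Omega> v" by simp
  have "(\<lambda>n. LINT x|?M. (norm (u n x - v x))\<^sup>2) \<longlonglongrightarrow> 0"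
  proof (rule LIMSEQ_I)
    fix e :: real assume "e > 0"
    then obtain K where K: "\<forall>m\<ge>K. \<forall>n\<ge>K. (LINT x|?M. (norm (u m x - u n x))\<^sup>2) < e/2"
      using cauchy[of "e/2"] by auto
    have "(LINT x|?M. (norm (u n x - v x))\<^sup>2) < e" if "n \<ge> K" for n
      using fatou[of "e/2" K n] K that \<open>e > 0\<close> by auto
    then show "\<exists>K. \<forall>n\<ge>K. norm ((LINT x|?M. (norm (u n x - v x))\<^sup>2) - 0) < e"
      by (intro exI[of _ K]) (auto simp: abs_of_nonneg)
  qed
  with vL2 show ?thesis by (rule that)
qed

section \<open>Smooth cutoff functions\<close>

lemma GDERIV_imp_continuous_on:
  assumes "\<And>x. GDERIV f x :> Df x"
  shows "continuous_on S f"
  using assms unfolding gderiv_def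
  by (meson has_derivative_continuous continuous_at_imp_continuous_on)

lemma C_k_Suc_imp: "C_k (Suc k) f \<Longrightarrow> C_k k f"
proof (induction k arbitrary: f)
  case 0
  then show ?case by (auto intro: GDERIV_imp_continuous_on)
next
  case (Suc k)
  then obtain Df where "\<forall>x. GDERIV f x :> Df x" "\<forall>b\<in>Basis. C_k (Suc k) (\<lambda>x. Df x \<bullet> b)"
    unfolding C_k.simps(2)[of "Suc k" f] by blast
  then show ?case
    unfolding C_k.simps(2)[of k f] using Suc.IH by blast
qed

lemma C_k_const: "C_k k (\<lambda>x. c)"
proof (induction k arbitrary: c)
  case (Suc k)
  have "GDERIV (\<lambda>x. c) x :> 0" for x :: 'a by (rule GDERIV_const)
  then show ?case using Suc.IH by (auto intro!: exI[of _ "\<lambda>x. 0"])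
qed simp

lemma C_k_add: "C_k k f \<Longrightarrow> C_k k g \<Longrightarrow> C_k k (\<lambda>x. f x + g x)"
proof (induction k arbitrary: f g)
  case (Suc k)
  then obtain Df Dg where "\<forall>x. GDERIV f x :> Df x" "\<forall>b\<in>Basis. C_k k (\<lambda>x. Df x \<bullet> b)"
     "\<forall>x. GDERIV g x :> Dg x" "\<forall>b\<in>Basis. C_k k (\<lambda>x. Dg x \<bullet> b)"
    unfolding C_k.simps by blast
  then show ?case
    unfolding C_k.simps
    by (intro exI[of _ "\<lambda>x. Df x + Dg x"]) (auto intro!: GDERIV_add Suc.IH simp: inner_add_left)
qed (auto intro: continuous_on_add)

lemma C_k_mult: "C_k k f \<Longrightarrow> C_k k g \<Longrightarrow> C_k k (\<lambda>x. f x * g x)"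
proof (induction k arbitrary: f g)
  case (Suc k)
  then obtain Df Dg where "\<forall>x. GDERIV f x :> Df x" "\<forall>b\<in>Basis. C_k k (\<lambda>x. Df x \<bullet> b)"
     "\<forall>x. GDERIV g x :> Dg x" "\<forall>b\<in>Basis. C_k k (\<lambda>x. Dg x \<bullet> b)"
    unfolding C_k.simps by blast
  moreover have "C_k k f" "C_k k g"
    using Suc.prems by (auto intro: C_k_Suc_imp simp del: C_k.simps)
  ultimately show ?case
    unfolding C_k.simps
    by (intro exI[of _ "\<lambda>x. f x *\<^sub>R Dg x + g x *\<^sub>R Df x"])
      (auto intro!: GDERIV_mult Suc.IH C_k_add simp: inner_add_left)
qed (auto intro: continuous_on_mult)

lemma C_k_cmult: "C_k k f \<Longrightarrow> C_k k (\<lambda>x. c * f x)"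
  by (intro C_k_mult C_k_const)

lemma GDERIV_real_iff:
  "GDERIV f x :> D \<longleftrightarrow> (f has_real_derivative D) (at x)"
  by (simp add: gderiv_def has_field_derivative_def mult.commute[of D])

lemma C_k_SucI:
  fixes f :: "real \<Rightarrow> real"
  assumes "\<And>x. (f has_real_derivative f' x) (at x)" "C_k k f'"
  shows "C_k (Suc k) f"
  using assms by (auto simp: GDERIV_real_iff)

lemma GDERIV_compose_inner:
  assumes "(f has_real_derivative d) (at ((x - p) \<bullet> v))"
  shows "GDERIV (\<lambda>x. f ((x - p) \<bullet> v)) x :> d *\<^sub>R v"
proof -
  have "GDERIV (\<lambda>x. (x - p) \<bullet> v) x :> v"
    unfolding gderiv_def by (auto intro!: derivative_eq_intros)
  from GDERIV_DERIV_compose[OF this assms] show ?thesis .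
qed

lemma C_k_compose_inner:
  "C_k k f \<Longrightarrow> C_k k (\<lambda>x. f ((x - p) \<bullet> v))"
proof (induction k arbitrary: f)
  case 0
  then show ?case
    by (auto intro!: continuous_intros continuous_on_compose2[of UNIV f])
next
  case (Suc k)
  then obtain f' where f': "\<And>x. (f has_real_derivative f' x) (at x)" "C_k k f'"
    by (auto simp: GDERIV_real_iff)
  then show ?case
    unfolding C_k.simps
    by (intro exI[of _ "\<lambda>x. f' ((x - p) \<bullet> v) *\<^sub>R v"])
      (auto intro!: GDERIV_compose_inner C_k_mult C_k_const Suc.IH)
qed

text \<open>Sine and cosine are combined with arbitrary coefficients so that the family is closed
  under differentiation, as the induction requires.\<close>

lemma C_k_trig:
  fixes A B c :: real
  shows "C_k k (\<lambda>x. A * sin (c * x) + B * cos (c * x))"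
proof (induction k arbitrary: A B)
  case 0
  show ?case by (auto intro!: continuous_intros)
next
  case (Suc k)
  show ?case
  proof (rule C_k_SucI[OF _ Suc.IH[of "- (c * B)" "c * A"]])
    show "((\<lambda>x. A * sin (c * x) + B * cos (c * x)) has_real_derivative
        - (c * B) * sin (c * x) + c * A * cos (c * x)) (at x)" for x
      by (auto intro!: derivative_eq_intros simp: algebra_simps)
  qed
qed

lemma C_k_affine:
  fixes f :: "real \<Rightarrow> real"
  shows "C_k k f \<Longrightarrow> C_k k (\<lambda>x. f (c * x + d))"
proof (induction k arbitrary: f)
  case 0
  then show ?case
    by (auto intro!: continuous_intros continuous_on_compose2[of UNIV f])
next
  case (Suc k)
  then obtain f' where f': "\<And>x. (f has_real_derivative f' x) (at x)" "C_k k f'"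
    by (auto simp: GDERIV_real_iff)
  show ?case
  proof (rule C_k_SucI[OF _ C_k_cmult[OF Suc.IH[OF f'(2)], of c]])
    show "((\<lambda>x. f (c * x + d)) has_real_derivative c * f' (c * x + d)) (at x)" for x
      by (rule DERIV_cong[OF DERIV_chain2[OF f'(1)]])
        (auto intro!: derivative_eq_intros)
  qed
qed

text \<open>The classical smooth function exp (-1/y) extended by 0, with an extra pole of order
  \<open>n\<close>. Derivatives of members are linear combinations of members, so smoothness of all
  of them is a single induction.\<close>

definition flat :: "nat \<Rightarrow> real \<Rightarrow> real" where
  "flat n y = (if y > 0 then exp (- (1 / y)) / y ^ n else 0)"

lemma flat_nonneg: "0 \<le> flat n y"
  by (simp add: flat_def)

lemma power_le_fact_exp:
  fixes z :: real
  assumes "0 \<le> z"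
  shows "z ^ n \<le> fact n * exp z"
proof -
  have "(\<Sum>i\<in>{n}. z ^ i /\<^sub>R fact i) \<le> (\<Sum>i. z ^ i /\<^sub>R fact i)"
    using assms by (intro sum_le_suminf summable_exp_generic) auto
  then have "z ^ n / fact n \<le> exp z"
    by (simp add: exp_def divide_inverse mult.commute)
  then show ?thesis by (simp add: field_simps)
qed

text \<open>With z = 1/y, a single term of the exponential series beats any power of z. So
  \<open>flat n\<close> vanishes to every order at 0; order \<open>k = 2\<close> yields the
  derivative there.\<close>

lemma flat_le:
  assumes "0 < y"
  shows "flat n y \<le> fact (n + k) * y ^ k"
proof -
  have "(1 / y) ^ (n + k) \<le> fact (n + k) * exp (1 / y)"
    using assms by (intro power_le_fact_exp) auto
  then have "exp (- (1 / y)) / y ^ n \<le> fact (n + k) * y ^ k"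
    using assms by (simp add: exp_minus field_simps power_add)
  with assms show ?thesis by (simp add: flat_def)
qed

lemma flat_DERIV:
  "(flat n has_real_derivative flat (n + 2) y - real n * flat (n + 1) y) (at y)"
proof -
  consider "y < 0" | "y = 0" | "y > 0" by linarith
  then show ?thesis
  proof cases
    case 1
    have "((\<lambda>x. 0) has_real_derivative flat (n + 2) y - real n * flat (n + 1) y) (at y)"
      using 1 by (simp add: flat_def)
    then show ?thesis
      by (rule has_field_derivative_transform_within_open[of _ _ _ "{..<0}"])
        (use 1 in \<open>auto simp: flat_def\<close>)
  next
    case 2
    have "(flat n has_real_derivative 0) (at 0)"
      unfolding has_field_derivative_iff
    proof (rule Lim_null_comparison)
      show "\<forall>\<^sub>F h in at 0. norm ((flat n h - flat n 0) / (h - 0)) \<le> fact (n + 2) * \<bar>h\<bar>"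
      proof (rule eventually_at_filter[THEN iffD2], rule always_eventually, intro allI impI)
        fix h :: real assume "h \<noteq> 0"
        have "flat n h \<le> fact (n + 2) * \<bar>h\<bar> ^ 2"
          using flat_le[of h n 2] by (cases "h > 0") (auto simp: flat_def)
        then have "\<bar>flat n h\<bar> / \<bar>h\<bar> \<le> fact (n + 2) * \<bar>h\<bar>"
          using \<open>h \<noteq> 0\<close> flat_nonneg[of n h]
          by (simp add: divide_le_eq power2_eq_square mult.assoc)
        then show "norm ((flat n h - flat n 0) / (h - 0)) \<le> fact (n + 2) * \<bar>h\<bar>"
          by (simp add: flat_def)
      qed
      show "((\<lambda>h. fact (n + 2) * \<bar>h\<bar>) \<longlongrightarrow> (0::real)) (at 0)"
        by (auto intro!: tendsto_eq_intros)
    qed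
    with 2 show ?thesis by (simp add: flat_def)
  next
    case 3
    have "((\<lambda>y. exp (- inverse y) * inverse y ^ n) has_real_derivative
        flat (n + 2) y - real n * flat (n + 1) y) (at y)"
    proof (rule DERIV_cong)
      show "((\<lambda>y. exp (- inverse y) * inverse y ^ n) has_real_derivative
        exp (- inverse y) * (inverse y * inverse y) * inverse y ^ n
        - real n * inverse y ^ (n - 1) * (inverse y * inverse y) * exp (- inverse y)) (at y)"
        using 3 by (auto intro!: derivative_eq_intros simp: algebra_simps)
      \<comment> \<open>The case split on \<open>n\<close> is due to the truncated
        \<open>n - 1\<close>; for \<open>n = 0\<close> the factor \<open>real n\<close> removes that
        term.\<close>
      show "exp (- inverse y) * (inverse y * inverse y) * inverse y ^ n
        - real n * inverse y ^ (n - 1) * (inverse y * inverse y) * exp (- inverse y)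
        = flat (n + 2) y - real n * flat (n + 1) y"
        using 3 by (cases n) (simp_all add: flat_def divide_inverse power_inverse algebra_simps)
    qed
    then have "((\<lambda>y. exp (- (1 / y)) / y ^ n) has_real_derivative
        flat (n + 2) y - real n * flat (n + 1) y) (at y)"
      by (simp add: divide_inverse power_inverse)
    then show ?thesis
      by (rule has_field_derivative_transform_within_open[of _ _ _ "{0<..}"])
        (use 3 in \<open>auto simp: flat_def\<close>)
  qed
qed

lemma C_k_flat: "C_k k (flat n)"
proof (induction k arbitrary: n)
  case 0
  show ?case
    using flat_DERIV by (auto simp: continuous_on_eq_continuous_at intro: DERIV_isCont)
next
  case (Suc k)
  have "C_k k (\<lambda>y. flat (n + 2) y + (- real n) * flat (n + 1) y)"
    by (intro C_k_add C_k_cmult Suc.IH)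
  then show ?case
    by (intro C_k_SucI[where f' = "\<lambda>y. flat (n + 2) y + (- real n) * flat (n + 1) y"])
      (use flat_DERIV in auto)
qed

text \<open>The cutoff to \<open>(0, 1)\<close> is a product of two factors \<open>flat 0 (k s - 1)\<close>, each vanishing for
  \<open>s \<le> 1/k\<close>. Instead of being constant inside it tends to 1, and \<open>s\<close> times its derivative stays
  bounded and tends to 0, which is all that the integration by parts needs.\<close>

definition cutoff :: "nat \<Rightarrow> real \<Rightarrow> real" where
  "cutoff k s = flat 0 (k * s - 1) * flat 0 (k * (1 - s) - 1)"

definition cutoff' :: "nat \<Rightarrow> real \<Rightarrow> real" where
  "cutoff' k s = k * flat 2 (k * s - 1) * flat 0 (k * (1 - s) - 1)
     - flat 0 (k * s - 1) * (k * flat 2 (k * (1 - s) - 1))"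

lemma flat_0_le_1: "flat 0 y \<le> 1"
  by (simp add: flat_def)

lemma cutoff_bounds: "0 \<le> cutoff k s" "cutoff k s \<le> 1"
  using flat_nonneg flat_0_le_1 unfolding cutoff_def
  by (auto intro!: mult_le_one)

lemma cutoff_DERIV: "(cutoff k has_real_derivative cutoff' k s) (at s)"
proof -
  have flat0: "(flat 0 has_real_derivative flat 2 y) (at y)" for y
    using flat_DERIV[of 0 y] by (simp add: numeral_2_eq_2)
  show ?thesis
    unfolding cutoff_def[abs_def] cutoff'_def
    by (auto intro!: derivative_eq_intros DERIV_chain2[OF flat0] simp: algebra_simps)
qed

lemma C_k_cutoff: "C_k j (cutoff k)"
proof -
  have "C_k j (\<lambda>s. flat 0 (real k * s + (- 1)) * flat 0 ((- real k) * s + (real k - 1)))"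
    by (intro C_k_mult C_k_affine C_k_flat)
  moreover have "cutoff k = (\<lambda>s. flat 0 (real k * s + (- 1)) * flat 0 ((- real k) * s + (real k - 1)))"
    by (auto simp: cutoff_def algebra_simps)
  ultimately show ?thesis by simp
qed

lemma cutoff_eq_0:
  assumes "s \<notin> {1 / k..1 - 1 / k}" "k > 0"
  shows "cutoff k s = 0"
proof -
  have "k * s - 1 \<le> 0 \<or> k * (1 - s) - 1 \<le> 0"
    using assms by (auto simp: field_simps)
  then show ?thesis by (auto simp: cutoff_def flat_def)
qed

lemma flat_0_tendsto: "filterlim y at_top F \<Longrightarrow> ((\<lambda>k. flat 0 (y k)) \<longlongrightarrow> 1) F"
proof -
  assume y: "filterlim y at_top F"
  have "((\<lambda>k. exp (- (1 / y k))) \<longlongrightarrow> exp (- 0)) F"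
    by (intro tendsto_intros tendsto_divide_0[OF tendsto_const] filterlim_at_top_imp_at_infinity y)
  moreover have "\<forall>\<^sub>F k in F. exp (- (1 / y k)) = flat 0 (y k)"
    using y[THEN filterlim_at_top_dense[THEN iffD1], rule_format, of 0]
    by eventually_elim (simp add: flat_def)
  ultimately show "((\<lambda>k. flat 0 (y k)) \<longlongrightarrow> 1) F"
    by (auto intro: Lim_transform_eventually)
qed

text \<open>For y = k s - 1 the factor y + 1 is k s, so the left-hand side is s times the dangerous
  factor \<open>k * flat 2 (k * s - 1)\<close> in \<open>cutoff'\<close>. The first bound gives its
  decay as k grows, the second a bound uniform in k and s.\<close>

lemma flat_2_le: "(y + 1) * flat 2 y \<le> 1 / y * (1 + 1 / y)" "(y + 1) * flat 2 y \<le> 2" if "0 < y"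
proof -
  have eq: "(y + 1) * flat 2 y = (1 / y + (1 / y)\<^sup>2) * exp (- (1 / y))"
    using that by (simp add: flat_def field_simps power2_eq_square)
  also have "\<dots> \<le> (1 / y + (1 / y)\<^sup>2) * 1"
    using that by (intro mult_left_mono) auto
  finally show "(y + 1) * flat 2 y \<le> 1 / y * (1 + 1 / y)"
    by (simp add: algebra_simps power2_eq_square)
  \<comment> \<open>The quadratic Taylor bound, doubled, dominates z + z^2 for z = 1/y.\<close>
  have "1 + 1 / y + (1 / y)\<^sup>2 / 2 \<le> exp (1 / y)"
    using that by (intro exp_lower_Taylor_quadratic) auto
  moreover have "0 < 1 / y" using that by simp
  ultimately have "1 / y + (1 / y)\<^sup>2 \<le> 2 * exp (1 / y)" by linarith
  then have "(1 / y + (1 / y)\<^sup>2) * inverse (exp (1 / y)) \<le> 2"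
    by (simp only: divide_inverse[symmetric] pos_divide_le_eq[OF exp_gt_zero])
  then show "(y + 1) * flat 2 y \<le> 2"
    unfolding eq exp_minus .
qed

lemma scaled_flat_2:
  assumes "0 \<le> s"
  shows "s * (k * flat 2 (k * s - 1)) \<le> 2"
proof (cases "k * s - 1 > 0")
  case True
  from flat_2_le(2)[OF this] show ?thesis by (simp add: mult.left_commute mult.commute)
qed (simp add: flat_def)

lemma filterlim_real_mult_minus_1:
  assumes "0 < s"
  shows "filterlim (\<lambda>k. real k * s - 1) at_top sequentially"
  using filterlim_tendsto_add_at_top[OF tendsto_const[of "-1"]
      filterlim_at_top_mult_tendsto_pos[OF tendsto_const assms filterlim_real_sequentially]]
  by (simp add: algebra_simps)

lemma scaled_flat_2_tendsto:
  assumes "0 < s"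
  shows "(\<lambda>k. s * (real k * flat 2 (real k * s - 1))) \<longlonglongrightarrow> 0"
proof (rule tendsto_sandwich)
  have lim: "filterlim (\<lambda>k. real k * s - 1) at_top sequentially"
    using assms by (rule filterlim_real_mult_minus_1)
  have pos: "\<forall>\<^sub>F k in sequentially. 0 < real k * s - 1"
    using lim unfolding filterlim_at_top_dense by blast
  show "\<forall>\<^sub>F k in sequentially. 0 \<le> s * (real k * flat 2 (real k * s - 1))"
    using assms flat_nonneg by auto
  show "\<forall>\<^sub>F k in sequentially. s * (real k * flat 2 (real k * s - 1))
      \<le> 1 / (real k * s - 1) * (1 + 1 / (real k * s - 1))"
    using pos
  proof eventually_elim
    case (elim k)
    show ?case using flat_2_le(1)[OF elim] by (simp add: algebra_simps)
  qed
  show "(\<lambda>k. 1 / (real k * s - 1) * (1 + 1 / (real k * s - 1))) \<longlonglongrightarrow> 0"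
    using tendsto_mult[OF tendsto_divide_0[OF tendsto_const[of 1] filterlim_at_top_imp_at_infinity[OF lim]]
        tendsto_add[OF tendsto_const[of 1] tendsto_divide_0[OF tendsto_const[of 1] filterlim_at_top_imp_at_infinity[OF lim]]]]
    by simp
qed simp

lemma cutoff_tendsto:
  assumes "0 < s" "s < 1"
  shows "(\<lambda>k. cutoff k s) \<longlonglongrightarrow> 1"
proof -
  have "(\<lambda>k. flat 0 (real k * s - 1) * flat 0 (real k * (1 - s) - 1)) \<longlonglongrightarrow> 1 * 1"
    by (intro tendsto_mult flat_0_tendsto) (use assms in \<open>auto intro!: filterlim_real_mult_minus_1\<close>)
  then show ?thesis by (simp add: cutoff_def)
qed

text \<open>A factor that vanishes linearly at both ends compensates the growth of
  \<open>cutoff'\<close>, which is like one over the distance to the endpoint. The explicit bound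
  serves the pointwise limit, the constant serves dominated convergence; 4 is 2 from each
  endpoint.\<close>

lemma cutoff'_bound:
  assumes "0 < s" "s < 1" "\<bar>f\<bar> \<le> C * s" "\<bar>f\<bar> \<le> C * (1 - s)"
  shows "\<bar>f * cutoff' k s\<bar> \<le> C * (s * (k * flat 2 (k * s - 1)))
    + C * ((1 - s) * (k * flat 2 (k * (1 - s) - 1)))"
    and "\<bar>f * cutoff' k s\<bar> \<le> 4 * C"
proof -
  let ?F = "k * flat 2 (k * s - 1)" and ?G = "k * flat 2 (k * (1 - s) - 1)"
  have nn: "0 \<le> ?F" "0 \<le> ?G" using flat_nonneg by auto
  have "0 \<le> C * s" using assms(3) by linarith
  then have C: "0 \<le> C" using assms(1) by (simp add: zero_le_mult_iff)
  have "\<bar>f * cutoff' k s\<bar> = \<bar>f * ?F * flat 0 (k * (1 - s) - 1) - f * ?G * flat 0 (k * s - 1)\<bar>"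
    by (simp add: cutoff'_def algebra_simps)
  also have "\<dots> \<le> \<bar>f * ?F\<bar> * flat 0 (k * (1 - s) - 1) + \<bar>f * ?G\<bar> * flat 0 (k * s - 1)"
    by (rule order_trans[OF abs_triangle_ineq4]) (simp add: abs_mult flat_nonneg)
  also have "\<dots> \<le> \<bar>f * ?F\<bar> * 1 + \<bar>f * ?G\<bar> * 1"
    by (intro add_mono mult_left_mono flat_0_le_1) auto
  also have "\<dots> = \<bar>f\<bar> * ?F + \<bar>f\<bar> * ?G"
    using nn abs_mult[of f ?F] abs_mult[of f ?G] by simp
  also have "\<dots> \<le> C * s * ?F + C * (1 - s) * ?G"
    using assms nn by (intro add_mono mult_right_mono) auto
  finally show 1: "\<bar>f * cutoff' k s\<bar> \<le> C * (s * ?F) + C * ((1 - s) * ?G)"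
    by (simp add: algebra_simps)
  have "C * (s * ?F) \<le> C * 2" "C * ((1 - s) * ?G) \<le> C * 2"
    using assms C by (intro mult_left_mono scaled_flat_2; simp)+
  with 1 show "\<bar>f * cutoff' k s\<bar> \<le> 4 * C" by linarith
qed

lemma cutoff'_tendsto:
  assumes "0 < s" "s < 1" "\<bar>f\<bar> \<le> C * s" "\<bar>f\<bar> \<le> C * (1 - s)"
  shows "(\<lambda>k. f * cutoff' k s) \<longlonglongrightarrow> 0"
proof (rule Lim_null_comparison)
  show "\<forall>\<^sub>F k in sequentially. norm (f * cutoff' k s) \<le> C * (s * (k * flat 2 (k * s - 1)))
    + C * ((1 - s) * (k * flat 2 (k * (1 - s) - 1)))"
    using cutoff'_bound(1)[OF assms] by simp
  have "(\<lambda>k. C * (s * (real k * flat 2 (real k * s - 1)))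
    + C * ((1 - s) * (real k * flat 2 (real k * (1 - s) - 1)))) \<longlonglongrightarrow> C * 0 + C * 0"
    using assms by (intro tendsto_intros scaled_flat_2_tendsto) auto
  then show "(\<lambda>k. C * (s * (real k * flat 2 (real k * s - 1)))
    + C * ((1 - s) * (real k * flat 2 (real k * (1 - s) - 1)))) \<longlonglongrightarrow> 0" by simp
qed

section \<open>Coordinates on a parallelogram\<close>

lemma parallelogram_eq_image:
  "parallelogram p a b = (+) p ` ((\<lambda>x::real^2. x$1 *\<^sub>R a + x$2 *\<^sub>R b) ` box 0 1)"
proof (intro equalityI subsetI)
  fix y assume "y \<in> parallelogram p a b"
  then obtain s t where y: "y = p + s *\<^sub>R a + t *\<^sub>R b" and st: "0 < s" "s < 1" "0 < t" "t < 1"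
    unfolding parallelogram_def by blast
  let ?x = "vector [s, t] :: real^2"
  have "?x \<in> box 0 1"
    using st by (auto simp: mem_box_cart forall_2)
  moreover have "y = p + (?x$1 *\<^sub>R a + ?x$2 *\<^sub>R b)"
    by (simp add: y add.assoc)
  ultimately show "y \<in> (+) p ` ((\<lambda>x::real^2. x$1 *\<^sub>R a + x$2 *\<^sub>R b) ` box 0 1)"
    by blast
next
  fix y assume "y \<in> (+) p ` ((\<lambda>x::real^2. x$1 *\<^sub>R a + x$2 *\<^sub>R b) ` box 0 1)"
  then obtain x :: "real^2" where x: "x \<in> box 0 1" "y = p + x$1 *\<^sub>R a + x$2 *\<^sub>R b"
    by (auto simp: add.assoc)
  moreover have "0 < x$1" "x$1 < 1" "0 < x$2" "x$2 < 1"
    using x(1) by (auto simp: mem_box_cart)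
  ultimately show "y \<in> parallelogram p a b"
    unfolding parallelogram_def by blast
qed

lemma inner_Basis_one_cart: "b \<in> Basis \<Longrightarrow> (1::real^'n) \<bullet> b = 1"
  by (auto simp: Basis_vec_def inner_axis)

lemma linear_coords: "linear (\<lambda>x::real^2. x$1 *\<^sub>R a + x$2 *\<^sub>R b)"
  by (auto intro!: linearI simp: algebra_simps)

lemma parallelogram_lmeasurable: "parallelogram p a b \<in> lmeasurable"
  unfolding parallelogram_eq_image
  by (intro measurable_translation measurable_linear_image linear_coords) auto

lemma measure_parallelogram:
  "measure lebesgue (parallelogram p a b) = \<bar>a$1 * b$2 - a$2 * b$1\<bar>"
proof -
  have "det (matrix (\<lambda>x::real^2. x$1 *\<^sub>R a + x$2 *\<^sub>R b)) = a$1 * b$2 - a$2 * b$1"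
    by (simp add: det_2 matrix_def axis_def)
  moreover have "measure lebesgue (box 0 (1::real^2)) = 1"
    by (simp add: measure_lborel_box_eq inner_Basis_one_cart)
  ultimately show ?thesis
    unfolding parallelogram_eq_image measure_translation
    by (simp add: measure_linear_image linear_coords)
qed

text \<open>Lagrange's identity: the squared area is the Gram determinant of the sides. This form
  lets the areas computed from two descriptions of the same set be compared through lengths and
  angles.\<close>

lemma measure_parallelogram_sq:
  "(measure lebesgue (parallelogram p a b))\<^sup>2 = (norm a)\<^sup>2 * (norm b)\<^sup>2 - (a \<bullet> b)\<^sup>2"
  unfolding measure_parallelogram power2_norm_eq_inner
  by (simp add: inner_vec_def sum_2 power2_eq_square algebra_simps)

lemma L2_continuous:
  fixes F :: "'a::euclidean_space \<Rightarrow> 'b::euclidean_space"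
  assumes "\<Omega> \<in> lmeasurable" "bounded \<Omega>" "continuous_on UNIV F"
  shows "L2 \<Omega> F"
proof -
  have "compact (F ` closure \<Omega>)"
    using assms by (intro compact_continuous_image) (auto intro: continuous_on_subset)
  then obtain B where B: "\<And>y. y \<in> F ` closure \<Omega> \<Longrightarrow> norm y \<le> B"
    using compact_imp_bounded bounded_iff by metis
  show ?thesis
  proof (rule L2_bounded[OF assms(1)])
    have "F \<in> borel_measurable borel"
      using assms(3) by (rule borel_measurable_continuous_onI)
    then have "F \<in> borel_measurable lebesgue"
      by (simp add: measurable_completion)
    then show "F \<in> borel_measurable (lebesgue_on \<Omega>)"
      by (rule measurable_restrict_space1)
    show "norm (F x) \<le> B" if "x \<in> \<Omega>" for x
      using B that closure_subset by blast
  qed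
qed

lemma integral_unit_square:
  fixes f h :: "real \<Rightarrow> real"
  assumes f: "continuous_on UNIV f" and h: "continuous_on UNIV h"
  shows "(LINT y|lborel. indicator ({0<..<1} \<times> {0<..<1}) y * (f (fst y) * h (snd y)))
    = integral {0..1} f * integral {0..1} h"
proof -
  have one: "(LINT x|lborel. indicator {0<..<1} x * g x) = integral {0..1} g"
    if "continuous_on UNIV g" for g :: "real \<Rightarrow> real"
  proof -
    have "set_integrable lborel {0..1} g"
      using that by (intro borel_integrable_atLeastAtMost') (auto intro: continuous_on_subset)
    then have "set_integrable lborel {0<..<1} g"
      by (rule set_integrable_subset) auto
    from set_borel_integral_eq_integral(2)[OF this] show ?thesis
      by (simp add: set_lebesgue_integral_def integral_open_interval_real)
  qed
  let ?F = "\<lambda>y. indicator ({0<..<1} \<times> {0<..<1}) y * (f (fst y) * h (snd y)) :: real"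
  have "set_integrable lborel (cbox (0, 0) (1, 1)) (\<lambda>y. f (fst y) * h (snd y))"
    unfolding set_integrable_def
    by (intro borel_integrable_compact continuous_intros continuous_on_compose2[OF f]
        continuous_on_compose2[OF h]) auto
  then have "set_integrable lborel ({0<..<1} \<times> {0<..<1}) (\<lambda>y. f (fst y) * h (snd y))"
    by (rule set_integrable_subset) (auto simp: borel_open open_Times mem_box cbox_Pair_eq)
  then have int: "integrable (lborel \<Otimes>\<^sub>M lborel) ?F"
    by (simp add: set_integrable_def lborel_prod)
  have "(LINT y|lborel. ?F y) = integral\<^sup>L (lborel \<Otimes>\<^sub>M lborel) ?F"
    by (simp add: lborel_prod)
  also have "\<dots> = (LINT x|lborel. LINT y|lborel. ?F (x, y))"
    using lborel_pair.integral_fst'[OF int] by simp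
  also have "\<dots> = (LINT x|lborel. LINT y|lborel. (indicator {0<..<1} x * f x) * (indicator {0<..<1} y * h y))"
    by (intro Bochner_Integration.integral_cong refl) (simp add: indicator_times algebra_simps)
  also have "\<dots> = integral {0..1} f * integral {0..1} h"
    by (simp add: one[OF f] one[OF h])
  finally show ?thesis .
qed

section \<open>Dual basis, affine coordinates and change of variables\<close>

locale pgram =
  fixes p a b :: "real^2"
  assumes noncollinear: "\<not> collinear {0, a, b}"
begin

abbreviation P :: "(real^2) set" where "P \<equiv> parallelogram p a b"

text \<open>Gram determinant of the sides, that is, the squared area of \<open>P\<close>.\<close>

definition D :: real where "D = (norm a)\<^sup>2 * (norm b)\<^sup>2 - (a \<bullet> b)\<^sup>2"

text \<open>\<open>a'\<close> and \<open>b'\<close> form the basis dual to \<open>a\<close>,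
  \<open>b\<close>; they are the constant gradients of the affine coordinates \<open>s\<close> and
  \<open>t\<close>.\<close>

definition a' :: "real^2" where "a' = (1 / D) *\<^sub>R ((norm b)\<^sup>2 *\<^sub>R a - (a \<bullet> b) *\<^sub>R b)"
definition b' :: "real^2" where "b' = (1 / D) *\<^sub>R ((norm a)\<^sup>2 *\<^sub>R b - (a \<bullet> b) *\<^sub>R a)"

definition s :: "real^2 \<Rightarrow> real" where "s x = (x - p) \<bullet> a'"
definition t :: "real^2 \<Rightarrow> real" where "t x = (x - p) \<bullet> b'"

lemma D_pos: "0 < D"
proof -
  have "\<bar>a \<bullet> b\<bar> < norm a * norm b"
    using noncollinear norm_cauchy_schwarz_equal[of a b] Cauchy_Schwarz_ineq2[of a b] by linarith
  then have "\<bar>a \<bullet> b\<bar>\<^sup>2 < (norm a * norm b)\<^sup>2"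
    by (intro power_strict_mono) auto
  then show ?thesis by (simp add: D_def power_mult_distrib)
qed

lemma a_b_nonzero: "a \<noteq> 0" "b \<noteq> 0"
  using D_pos by (auto simp: D_def)

lemma dual_basis: "a \<bullet> a' = 1" "a \<bullet> b' = 0" "b \<bullet> a' = 0" "b \<bullet> b' = 1"
proof -
  have "a \<bullet> a' = (1 / D) * D" "b \<bullet> b' = (1 / D) * D"
    unfolding a'_def b'_def D_def inner_scaleR_right inner_diff_right power2_norm_eq_inner
    by (simp_all add: inner_commute[of b a] power2_eq_square mult.commute)
  with D_pos show "a \<bullet> a' = 1" "b \<bullet> b' = 1" by simp_all
  show "a \<bullet> b' = 0" "b \<bullet> a' = 0"
    unfolding a'_def b'_def inner_scaleR_right inner_diff_right power2_norm_eq_inner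
    by (simp_all add: inner_commute[of b a] mult.commute)
qed

lemma dual_gram: "a' \<bullet> a' = (norm b)\<^sup>2 / D" "a' \<bullet> b' = - (a \<bullet> b) / D" "b' \<bullet> b' = (norm a)\<^sup>2 / D"
proof -
  have "a' \<bullet> a' = (1 / D) * ((norm b)\<^sup>2 * (a \<bullet> a') - (a \<bullet> b) * (b \<bullet> a'))"
    by (subst (1) a'_def) (simp add: inner_simps)
  then show "a' \<bullet> a' = (norm b)\<^sup>2 / D" by (simp add: dual_basis)
  have "a' \<bullet> b' = (1 / D) * ((norm b)\<^sup>2 * (a \<bullet> b') - (a \<bullet> b) * (b \<bullet> b'))"
    by (subst (1) a'_def) (simp add: inner_simps)
  then show "a' \<bullet> b' = - (a \<bullet> b) / D" by (simp add: dual_basis)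
  have "b' \<bullet> b' = (1 / D) * ((norm a)\<^sup>2 * (b \<bullet> b') - (a \<bullet> b) * (a \<bullet> b'))"
    by (subst (1) b'_def) (simp add: inner_simps)
  then show "b' \<bullet> b' = (norm a)\<^sup>2 / D" by (simp add: dual_basis)
qed

lemma orthogonal_a_b_zero:
  assumes "z \<bullet> a = 0" "z \<bullet> b = 0"
  shows "z = 0"
proof -
  have "a \<noteq> b"
    using dual_basis by auto
  have indep: "independent {a, b}"
  proof (rule independent_insertI)
    show "a \<notin> span {b}"
    proof
      assume "a \<in> span {b}"
      then obtain k where "a = k *\<^sub>R b" by (auto simp: span_singleton)
      then have "a \<bullet> a' = k * (b \<bullet> a')" by simp
      then show False by (simp add: dual_basis)
    qed
  qed (use a_b_nonzero in simp)
  have "span {a, b} = UNIV"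
    using dim_eq_card_independent[OF indep] \<open>a \<noteq> b\<close> dim_eq_full[of "{a, b}"] by simp
  then have "z \<in> span {a, b}" by simp
  then have "orthogonal z z"
    by (rule orthogonal_to_span) (use assms in \<open>auto simp: orthogonal_def\<close>)
  then show ?thesis by (simp add: orthogonal_def)
qed

lemma dual_decomposition: "(x \<bullet> a) *\<^sub>R a' + (x \<bullet> b) *\<^sub>R b' = x"
proof -
  have "(x \<bullet> a) *\<^sub>R a' + (x \<bullet> b) *\<^sub>R b' - x = 0"
    by (rule orthogonal_a_b_zero) (simp_all add: inner_simps dual_basis inner_commute[of _ a] inner_commute[of _ b])
  then show ?thesis by simp
qed

lemma decomposition: "(x \<bullet> a') *\<^sub>R a + (x \<bullet> b') *\<^sub>R b = x"
proof -
  define z where "z = (x \<bullet> a') *\<^sub>R a + (x \<bullet> b') *\<^sub>R b - x"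
  have z: "z \<bullet> a' = 0" "z \<bullet> b' = 0"
    by (simp_all add: z_def inner_simps dual_basis)
  have "z \<bullet> z = z \<bullet> ((z \<bullet> a) *\<^sub>R a' + (z \<bullet> b) *\<^sub>R b')"
    by (simp only: dual_decomposition)
  also have "\<dots> = 0"
    by (simp add: inner_add_right z)
  finally show ?thesis by (simp add: z_def)
qed

text \<open>A function with partial derivatives x, y in the coordinates \<open>s\<close>,
  \<open>t\<close> has this combination as its gradient, so the right-hand side is the Dirichlet
  density. The mixed term measures the failure of the sides to be orthogonal.\<close>

lemma norm_dual_comb:
  "(norm (x *\<^sub>R a' + y *\<^sub>R b'))\<^sup>2 = (x\<^sup>2 * (norm b)\<^sup>2 - 2 * (a \<bullet> b) * x * y + y\<^sup>2 * (norm a)\<^sup>2) / D"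
proof -
  have "(norm (x *\<^sub>R a' + y *\<^sub>R b'))\<^sup>2 = x\<^sup>2 * (a' \<bullet> a') + 2 * x * y * (a' \<bullet> b') + y\<^sup>2 * (b' \<bullet> b')"
    unfolding power2_norm_eq_inner by (simp add: inner_simps inner_commute[of b' a'] power2_eq_square algebra_simps)
  then show ?thesis
    unfolding dual_gram by (simp add: add_divide_distrib diff_divide_distrib mult_ac)
qed

lemma s_t_affine: "s (p + x *\<^sub>R a + y *\<^sub>R b) = x" "t (p + x *\<^sub>R a + y *\<^sub>R b) = y"
  by (simp_all add: s_def t_def inner_simps dual_basis)

lemma s_t_inverse: "p + s x *\<^sub>R a + t x *\<^sub>R b = x"
  using decomposition[of "x - p"] by (simp add: s_def t_def algebra_simps)

lemma s_t_continuous: "continuous_on S s" "continuous_on S t"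
  unfolding s_def[abs_def] t_def[abs_def] by (intro continuous_intros)+

lemma P_eq: "P = {x. 0 < s x \<and> s x < 1 \<and> 0 < t x \<and> t x < 1}"
proof (intro equalityI subsetI)
  fix x assume "x \<in> {x. 0 < s x \<and> s x < 1 \<and> 0 < t x \<and> t x < 1}"
  then show "x \<in> P"
    unfolding parallelogram_def using s_t_inverse[of x, symmetric] by blast
next
  fix x assume "x \<in> P"
  then obtain c d where "x = p + c *\<^sub>R a + d *\<^sub>R b" "0 < c" "c < 1" "0 < d" "d < 1"
    unfolding parallelogram_def by blast
  then show "x \<in> {x. 0 < s x \<and> s x < 1 \<and> 0 < t x \<and> t x < 1}"
    by (simp add: s_t_affine)
qed

lemma P_subset_compact:
  "compact {x. l \<le> s x \<and> s x \<le> u \<and> l' \<le> t x \<and> t x \<le> u'}"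
proof -
  have "{x. l \<le> s x \<and> s x \<le> u \<and> l' \<le> t x \<and> t x \<le> u'}
      = (\<lambda>z. p + fst z *\<^sub>R a + snd z *\<^sub>R b) ` ({l..u} \<times> {l'..u'})"
  proof (intro equalityI subsetI)
    fix x assume "x \<in> {x. l \<le> s x \<and> s x \<le> u \<and> l' \<le> t x \<and> t x \<le> u'}"
    then show "x \<in> (\<lambda>z. p + fst z *\<^sub>R a + snd z *\<^sub>R b) ` ({l..u} \<times> {l'..u'})"
      by (intro image_eqI[of _ _ "(s x, t x)"]) (simp_all add: s_t_inverse)
  qed (auto simp: s_t_affine)
  then show ?thesis
    by (auto intro!: compact_continuous_image compact_Times continuous_intros)
qed

lemma bounded_P: "bounded P"
  by (rule bounded_subset[OF compact_imp_bounded[OF P_subset_compact[of 0 1 0 1]]])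
    (auto simp: P_eq)

lemmas P_lmeasurable = parallelogram_lmeasurable[of p a b]

lemma measure_P_pos: "0 < measure lebesgue P"
proof -
  have "(measure lebesgue P)\<^sup>2 = D"
    using measure_parallelogram_sq by (simp add: D_def)
  with D_pos show ?thesis
    by (metis measure_nonneg order_less_le power2_eq_square mult_zero_left)
qed

lemma L2_continuous_P: "continuous_on UNIV F \<Longrightarrow> L2 P F"
  by (rule L2_continuous[OF P_lmeasurable bounded_P])

text \<open>Change of variables as an identity of measures. Lebesgue measure is determined by its
  values on boxes, and the preimage of a box under the coordinates is a parallelogram with scaled
  sides, whose area is known.\<close>

lemma lborel_coords:
  "lborel = density (distr lborel borel (\<lambda>x. (s x, t x))) (\<lambda>_. ennreal (1 / measure lebesgue P))"
proof (rule lborel_eqI)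
  let ?T = "\<lambda>x. (s x, t x)"
  have T: "?T \<in> borel_measurable borel"
    by (intro borel_measurable_continuous_onI continuous_intros s_t_continuous)
  fix l u :: "real \<times> real"
  assume le: "\<And>b. b \<in> Basis \<Longrightarrow> l \<bullet> b \<le> u \<bullet> b"
  have lu: "fst l \<le> fst u" "snd l \<le> snd u"
    using le[of "(1, 0)"] le[of "(0, 1)"] by (auto simp: Basis_prod_def inner_prod_def)
  let ?w = "fst u - fst l" and ?w' = "snd u - snd l"
  have prod_eq: "prod ((\<bullet>) (u - l)) Basis = ?w * ?w'"
    by (simp add: Basis_prod_def inner_prod_def)
  show "emeasure (density (distr lborel borel ?T) (\<lambda>_. ennreal (1 / measure lebesgue P))) (box l u)
      = ennreal (prod ((\<bullet>) (u - l)) Basis)"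
  \<comment> \<open>Boxes with a zero side are empty and handled apart, since the description of the
    preimage divides by both widths.\<close>
  proof (cases "?w = 0 \<or> ?w' = 0")
    case True
    then have "box l u = {}"
      by (auto simp: box_eq_empty Basis_prod_def inner_prod_def)
    with True show ?thesis by (auto simp: prod_eq)
  next
    case False
    with lu have w: "0 < ?w" "0 < ?w'" by auto
    let ?R = "parallelogram (p + fst l *\<^sub>R a + snd l *\<^sub>R b) (?w *\<^sub>R a) (?w' *\<^sub>R b)"
    have LR: "?T -` box l u = ?R"
    proof (intro equalityI subsetI)
      fix x assume "x \<in> ?T -` box l u"
      then have x: "fst l < s x" "s x < fst u" "snd l < t x" "t x < snd u"
        by (auto simp: mem_box Basis_prod_def inner_prod_def)
      have "((s x - fst l) / ?w) *\<^sub>R (?w *\<^sub>R a) = s x *\<^sub>R a - fst l *\<^sub>R a"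
        "((t x - snd l) / ?w') *\<^sub>R (?w' *\<^sub>R b) = t x *\<^sub>R b - snd l *\<^sub>R b"
        using w by (simp_all add: scaleR_diff_left[symmetric])
      then have "p + fst l *\<^sub>R a + snd l *\<^sub>R b + ((s x - fst l) / ?w) *\<^sub>R (?w *\<^sub>R a) + ((t x - snd l) / ?w') *\<^sub>R (?w' *\<^sub>R b)
        = p + s x *\<^sub>R a + t x *\<^sub>R b"
        by simp
      then have "x = p + fst l *\<^sub>R a + snd l *\<^sub>R b + ((s x - fst l) / ?w) *\<^sub>R (?w *\<^sub>R a) + ((t x - snd l) / ?w') *\<^sub>R (?w' *\<^sub>R b)"
        by (simp only: s_t_inverse)
      moreover have "0 < (s x - fst l) / ?w" "(s x - fst l) / ?w < 1" "0 < (t x - snd l) / ?w'" "(t x - snd l) / ?w' < 1"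
        using x w by simp_all
      ultimately show "x \<in> ?R" unfolding parallelogram_def by blast
    next
      fix x assume "x \<in> ?R"
      then obtain c d where cd: "0 < c" "c < 1" "0 < d" "d < 1"
        and x: "x = p + fst l *\<^sub>R a + snd l *\<^sub>R b + c *\<^sub>R (?w *\<^sub>R a) + d *\<^sub>R (?w' *\<^sub>R b)"
        unfolding parallelogram_def by blast
      have "x = p + (fst l + c * ?w) *\<^sub>R a + (snd l + d * ?w') *\<^sub>R b"
        unfolding x by (simp add: algebra_simps)
      then have st: "s x = fst l + c * ?w" "t x = snd l + d * ?w'"
        by (simp_all only: s_t_affine)
      have "0 < c * ?w" "0 < d * ?w'" "c * ?w < 1 * ?w" "d * ?w' < 1 * ?w'"
        using cd w by (intro mult_pos_pos mult_strict_right_mono; simp)+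
      then show "x \<in> ?T -` box l u"
        using st by (auto simp: mem_box Basis_prod_def inner_prod_def)
    qed
    have R: "?R \<in> sets borel"
      unfolding LR[symmetric] using T by (intro measurable_sets_borel[OF T]) auto
    have "(c *\<^sub>R a) $ 1 * (d *\<^sub>R b) $ 2 - (c *\<^sub>R a) $ 2 * (d *\<^sub>R b) $ 1
        = (c * d) * (a $ 1 * b $ 2 - a $ 2 * b $ 1)" for c d
      by (simp add: algebra_simps)
    moreover have "\<bar>?w * ?w'\<bar> = ?w * ?w'"
      using w by (intro abs_of_pos mult_pos_pos)
    ultimately have "measure lebesgue ?R = ?w * ?w' * measure lebesgue P"
      unfolding measure_parallelogram by (simp only: abs_mult)
    moreover have "emeasure lborel ?R = emeasure lebesgue ?R"
      using R by simp
    moreover have "emeasure lebesgue ?R = ennreal (measure lebesgue ?R)"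
      by (rule emeasure_eq_measure2[OF parallelogram_lmeasurable])
    ultimately have "emeasure lborel ?R = ennreal (?w * ?w' * measure lebesgue P)"
      by simp
    then have "emeasure (density (distr lborel borel ?T) (\<lambda>_. ennreal (1 / measure lebesgue P))) (box l u)
       = ennreal (1 / measure lebesgue P) * ennreal (?w * ?w' * measure lebesgue P)"
      using T by (simp add: emeasure_density_const emeasure_distr LR)
    also have "\<dots> = ennreal (?w * ?w')"
      using measure_P_pos w by (simp add: ennreal_mult[symmetric])
    finally show ?thesis by (simp add: prod_eq)
  qed
qed simp

lemma integral_tensor:
  assumes f: "continuous_on UNIV f" and h: "continuous_on UNIV h"
  shows "(LINT x|lebesgue_on P. f (s x) * h (t x)) = measure lebesgue P * (integral {0..1} f * integral {0..1} h)"
proof -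
  let ?T = "\<lambda>x. (s x, t x)"
  let ?F = "\<lambda>y. indicator ({0<..<1} \<times> {0<..<1}) y * (f (fst y) * h (snd y)) :: real"
  have T[measurable]: "?T \<in> borel_measurable borel"
    by (intro borel_measurable_continuous_onI continuous_intros s_t_continuous)
  have [measurable]: "f \<in> borel_measurable borel" "h \<in> borel_measurable borel"
    using f h by (auto intro: borel_measurable_continuous_onI)
  have [measurable]: "{0<..<1::real} \<times> {0<..<1::real} \<in> sets borel"
    by (intro borel_open open_Times) auto
  have F: "?F \<in> borel_measurable borel"
    unfolding borel_prod[symmetric] by measurable
  have FT: "?F (?T x) = indicator P x * (f (s x) * h (t x))" for x
    by (simp add: P_eq indicator_def)
  have meas: "(\<lambda>x. ?F (?T x)) \<in> borel_measurable lborel"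
    using measurable_compose[OF T F] by simp
  have "integral {0..1} f * integral {0..1} h = (LINT y|lborel. ?F y)"
    using integral_unit_square[OF f h] by simp
  also have "\<dots> = (LINT y|distr lborel borel ?T. (1 / measure lebesgue P) * ?F y)"
    by (subst lborel_coords, subst integral_density) (use F in auto)
  also have "\<dots> = (LINT x|lborel. (1 / measure lebesgue P) * ?F (?T x))"
    by (subst integral_distr) (use F in auto)
  also have "\<dots> = (1 / measure lebesgue P) * (LINT x|lborel. ?F (?T x))"
    by simp
  also have "(LINT x|lborel. ?F (?T x)) = (LINT x|lebesgue. ?F (?T x))"
    using meas by (subst integral_completion) auto
  also have "\<dots> = (LINT x|lebesgue_on P. f (s x) * h (t x))"
    unfolding FT using P_lmeasurable by (subst integral_restrict_space) (auto simp: fmeasurableD)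
  finally show ?thesis
    using measure_P_pos by simp
qed

end

section \<open>Fourier series on a parallelogram\<close>

text \<open>The codomain is kept general so that scalar functions and gradient fields share one
  calculus; \<open>ip P g g\<close> is the Dirichlet energy if \<open>g\<close> is a weak
  gradient.\<close>

definition ip :: "'a::euclidean_space set \<Rightarrow> ('a \<Rightarrow> 'b::euclidean_space) \<Rightarrow> ('a \<Rightarrow> 'b) \<Rightarrow> real" where
  "ip \<Omega> u v = (LINT x|lebesgue_on \<Omega>. u x \<bullet> v x)"

lemma ip_real: "ip \<Omega> u v = (LINT x|lebesgue_on \<Omega>. u x * v x :: real)"
  by (simp add: ip_def)

lemma ip_commute: "ip \<Omega> u v = ip \<Omega> v u"
  by (simp add: ip_def inner_commute)

lemma ip_add_left:
  "L2 \<Omega> u \<Longrightarrow> L2 \<Omega> v \<Longrightarrow> L2 \<Omega> w \<Longrightarrow> ip \<Omega> (\<lambda>x. u x + v x) w = ip \<Omega> u w + ip \<Omega> v w"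
  by (simp add: ip_def inner_add_left L2_inner_integrable)

lemma ip_diff_left:
  "L2 \<Omega> u \<Longrightarrow> L2 \<Omega> v \<Longrightarrow> L2 \<Omega> w \<Longrightarrow> ip \<Omega> (\<lambda>x. u x - v x) w = ip \<Omega> u w - ip \<Omega> v w"
  by (simp add: ip_def inner_diff_left L2_inner_integrable)

lemma ip_scaleR_left: "ip \<Omega> (\<lambda>x. c *\<^sub>R u x) w = c * ip \<Omega> u w"
  by (simp add: ip_def)

lemma ip_scaleR_right: "ip \<Omega> w (\<lambda>x. c *\<^sub>R u x) = c * ip \<Omega> w u"
  by (simp add: ip_def)

lemma ip_cmult_left:
  fixes u :: "'a::euclidean_space \<Rightarrow> real"
  shows "ip \<Omega> (\<lambda>x. c * u x) w = c * ip \<Omega> u w"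
  using ip_scaleR_left[of \<Omega> c u w] by simp

lemma ip_cmult_right:
  fixes u :: "'a::euclidean_space \<Rightarrow> real"
  shows "ip \<Omega> w (\<lambda>x. c * u x) = c * ip \<Omega> w u"
  using ip_scaleR_right[of \<Omega> w c u] by simp

lemma ip_diff_right:
  "L2 \<Omega> u \<Longrightarrow> L2 \<Omega> v \<Longrightarrow> L2 \<Omega> w \<Longrightarrow> ip \<Omega> w (\<lambda>x. u x - v x) = ip \<Omega> w u - ip \<Omega> w v"
  by (simp add: ip_commute[of _ w] ip_diff_left)

lemma ip_add_right:
  "L2 \<Omega> u \<Longrightarrow> L2 \<Omega> v \<Longrightarrow> L2 \<Omega> w \<Longrightarrow> ip \<Omega> w (\<lambda>x. u x + v x) = ip \<Omega> w u + ip \<Omega> w v"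
  by (simp add: ip_commute[of _ w] ip_add_left)

lemma ip_sum_left:
  assumes "\<And>i. i \<in> I \<Longrightarrow> L2 \<Omega> (u i)" "L2 \<Omega> w"
  shows "ip \<Omega> (\<lambda>x. \<Sum>i\<in>I. u i x) w = (\<Sum>i\<in>I. ip \<Omega> (u i) w)"
  unfolding ip_def inner_sum_left
  by (rule Bochner_Integration.integral_sum) (use assms in \<open>auto intro: L2_inner_integrable\<close>)

lemma ip_nonneg: "0 \<le> ip \<Omega> u u"
  by (simp add: ip_def)

lemma ip_norm: "(LINT x|lebesgue_on \<Omega>. (norm (u x))\<^sup>2) = ip \<Omega> u u"
  by (simp add: ip_def power2_norm_eq_inner)

lemma ip_sq_diff:
  assumes "L2 \<Omega> u" "L2 \<Omega> v"
  shows "ip \<Omega> (\<lambda>x. u x - v x) (\<lambda>x. u x - v x) = ip \<Omega> u u - 2 * ip \<Omega> u v + ip \<Omega> v v"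
  using assms by (simp add: ip_diff_left ip_diff_right L2_diff ip_commute[of _ v u])

lemma ip_sq_add:
  assumes "L2 \<Omega> u" "L2 \<Omega> v"
  shows "ip \<Omega> (\<lambda>x. u x + v x) (\<lambda>x. u x + v x) = ip \<Omega> u u + 2 * ip \<Omega> u v + ip \<Omega> v v"
  using assms by (simp add: ip_add_left ip_add_right L2_add ip_commute[of _ v u])

text \<open>The parallelogram law with the nonnegative square of \<open>(u - v) - (v - w)\<close>
  dropped; it replaces the triangle inequality without square roots.\<close>

lemma ip_sq_triangle:
  assumes "L2 \<Omega> u" "L2 \<Omega> v" "L2 \<Omega> w"
  shows "ip \<Omega> (\<lambda>x. u x - w x) (\<lambda>x. u x - w x)
    \<le> 2 * ip \<Omega> (\<lambda>x. u x - v x) (\<lambda>x. u x - v x) + 2 * ip \<Omega> (\<lambda>x. v x - w x) (\<lambda>x. v x - w x)"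
proof -
  have uv: "L2 \<Omega> (\<lambda>x. u x - v x)" "L2 \<Omega> (\<lambda>x. v x - w x)"
    using assms by (auto intro: L2_diff)
  have "0 \<le> ip \<Omega> (\<lambda>x. (u x - v x) - (v x - w x)) (\<lambda>x. (u x - v x) - (v x - w x))"
    by (rule ip_nonneg)
  with ip_sq_diff[OF uv] ip_sq_add[OF uv] show ?thesis by simp
qed

text \<open>The coefficients are arbitrary, so that best approximation and Bessel's inequality both
  follow by choosing or optimizing them.\<close>

lemma ip_orthogonal_expansion:
  fixes e :: "'i \<Rightarrow> 'a::euclidean_space \<Rightarrow> real"
  assumes "finite I" "\<And>i. i \<in> I \<Longrightarrow> L2 \<Omega> (e i)" "L2 \<Omega> u"
    and orth: "\<And>i j. i \<in> I \<Longrightarrow> j \<in> I \<Longrightarrow> ip \<Omega> (e i) (e j) = (if i = j then N i else 0)"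
  shows "ip \<Omega> (\<lambda>x. u x - (\<Sum>i\<in>I. c i * e i x)) (\<lambda>x. u x - (\<Sum>i\<in>I. c i * e i x))
    = ip \<Omega> u u - 2 * (\<Sum>i\<in>I. c i * ip \<Omega> u (e i)) + (\<Sum>i\<in>I. (c i)\<^sup>2 * N i)"
proof -
  let ?p = "\<lambda>x. \<Sum>i\<in>I. c i * e i x"
  have p: "L2 \<Omega> ?p" using assms by (intro L2_sum L2_cmult)
  have 1: "ip \<Omega> ?p w = (\<Sum>i\<in>I. c i * ip \<Omega> (e i) w)" if "L2 \<Omega> w" for w
    using assms that by (subst ip_sum_left) (auto intro: L2_cmult simp: ip_cmult_left)
  have "ip \<Omega> ?p ?p = (\<Sum>i\<in>I. c i * ip \<Omega> ?p (e i))"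
    using 1[OF p] by (simp add: ip_commute)
  also have "\<dots> = (\<Sum>i\<in>I. (c i)\<^sup>2 * N i)"
  proof (rule sum.cong[OF refl])
    fix i assume "i \<in> I"
    then have "ip \<Omega> ?p (e i) = (\<Sum>j\<in>I. c j * (if j = i then N i else 0))"
      using assms(2) orth by (subst 1) (auto intro!: sum.cong)
    also have "\<dots> = c i * N i"
      using \<open>finite I\<close> \<open>i \<in> I\<close> by (simp add: if_distrib cong: if_cong)
    finally show "c i * ip \<Omega> ?p (e i) = (c i)\<^sup>2 * N i" by (simp add: power2_eq_square)
  qed
  finally have pp: "ip \<Omega> ?p ?p = (\<Sum>i\<in>I. (c i)\<^sup>2 * N i)" .
  have "ip \<Omega> u ?p = (\<Sum>i\<in>I. c i * ip \<Omega> u (e i))"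
    unfolding ip_commute[of \<Omega> u ?p] 1[OF assms(3)] ip_commute[of \<Omega> u "e i" for i] ..
  then show ?thesis
    by (simp add: ip_sq_diff[OF assms(3) p] pp)
qed

text \<open>Completing the square for each index: 2 c q - c^2 N is largest at c = q / N, with value
  q^2 / N. Hence any approximating sum, with whatever coefficients, bounds the Parseval
  defect.\<close>

lemma ip_best_approximation:
  fixes e :: "'i \<Rightarrow> 'a::euclidean_space \<Rightarrow> real"
  assumes "finite I" "\<And>i. i \<in> I \<Longrightarrow> L2 \<Omega> (e i)" "L2 \<Omega> u"
    and "\<And>i j. i \<in> I \<Longrightarrow> j \<in> I \<Longrightarrow> ip \<Omega> (e i) (e j) = (if i = j then N i else 0)"
    and N: "\<And>i. i \<in> I \<Longrightarrow> 0 < N i"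
  shows "ip \<Omega> u u - (\<Sum>i\<in>I. (ip \<Omega> u (e i))\<^sup>2 / N i)
    \<le> ip \<Omega> (\<lambda>x. u x - (\<Sum>i\<in>I. c i * e i x)) (\<lambda>x. u x - (\<Sum>i\<in>I. c i * e i x))"
proof -
  have "2 * (c i * ip \<Omega> u (e i)) - (c i)\<^sup>2 * N i \<le> (ip \<Omega> u (e i))\<^sup>2 / N i" if "i \<in> I" for i
  proof -
    have "0 \<le> (ip \<Omega> u (e i) - c i * N i)\<^sup>2" by simp
    then have "(2 * (c i * ip \<Omega> u (e i)) - (c i)\<^sup>2 * N i) * N i \<le> (ip \<Omega> u (e i))\<^sup>2"
      by (simp add: power2_eq_square algebra_simps)
    then show ?thesis using N[OF that] by (simp add: pos_le_divide_eq)
  qed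
  then have "(\<Sum>i\<in>I. 2 * (c i * ip \<Omega> u (e i)) - (c i)\<^sup>2 * N i) \<le> (\<Sum>i\<in>I. (ip \<Omega> u (e i))\<^sup>2 / N i)"
    by (rule sum_mono)
  then show ?thesis
    using ip_orthogonal_expansion[OF assms(1-4), of c] by (simp add: sum_subtractf sum_distrib_left)
qed

lemma ip_bessel:
  fixes e :: "'i \<Rightarrow> 'a::euclidean_space \<Rightarrow> real"
  assumes "finite I" "\<And>i. i \<in> I \<Longrightarrow> L2 \<Omega> (e i)" "L2 \<Omega> u"
    and "\<And>i j. i \<in> I \<Longrightarrow> j \<in> I \<Longrightarrow> ip \<Omega> (e i) (e j) = (if i = j then N i else 0)"
    and N: "\<And>i. i \<in> I \<Longrightarrow> 0 < N i"
  shows "(\<Sum>i\<in>I. (ip \<Omega> u (e i))\<^sup>2 / N i) \<le> ip \<Omega> u u"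
proof -
  have "(\<Sum>i\<in>I. (ip \<Omega> u (e i) / N i) * ip \<Omega> u (e i)) = (\<Sum>i\<in>I. (ip \<Omega> u (e i))\<^sup>2 / N i)"
    "(\<Sum>i\<in>I. (ip \<Omega> u (e i) / N i)\<^sup>2 * N i) = (\<Sum>i\<in>I. (ip \<Omega> u (e i))\<^sup>2 / N i)"
    using N by (auto intro!: sum.cong simp: power2_eq_square)
  with ip_orthogonal_expansion[OF assms(1-4), of "\<lambda>i. ip \<Omega> u (e i) / N i"]
    ip_nonneg[of \<Omega> "\<lambda>x. u x - (\<Sum>i\<in>I. ip \<Omega> u (e i) / N i * e i x)"]
  show ?thesis by simp
qed

section \<open>Orthogonality integrals and product formulas\<close>

lemma integral_cos_int:
  "((\<lambda>x. cos (of_int k * pi * x)) has_integral (if k = 0 then 1 else 0)) {0..1}"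
proof (cases "k = 0")
  case False
  have "((\<lambda>x. cos (of_int k * pi * x)) has_integral
      (sin (of_int k * pi * 1) / (of_int k * pi) - sin (of_int k * pi * 0) / (of_int k * pi))) {0..1}"
  proof (rule fundamental_theorem_of_calculus)
    show "((\<lambda>x. sin (of_int k * pi * x) / (of_int k * pi)) has_vector_derivative
        cos (of_int k * pi * x)) (at x within {0..1})" for x
      unfolding has_real_derivative_iff_has_vector_derivative[symmetric]
      using False by (auto intro!: derivative_eq_intros)
  qed simp
  moreover have "sin (of_int k * pi) = 0"
    using sin_npi_int[of k] by (simp add: mult.commute)
  ultimately show ?thesis using False by simp
qed (use has_integral_const_real[of 1 0 1] in simp)

lemma integral_cos_cos:
  "integral {0..1} (\<lambda>x. cos (real m * pi * x) * cos (real n * pi * x))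
    = (if m = n then if m = 0 then 1 else 1 / 2 else 0)"
proof -
  have eq: "cos (real m * pi * x) * cos (real n * pi * x)
      = (1 / 2) * (cos (of_int (int m - int n) * pi * x) + cos (of_int (int m + int n) * pi * x))" for x
  proof -
    have "of_int (int m - int n) * pi * x = real m * pi * x - real n * pi * x"
      "of_int (int m + int n) * pi * x = real m * pi * x + real n * pi * x"
      by (simp_all add: algebra_simps)
    then show ?thesis by (simp only: cos_times_cos)
  qed
  have "((\<lambda>x. cos (real m * pi * x) * cos (real n * pi * x)) has_integral
     (1 / 2) * ((if int m - int n = 0 then 1 else 0) + (if int m + int n = 0 then 1 else 0))) {0..1}"
    unfolding eq by (intro has_integral_mult_right has_integral_add integral_cos_int)
  then show ?thesis by (auto dest!: integral_unique)
qed

lemma integral_sin_sin: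
  "integral {0..1} (\<lambda>x. sin (real m * pi * x) * sin (real n * pi * x))
    = (if m = n \<and> m \<noteq> 0 then 1 / 2 else 0)"
proof -
  have eq: "sin (real m * pi * x) * sin (real n * pi * x)
      = (1 / 2) * (cos (of_int (int m - int n) * pi * x) - cos (of_int (int m + int n) * pi * x))" for x
  proof -
    have "of_int (int m - int n) * pi * x = real m * pi * x - real n * pi * x"
      "of_int (int m + int n) * pi * x = real m * pi * x + real n * pi * x"
      by (simp_all add: algebra_simps)
    then show ?thesis by (simp only: sin_times_sin)
  qed
  have "((\<lambda>x. sin (real m * pi * x) * sin (real n * pi * x)) has_integral
     (1 / 2) * ((if int m - int n = 0 then 1 else 0) - (if int m + int n = 0 then 1 else 0))) {0..1}"
    unfolding eq by (intro has_integral_mult_right has_integral_diff integral_cos_int)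
  then show ?thesis by (auto dest!: integral_unique)
qed

text \<open>With truncated subtraction \<open>(m - n) + (n - m)\<close> is the distance of
  \<open>m\<close> and \<open>n\<close>; the product formula thus stays within natural
  frequencies.\<close>

lemma cos_mult_cos_nat:
  "cos (real m * y) * cos (real n * y)
    = (1 / 2) * cos (real (m + n) * y) + (1 / 2) * cos (real ((m - n) + (n - m)) * y)"
proof -
  have "real ((m - n) + (n - m)) * y = real m * y - real n * y
      \<or> real ((m - n) + (n - m)) * y = - (real m * y - real n * y)"
    by (cases "m \<le> n") (auto simp: of_nat_diff algebra_simps)
  then have "cos (real ((m - n) + (n - m)) * y) = cos (real m * y - real n * y)"
    by (metis cos_minus)
  moreover have "real (m + n) * y = real m * y + real n * y"
    by (simp add: algebra_simps)
  ultimately show ?thesis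
    by (simp only: cos_times_cos) simp
qed

text \<open>Measurability provides continuous functions converging almost everywhere but without any
  bound. Truncating \<open>u\<close> first, and the approximants at the same height, makes dominated
  convergence applicable.\<close>

lemma L2_approx_continuous:
  fixes u :: "'a::euclidean_space \<Rightarrow> real"
  assumes \<Omega>: "\<Omega> \<in> lmeasurable" and u: "L2 \<Omega> u" and "0 < \<epsilon>"
  shows "\<exists>G. continuous_on UNIV G \<and> ip \<Omega> (\<lambda>x. u x - G x) (\<lambda>x. u x - G x) < \<epsilon>"
proof -
  let ?M = "lebesgue_on \<Omega>"
  interpret finite_measure ?M
    using \<Omega> by (rule finite_measure_lebesgue_on)
  define clip where "clip k y = max (- k) (min k y)" for k y :: real
  have clip_cont: "continuous_on S (clip k)" for S k
    unfolding clip_def[abs_def] by (intro continuous_intros)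
  have clip_le: "\<bar>clip k y\<bar> \<le> k" if "0 \<le> k" for k y
    using that by (auto simp: clip_def)
  have [measurable]: "clip k \<in> borel_measurable borel" for k
    by (rule borel_measurable_continuous_onI[OF clip_cont])
  have u_meas[measurable]: "u \<in> borel_measurable ?M"
    using u by (simp add: L2_def)
  have "(\<lambda>k. LINT x|?M. (u x - clip (real k) (u x))\<^sup>2) \<longlonglongrightarrow> (LINT x|?M. 0)"
  proof (rule integral_dominated_convergence)
    show "integrable ?M (\<lambda>x. (u x)\<^sup>2)"
      using u by (simp add: L2_def)
    show "AE x in ?M. (\<lambda>k. (u x - clip (real k) (u x))\<^sup>2) \<longlonglongrightarrow> 0"
    proof (rule AE_I2)
      fix x
      have "\<forall>\<^sub>F k in sequentially. (u x - clip (real k) (u x))\<^sup>2 = 0"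
        using eventually_ge_at_top[of "nat \<lceil>\<bar>u x\<bar>\<rceil>"]
      proof eventually_elim
        case (elim k)
        then have "\<bar>u x\<bar> \<le> real k" by linarith
        then have "clip (real k) (u x) = u x" by (auto simp: clip_def)
        then show ?case by simp
      qed
      then show "(\<lambda>k. (u x - clip (real k) (u x))\<^sup>2) \<longlonglongrightarrow> 0"
        by (rule tendsto_eventually)
    qed
    have "\<bar>y - clip (real k) y\<bar> \<le> \<bar>y\<bar>" for k y
      by (auto simp: clip_def)
    then show "AE x in ?M. norm ((u x - clip (real k) (u x))\<^sup>2) \<le> (u x)\<^sup>2" for k
      by (simp add: abs_le_square_iff[symmetric])
  qed measurable
  then have "\<forall>\<^sub>F k in sequentially. (LINT x|?M. (u x - clip (real k) (u x))\<^sup>2) < \<epsilon> / 4"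
    using \<open>0 < \<epsilon>\<close> by (intro order_tendstoD) auto
  then obtain k where k: "(LINT x|?M. (u x - clip (real k) (u x))\<^sup>2) < \<epsilon> / 4"
    by (auto simp: eventually_sequentially)
  \<comment> \<open>The two errors of \<open>\<epsilon> / 4\<close> are doubled by
    \<open>ip_sq_triangle\<close> and add up to \<open>\<epsilon>\<close>.\<close>
  have "u measurable_on \<Omega>"
    using u_meas \<Omega> by (simp add: measurable_on_iff_borel_measurable fmeasurableD)
  then obtain N g where N: "negligible N" and g: "\<And>n. continuous_on UNIV (g n)"
    and lim: "\<And>x. x \<notin> N \<Longrightarrow> (\<lambda>n. g n x) \<longlonglongrightarrow> (if x \<in> \<Omega> then u x else 0)"
    unfolding measurable_on_def by blast
  define G where "G n x = clip (real k) (g n x)" for n x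
  have G_cont: "continuous_on UNIV (G n)" for n
    unfolding G_def[abs_def] by (rule continuous_on_compose2[OF clip_cont[of UNIV] g]) auto
  have G_meas[measurable]: "G n \<in> borel_measurable ?M" for n
    using borel_measurable_continuous_onI[OF G_cont]
    by (intro measurable_restrict_space1) (simp add: measurable_completion)
  have "(\<lambda>n. LINT x|?M. (clip (real k) (u x) - G n x)\<^sup>2) \<longlonglongrightarrow> (LINT x|?M. 0)"
  proof (rule integral_dominated_convergence)
    show "integrable ?M (\<lambda>x. (2 * real k)\<^sup>2)" by simp
    have "AE x in lebesgue. x \<notin> N"
      using N by (simp add: negligible_iff_null_sets AE_not_in)
    then have "AE x in ?M. x \<notin> N"
      using \<Omega> by (subst AE_restrict_space_iff) (auto simp: fmeasurableD)
    then show "AE x in ?M. (\<lambda>n. (clip (real k) (u x) - G n x)\<^sup>2) \<longlonglongrightarrow> 0"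
      using AE_space
    proof eventually_elim
      case (elim x)
      then have "(\<lambda>n. g n x) \<longlonglongrightarrow> u x"
        using lim[of x] by simp
      then have "(\<lambda>n. G n x) \<longlonglongrightarrow> clip (real k) (u x)"
        unfolding G_def using clip_cont[of UNIV "real k"]
        by (intro isCont_tendsto_compose[of _ "clip (real k)"]) (simp_all add: continuous_on_eq_continuous_at)
      then have "(\<lambda>n. (clip (real k) (u x) - G n x)\<^sup>2) \<longlonglongrightarrow> (clip (real k) (u x) - clip (real k) (u x))\<^sup>2"
        by (intro tendsto_intros)
      then show ?case by simp
    qed
    have "\<bar>clip (real k) (u x) - G n x\<bar> \<le> \<bar>2 * real k\<bar>" for n x
      using clip_le[of "real k" "u x"] clip_le[of "real k" "g n x"] unfolding G_def by linarith
    then show "AE x in ?M. norm ((clip (real k) (u x) - G n x)\<^sup>2) \<le> (2 * real k)\<^sup>2" for n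
      by (intro AE_I2) (simp only: real_norm_def abs_power2 abs_le_square_iff[symmetric])
  qed measurable
  then have "\<forall>\<^sub>F n in sequentially. (LINT x|?M. (clip (real k) (u x) - G n x)\<^sup>2) < \<epsilon> / 4"
    using \<open>0 < \<epsilon>\<close> by (intro order_tendstoD) auto
  then obtain n where n: "(LINT x|?M. (clip (real k) (u x) - G n x)\<^sup>2) < \<epsilon> / 4"
    by (auto simp: eventually_sequentially)
  have "L2 \<Omega> (\<lambda>x. clip (real k) (u x))" "L2 \<Omega> (G n)"
    using clip_le[of "real k"] by (auto intro!: L2_bounded[OF \<Omega>, where B = "real k"] simp: G_def)
  from ip_sq_triangle[OF u this] k n
  have "ip \<Omega> (\<lambda>x. u x - G n x) (\<lambda>x. u x - G n x) < \<epsilon>"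
    by (simp add: ip_real power2_eq_square)
  with G_cont show ?thesis by blast
qed

section \<open>The cosine system and its completeness\<close>

context pgram
begin

definition e_cc :: "nat \<times> nat \<Rightarrow> real^2 \<Rightarrow> real" where
  "e_cc i x = cos (real (fst i) * pi * s x) * cos (real (snd i) * pi * t x)"
text \<open>The \<open>s\<close>-derivative of \<open>e_sc i\<close> is a multiple of
  \<open>e_cc i\<close>, and \<open>e_sc i\<close> vanishes on the sides \<open>s = 0\<close> and
  \<open>s = 1\<close>; \<open>e_cs\<close> plays the same role for \<open>t\<close>.\<close>

definition e_sc :: "nat \<times> nat \<Rightarrow> real^2 \<Rightarrow> real" where
  "e_sc i x = sin (real (fst i) * pi * s x) * cos (real (snd i) * pi * t x)"
definition e_cs :: "nat \<times> nat \<Rightarrow> real^2 \<Rightarrow> real" where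
  "e_cs i x = cos (real (fst i) * pi * s x) * sin (real (snd i) * pi * t x)"

text \<open>Squared norm of \<open>e_cc i\<close>. It is also that of \<open>e_sc i\<close> if
  \<open>fst i\<close> is positive and of \<open>e_cs i\<close> if \<open>snd i\<close> is, so
  Fourier coefficients of \<open>u\<close> and of its derivatives carry the same weights.\<close>

definition e_norm :: "nat \<times> nat \<Rightarrow> real" where
  "e_norm i = measure lebesgue P * ((if fst i = 0 then 1 else 1 / 2) * (if snd i = 0 then 1 else 1 / 2))"

text \<open>The contribution of mode \<open>i\<close> to the squared norm of \<open>u\<close> in
  Parseval's identity.\<close>

definition energy :: "(real^2 \<Rightarrow> real) \<Rightarrow> nat \<times> nat \<Rightarrow> real" where
  "energy u i = (ip P u (e_cc i))\<^sup>2 / e_norm i"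

lemma e_norm_pos: "0 < e_norm i"
  using measure_P_pos by (simp add: e_norm_def)

lemma e_continuous: "continuous_on S (e_cc i)" "continuous_on S (e_sc i)" "continuous_on S (e_cs i)"
  unfolding e_cc_def[abs_def] e_sc_def[abs_def] e_cs_def[abs_def]
  by (intro continuous_intros s_t_continuous)+

lemma L2_e: "L2 P (e_cc i)" "L2 P (e_sc i)" "L2 P (e_cs i)"
  by (intro L2_continuous_P e_continuous)+

lemma ip_tensor:
  assumes "continuous_on UNIV f" "continuous_on UNIV h" "continuous_on UNIV f'" "continuous_on UNIV h'"
  shows "ip P (\<lambda>x. f (s x) * h (t x)) (\<lambda>x. f' (s x) * h' (t x))
    = measure lebesgue P * (integral {0..1} (\<lambda>y. f y * f' y) * integral {0..1} (\<lambda>y. h y * h' y))"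
proof -
  have "ip P (\<lambda>x. f (s x) * h (t x)) (\<lambda>x. f' (s x) * h' (t x))
    = (LINT x|lebesgue_on P. (f (s x) * f' (s x)) * (h (t x) * h' (t x)))"
    by (simp add: ip_real mult_ac)
  then show ?thesis
    using assms by (simp add: integral_tensor[of "\<lambda>y. f y * f' y" "\<lambda>y. h y * h' y"] continuous_on_mult)
qed

lemma ip_e_cc: "ip P (e_cc i) (e_cc j) = (if i = j then e_norm i else 0)"
  unfolding e_cc_def[abs_def]
  by (subst ip_tensor) (auto intro!: continuous_intros simp: integral_cos_cos e_norm_def prod_eq_iff)

lemma ip_e_sc: "ip P (e_sc i) (e_sc j) = (if i = j then e_norm i else 0)" if "fst i \<noteq> 0"
  using that unfolding e_sc_def[abs_def]
  by (subst ip_tensor)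
    (auto intro!: continuous_intros simp: integral_cos_cos integral_sin_sin e_norm_def prod_eq_iff)

lemma ip_e_cs: "ip P (e_cs i) (e_cs j) = (if i = j then e_norm i else 0)" if "snd i \<noteq> 0"
  using that unfolding e_cs_def[abs_def]
  by (subst ip_tensor)
    (auto intro!: continuous_intros simp: integral_cos_cos integral_sin_sin e_norm_def prod_eq_iff)

text \<open>Generation by single modes and sums makes closure under products, required by
  Stone-Weierstrass, a nested induction; \<open>trig_poly_expand\<close> recovers a finite sum over
  distinct modes.\<close>

inductive trig_poly :: "(real^2 \<Rightarrow> real) \<Rightarrow> bool" where
  base: "trig_poly (\<lambda>x. c * e_cc i x)"
| add: "trig_poly f \<Longrightarrow> trig_poly g \<Longrightarrow> trig_poly (\<lambda>x. f x + g x)"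

lemma trig_poly_const: "trig_poly (\<lambda>x. c)"
  using base[of c "(0, 0)"] by (simp add: e_cc_def)

lemma trig_poly_continuous: "trig_poly f \<Longrightarrow> continuous_on S f"
  by (induction rule: trig_poly.induct) (auto intro!: continuous_intros e_continuous)

lemma trig_poly_mult_base: "trig_poly (\<lambda>x. (c * e_cc i x) * (d * e_cc j x))"
proof -
  have cc: "cos (real m * pi * y) * cos (real n * pi * y)
    = (1 / 2) * cos (real (m + n) * pi * y) + (1 / 2) * cos (real ((m - n) + (n - m)) * pi * y)" for m n y
    using cos_mult_cos_nat[of m "pi * y" n] by (simp only: mult.assoc)
  obtain m n m' n' where ij: "i = (m, n)" "j = (m', n')" by (metis surj_pair)
  let ?d = "\<lambda>m n. (m - n) + (n - m) :: nat"
  have "(c * e_cc i x) * (d * e_cc j x)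
    = (c * d / 4 * e_cc (m + m', n + n') x + c * d / 4 * e_cc (m + m', ?d n n') x)
     + (c * d / 4 * e_cc (?d m m', n + n') x + c * d / 4 * e_cc (?d m m', ?d n n') x)" for x
  proof -
    have "(c * e_cc i x) * (d * e_cc j x)
    = (c * d) * ((cos (real m * pi * s x) * cos (real m' * pi * s x))
        * (cos (real n * pi * t x) * cos (real n' * pi * t x)))"
      by (simp add: e_cc_def ij mult_ac)
    moreover have "(c * d) * ((1 / 2 * A + 1 / 2 * B) * (1 / 2 * C + 1 / 2 * E))
      = (c * d / 4 * (A * C) + c * d / 4 * (A * E)) + (c * d / 4 * (B * C) + c * d / 4 * (B * E))" for A B C E
      by (simp add: field_simps)
    ultimately show ?thesis
      unfolding cc e_cc_def fst_conv snd_conv by (simp only:)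
  qed
  then show ?thesis
    by (simp only:) (intro trig_poly.intros)
qed

lemma trig_poly_mult:
  assumes "trig_poly f" "trig_poly g"
  shows "trig_poly (\<lambda>x. f x * g x)"
  using assms
proof (induction rule: trig_poly.induct)
  case (base c i)
  from base show ?case
    by (induction rule: trig_poly.induct)
      (auto simp only: distrib_left intro: trig_poly_mult_base trig_poly.add)
next
  case (add f h)
  then show ?case
    by (simp only: distrib_right) (intro trig_poly.add; blast)
qed

lemma trig_poly_expand:
  "trig_poly f \<Longrightarrow> \<exists>F c. finite F \<and> f = (\<lambda>x. \<Sum>i\<in>F. c i * e_cc i x)"
proof (induction rule: trig_poly.induct)
  case (base c i)
  show ?case by (rule exI[of _ "{i}"], rule exI[of _ "\<lambda>_. c"]) simp
next
  case (add f g)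
  then obtain F c G d where fg: "finite F" "f = (\<lambda>x. \<Sum>i\<in>F. c i * e_cc i x)"
     "finite G" "g = (\<lambda>x. \<Sum>i\<in>G. d i * e_cc i x)"
    by blast
  have 1: "f x = (\<Sum>i\<in>F \<union> G. (if i \<in> F then c i else 0) * e_cc i x)" for x
    using fg by (auto intro!: sum.mono_neutral_cong_left)
  have 2: "g x = (\<Sum>i\<in>F \<union> G. (if i \<in> G then d i else 0) * e_cc i x)" for x
    using fg by (auto intro!: sum.mono_neutral_cong_left)
  show ?case
    using fg(1,3)
    by (intro exI[of _ "F \<union> G"] exI[of _ "\<lambda>i. (if i \<in> F then c i else 0) + (if i \<in> G then d i else 0)"])
      (auto simp only: 1 2 distrib_right sum.distrib finite_Un)
qed

lemma trig_poly_uniform_approx: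
  assumes "continuous_on UNIV G" "0 < \<epsilon>"
  shows "\<exists>g. trig_poly g \<and> (\<forall>x\<in>P. \<bar>G x - g x\<bar> < \<epsilon>)"
proof -
  \<comment> \<open>Stone-Weierstrass needs a compact set, hence the closed parallelogram.\<close>
  let ?S = "{x. 0 \<le> s x \<and> s x \<le> 1 \<and> 0 \<le> t x \<and> t x \<le> 1}"
  have "\<exists>g. trig_poly g \<and> (\<forall>x\<in>?S. \<bar>G x - g x\<bar> < \<epsilon>)"
  proof (rule Stone_Weierstrass_HOL)
    show "compact ?S" by (rule P_subset_compact)
    show "\<exists>f. trig_poly f \<and> f x \<noteq> f y" if xy: "x \<in> ?S \<and> y \<in> ?S \<and> x \<noteq> y" for x y
    proof -
      \<comment> \<open>Cosine is injective on a half period, so the modes (1, 0) and (0, 1) recover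
        \<open>s\<close> and \<open>t\<close> and separate points.\<close>
      have inj: "cos (pi * c) = cos (pi * d) \<Longrightarrow> c = d" if "0 \<le> c" "c \<le> 1" "0 \<le> d" "d \<le> 1" for c d
        using cos_inj_pi[of "pi * c" "pi * d"] that by simp
      have "s x \<noteq> s y \<or> t x \<noteq> t y"
        using xy s_t_inverse by metis
      then have "1 * e_cc (1, 0) x \<noteq> 1 * e_cc (1, 0) y \<or> 1 * e_cc (0, 1) x \<noteq> 1 * e_cc (0, 1) y"
        using xy inj by (auto simp: e_cc_def)
      then show ?thesis using trig_poly.base by blast
    qed
  qed (use assms in \<open>auto intro: trig_poly_const trig_poly_continuous trig_poly.add trig_poly_mult
      continuous_on_subset\<close>)
  then show ?thesis by (fastforce simp: P_eq)
qed

lemma trig_poly_dense: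
  assumes u: "L2 P u" and "0 < \<epsilon>"
  shows "\<exists>F c. finite F \<and> ip P (\<lambda>x. u x - (\<Sum>i\<in>F. c i * e_cc i x)) (\<lambda>x. u x - (\<Sum>i\<in>F. c i * e_cc i x)) < \<epsilon>"
proof -
  obtain G where G: "continuous_on UNIV G" "ip P (\<lambda>x. u x - G x) (\<lambda>x. u x - G x) < \<epsilon> / 4"
    using L2_approx_continuous[OF P_lmeasurable u, of "\<epsilon> / 4"] \<open>0 < \<epsilon>\<close> by auto
  \<comment> \<open>Uniform error \<open>\<delta>\<close> costs \<open>\<epsilon> / 8\<close> in
    squared norm; doubled together with the other error it leaves 3/4 of
    \<open>\<epsilon>\<close>.\<close>
  define \<delta> where "\<delta> = sqrt (\<epsilon> / (8 * measure lebesgue P))"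
  have \<delta>: "0 < \<delta>" "\<delta>\<^sup>2 * measure lebesgue P = \<epsilon> / 8"
    using \<open>0 < \<epsilon>\<close> measure_P_pos by (auto simp: \<delta>_def)
  obtain g where g: "trig_poly g" "\<And>x. x \<in> P \<Longrightarrow> \<bar>G x - g x\<bar> < \<delta>"
    using trig_poly_uniform_approx[OF G(1) \<delta>(1)] by blast
  have L2: "L2 P G" "L2 P g"
    using G(1) g(1) by (auto intro: L2_continuous_P trig_poly_continuous)
  interpret finite_measure "lebesgue_on P"
    by (rule finite_measure_lebesgue_on[OF P_lmeasurable])
  have "ip P (\<lambda>x. G x - g x) (\<lambda>x. G x - g x) \<le> (LINT x|lebesgue_on P. \<delta>\<^sup>2)"
    unfolding ip_real
  proof (rule integral_mono)
    show "integrable (lebesgue_on P) (\<lambda>x. (G x - g x) * (G x - g x))"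
      using L2 by (intro L2_mult_integrable L2_diff)
    fix x assume "x \<in> space (lebesgue_on P)"
    then have "\<bar>G x - g x\<bar> \<le> \<delta>" using g(2)[of x] by simp
    then have "\<bar>G x - g x\<bar>\<^sup>2 \<le> \<delta>\<^sup>2" by (intro power_mono) auto
    then show "(G x - g x) * (G x - g x) \<le> \<delta>\<^sup>2" by (simp add: power2_eq_square)
  qed simp
  also have "\<dots> = \<epsilon> / 8"
    using \<delta>(2) P_lmeasurable by (simp add: measure_restrict_space fmeasurableD mult.commute)
  finally have "ip P (\<lambda>x. u x - g x) (\<lambda>x. u x - g x) < \<epsilon>"
    using ip_sq_triangle[OF u L2] G(2) \<open>0 < \<epsilon>\<close> by simp
  moreover obtain F c where "finite F" "g = (\<lambda>x. \<Sum>i\<in>F. c i * e_cc i x)"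
    using trig_poly_expand[OF g(1)] by blast
  ultimately show ?thesis by blast
qed

text \<open>Parseval together with Bessel's inequality for the derivatives: all but finitely many
  Fourier modes of \<open>u\<close> are controlled by the Dirichlet energy, which yields both the sharp
  Poincare inequality on a square and the compactness of the embedding of \<open>H\<^sup>1\<close> into \<open>L\<^sup>2\<close>.\<close>

lemma spectral_gap:
  assumes u: "L2 P u" and ga: "L2 P ga" and gb: "L2 P gb"
    and ibp_a: "\<And>i. ip P ga (e_sc i) = - (real (fst i) * pi) * ip P u (e_cc i)"
    and ibp_b: "\<And>i. ip P gb (e_cs i) = - (real (snd i) * pi) * ip P u (e_cc i)"
    and K: "finite K" "\<And>i. i \<notin> K \<Longrightarrow> R \<le> (real (fst i))\<^sup>2 + (real (snd i))\<^sup>2" and R: "0 < R"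
  shows "ip P u u \<le> (\<Sum>i\<in>K. energy u i) + (ip P ga ga + ip P gb gb) / (pi\<^sup>2 * R)"
proof (rule field_le_epsilon)
  fix \<epsilon> :: real assume "0 < \<epsilon>"
  then obtain F c where F: "finite F"
    and Fc: "ip P (\<lambda>x. u x - (\<Sum>i\<in>F. c i * e_cc i x)) (\<lambda>x. u x - (\<Sum>i\<in>F. c i * e_cc i x)) < \<epsilon>"
    using trig_poly_dense[OF u] by blast
  define F' where "F' = F \<union> K"
  have F': "finite F'" using F K by (simp add: F'_def)
  \<comment> \<open>Padding with zero coefficients enlarges the index set to contain
    \<open>K\<close> without changing the approximating sum.\<close>
  define c' where "c' i = (if i \<in> F then c i else 0)" for i
  have sum_c': "(\<Sum>i\<in>F. c i * e_cc i x) = (\<Sum>i\<in>F'. c' i * e_cc i x)" for x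
    using F' by (intro sum.mono_neutral_cong_left) (auto simp: F'_def c'_def)
  have "ip P u u - (\<Sum>i\<in>F'. energy u i)
      \<le> ip P (\<lambda>x. u x - (\<Sum>i\<in>F'. c' i * e_cc i x)) (\<lambda>x. u x - (\<Sum>i\<in>F'. c' i * e_cc i x))"
    unfolding energy_def
    by (rule ip_best_approximation) (auto simp: F' L2_e u ip_e_cc e_norm_pos)
  with Fc have le1: "ip P u u \<le> (\<Sum>i\<in>F'. energy u i) + \<epsilon>"
    by (simp add: sum_c')
  have bessel_a: "(\<Sum>i\<in>F'. (pi * real (fst i))\<^sup>2 * energy u i) \<le> ip P ga ga"
  proof -
    \<comment> \<open>Modes with \<open>fst i = 0\<close> have weight 0 here, and their
      \<open>e_sc\<close> is the zero function, which an orthogonal system with positive norms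
      cannot contain.\<close>
    have "(\<Sum>i\<in>F'. (pi * real (fst i))\<^sup>2 * energy u i)
        = (\<Sum>i\<in>{i\<in>F'. fst i \<noteq> 0}. (pi * real (fst i))\<^sup>2 * energy u i)"
      using F' by (intro sum.mono_neutral_right) auto
    also have "\<dots> = (\<Sum>i\<in>{i\<in>F'. fst i \<noteq> 0}. (ip P ga (e_sc i))\<^sup>2 / e_norm i)"
      by (intro sum.cong refl) (simp add: ibp_a energy_def power_mult_distrib mult_ac)
    also have "\<dots> \<le> ip P ga ga"
      by (rule ip_bessel) (auto simp: F' L2_e ga ip_e_sc e_norm_pos)
    finally show ?thesis .
  qed
  have bessel_b: "(\<Sum>i\<in>F'. (pi * real (snd i))\<^sup>2 * energy u i) \<le> ip P gb gb"
  proof -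
    have "(\<Sum>i\<in>F'. (pi * real (snd i))\<^sup>2 * energy u i)
        = (\<Sum>i\<in>{i\<in>F'. snd i \<noteq> 0}. (pi * real (snd i))\<^sup>2 * energy u i)"
      using F' by (intro sum.mono_neutral_right) auto
    also have "\<dots> = (\<Sum>i\<in>{i\<in>F'. snd i \<noteq> 0}. (ip P gb (e_cs i))\<^sup>2 / e_norm i)"
      by (intro sum.cong refl) (simp add: ibp_b energy_def power_mult_distrib mult_ac)
    also have "\<dots> \<le> ip P gb gb"
      by (rule ip_bessel) (auto simp: F' L2_e gb ip_e_cs e_norm_pos)
    finally show ?thesis .
  qed
  have energy_nonneg: "0 \<le> energy u i" for i
    using e_norm_pos[of i] by (simp add: energy_def)
  \<comment> \<open>Outside \<open>K\<close> each mode has squared frequency at least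
    \<open>R\<close>, so its energy is paid for by the two Bessel sums.\<close>
  have "pi\<^sup>2 * R * (\<Sum>i\<in>F' - K. energy u i) = (\<Sum>i\<in>F' - K. pi\<^sup>2 * R * energy u i)"
    by (simp add: sum_distrib_left)
  also have "\<dots> \<le> (\<Sum>i\<in>F' - K. (pi * real (fst i))\<^sup>2 * energy u i + (pi * real (snd i))\<^sup>2 * energy u i)"
  proof (rule sum_mono)
    fix i assume "i \<in> F' - K"
    then have "pi\<^sup>2 * R * energy u i \<le> pi\<^sup>2 * ((real (fst i))\<^sup>2 + (real (snd i))\<^sup>2) * energy u i"
      using K(2) energy_nonneg by (intro mult_right_mono mult_left_mono) auto
    then show "pi\<^sup>2 * R * energy u i \<le> (pi * real (fst i))\<^sup>2 * energy u i + (pi * real (snd i))\<^sup>2 * energy u i"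
      by (simp add: power_mult_distrib algebra_simps)
  qed
  also have "\<dots> \<le> (\<Sum>i\<in>F'. (pi * real (fst i))\<^sup>2 * energy u i + (pi * real (snd i))\<^sup>2 * energy u i)"
    using F' energy_nonneg by (intro sum_mono2) auto
  also have "\<dots> \<le> ip P ga ga + ip P gb gb"
    using bessel_a bessel_b by (simp add: sum.distrib)
  finally have "(\<Sum>i\<in>F' - K. energy u i) \<le> (ip P ga ga + ip P gb gb) / (pi\<^sup>2 * R)"
    using R by (simp add: pos_le_divide_eq mult.commute)
  moreover have "(\<Sum>i\<in>F'. energy u i) = (\<Sum>i\<in>K. energy u i) + (\<Sum>i\<in>F' - K. energy u i)"
    using F' by (subst sum.subset_diff[of K F']) (auto simp: F'_def)
  ultimately show "ip P u u \<le> (\<Sum>i\<in>K. energy u i) + (ip P ga ga + ip P gb gb) / (pi\<^sup>2 * R) + \<epsilon>"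
    using le1 by linarith
qed

end

section \<open>The Sobolev space\<close>

lemma ip_Cauchy_Schwarz:
  assumes u: "L2 \<Omega> u" and v: "L2 \<Omega> v"
  shows "(ip \<Omega> u v)\<^sup>2 \<le> ip \<Omega> u u * ip \<Omega> v v"
proof (cases "ip \<Omega> v v = 0")
  case True
  have "ip \<Omega> u v = 0"
  proof (rule ccontr)
    assume n: "ip \<Omega> u v \<noteq> 0"
    \<comment> \<open>When \<open>v\<close> has norm 0 the square of \<open>u - c v\<close> is
      affine in \<open>c\<close>; this choice makes it -1.\<close>
    define c where "c = (ip \<Omega> u u + 1) / (2 * ip \<Omega> u v)"
    have c: "c * ip \<Omega> u v = (ip \<Omega> u u + 1) / 2" using n by (simp add: c_def)
    have "0 \<le> ip \<Omega> (\<lambda>x. u x - c *\<^sub>R v x) (\<lambda>x. u x - c *\<^sub>R v x)"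
      by (rule ip_nonneg)
    also have "\<dots> = ip \<Omega> u u - 2 * (c * ip \<Omega> u v)"
      using ip_sq_diff[OF u L2_scaleR[OF v, of c]] True by (simp add: ip_scaleR_left ip_scaleR_right)
    also have "\<dots> = -1" unfolding c by (simp add: field_simps)
    finally show False by simp
  qed
  with True show ?thesis by simp
next
  case False
  then have pos: "0 < ip \<Omega> v v" using ip_nonneg[of \<Omega> v] by linarith
  define c where "c = ip \<Omega> u v / ip \<Omega> v v"
  have "0 \<le> ip \<Omega> (\<lambda>x. u x - c *\<^sub>R v x) (\<lambda>x. u x - c *\<^sub>R v x)"
    by (rule ip_nonneg)
  also have "\<dots> = ip \<Omega> u u - 2 * (c * ip \<Omega> u v) + c * (c * ip \<Omega> v v)"
    using ip_sq_diff[OF u L2_scaleR[OF v, of c]] by (simp add: ip_scaleR_left ip_scaleR_right)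
  also have "\<dots> = ip \<Omega> u u - (ip \<Omega> u v)\<^sup>2 / ip \<Omega> v v"
    using pos by (simp add: c_def power2_eq_square)
  finally show ?thesis
    using pos by (simp add: pos_divide_le_eq)
qed

lemma ip_tendsto_left:
  assumes "\<And>k. L2 \<Omega> (u k)" "L2 \<Omega> v" "L2 \<Omega> w"
    and "(\<lambda>k. ip \<Omega> (\<lambda>x. u k x - v x) (\<lambda>x. u k x - v x)) \<longlonglongrightarrow> 0"
  shows "(\<lambda>k. ip \<Omega> (u k) w) \<longlonglongrightarrow> ip \<Omega> v w"
proof -
  have "(\<lambda>k. (ip \<Omega> (\<lambda>x. u k x - v x) w)\<^sup>2) \<longlonglongrightarrow> 0"
  proof (rule tendsto_sandwich[OF _ _ tendsto_const])
    show "(\<lambda>k. ip \<Omega> (\<lambda>x. u k x - v x) (\<lambda>x. u k x - v x) * ip \<Omega> w w) \<longlonglongrightarrow> 0"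
      using tendsto_mult_right[OF assms(4), of "ip \<Omega> w w"] by simp
    show "\<forall>\<^sub>F k in sequentially. (ip \<Omega> (\<lambda>x. u k x - v x) w)\<^sup>2
        \<le> ip \<Omega> (\<lambda>x. u k x - v x) (\<lambda>x. u k x - v x) * ip \<Omega> w w"
      using assms by (intro always_eventually allI ip_Cauchy_Schwarz L2_diff)
  qed simp
  from tendsto_real_sqrt[OF this] have "(\<lambda>k. ip \<Omega> (\<lambda>x. u k x - v x) w) \<longlonglongrightarrow> 0"
    by (simp add: tendsto_rabs_zero_iff)
  then have "(\<lambda>k. ip \<Omega> (u k) w - ip \<Omega> v w) \<longlonglongrightarrow> 0"
    using assms by (simp add: ip_diff_left)
  then show ?thesis by (simp add: LIM_zero_iff)
qed

lemma GDERIV_unique: "GDERIV f x :> D \<Longrightarrow> GDERIV f x :> E \<Longrightarrow> D = E"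
  unfolding gderiv_def by (drule (1) has_derivative_unique) (simp add: fun_eq_iff vector_eq_ldot)

lemma GDERIV_zero_outside:
  assumes "compact K" "\<And>x. x \<notin> K \<Longrightarrow> f x = 0" "GDERIV f x :> D" "x \<notin> K"
  shows "D = 0"
proof -
  have "open (- K)" using compact_imp_closed[OF assms(1)] by (simp add: open_Compl)
  have "((\<lambda>x. 0) has_derivative (\<lambda>h. h \<bullet> D)) (at x)"
    using assms(3) unfolding gderiv_def
    by (rule has_derivative_transform_within_open[OF _ \<open>open (- K)\<close>]) (use assms in auto)
  then have "GDERIV (\<lambda>x. 0) x :> D" by (simp add: gderiv_def)
  from GDERIV_unique[OF this GDERIV_const] show ?thesis .
qed

lemma compact_support_bounded:
  fixes F :: "'a::euclidean_space \<Rightarrow> 'b::euclidean_space"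
  assumes "compact K" "\<And>x. x \<notin> K \<Longrightarrow> F x = 0" "continuous_on UNIV F"
  obtains B where "0 \<le> B" "\<And>x. norm (F x) \<le> B"
proof -
  have "compact (F ` K)"
    using assms by (intro compact_continuous_image) (auto intro: continuous_on_subset)
  then obtain B where "\<And>y. y \<in> F ` K \<Longrightarrow> norm y \<le> B"
    using compact_imp_bounded bounded_iff by metis
  then have "norm (F x) \<le> max B 0" for x
    using assms(2)[of x] by (cases "x \<in> K") (auto simp: le_max_iff_disj simp del: norm_le_zero_iff)
  with that[of "max B 0"] show ?thesis by auto
qed

lemma test_function_regular:
  fixes \<phi> :: "'a::euclidean_space \<Rightarrow> real"
  assumes "test_function \<Omega> \<phi>" "\<And>x. GDERIV \<phi> x :> D\<phi> x"
  shows "continuous_on UNIV \<phi>" "continuous_on UNIV D\<phi>"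
proof -
  show "continuous_on UNIV \<phi>"
    using assms(2) by (rule GDERIV_imp_continuous_on)
  have "C_k (Suc 0) \<phi>"
    using assms(1) by (auto simp: test_function_def simp del: C_k.simps)
  then obtain Df where Df: "\<And>x. GDERIV \<phi> x :> Df x" "\<And>b. b \<in> Basis \<Longrightarrow> continuous_on UNIV (\<lambda>x. Df x \<bullet> b)"
    by auto
  have "D\<phi> = Df"
    using GDERIV_unique[OF assms(2) Df(1)] by auto
  then show "continuous_on UNIV D\<phi>"
    using Df(2) by (subst continuous_on_componentwise) auto
qed

lemma borel_measurable_lebesgue_on_continuous:
  fixes F :: "'a::euclidean_space \<Rightarrow> 'b::euclidean_space"
  assumes "continuous_on UNIV F"
  shows "F \<in> borel_measurable (lebesgue_on \<Omega>)"
  using borel_measurable_continuous_onI[OF assms]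
  by (intro measurable_restrict_space1) (simp add: measurable_completion)

lemma test_function_L2:
  fixes \<phi> :: "'a::euclidean_space \<Rightarrow> real"
  assumes "\<Omega> \<in> lmeasurable" "test_function \<Omega> \<phi>" "\<And>x. GDERIV \<phi> x :> D\<phi> x"
  shows "L2 \<Omega> \<phi>" "L2 \<Omega> D\<phi>"
proof -
  note cont = test_function_regular[OF assms(2,3)]
  obtain K where K: "compact K" "\<And>x. x \<notin> K \<Longrightarrow> \<phi> x = 0"
    using assms(2) by (auto simp: test_function_def)
  obtain B where "\<And>x. norm (\<phi> x) \<le> B"
    using compact_support_bounded[OF K cont(1)] by blast
  then show "L2 \<Omega> \<phi>"
    by (intro L2_bounded[OF assms(1)] borel_measurable_lebesgue_on_continuous cont)
  have "\<And>x. x \<notin> K \<Longrightarrow> D\<phi> x = 0"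
    using GDERIV_zero_outside[OF K assms(3)] by blast
  then obtain B where "\<And>x. norm (D\<phi> x) \<le> B"
    using compact_support_bounded[OF K(1) _ cont(2)] by blast
  then show "L2 \<Omega> D\<phi>"
    by (intro L2_bounded[OF assms(1)] borel_measurable_lebesgue_on_continuous cont)
qed

lemma L2_scaleR_integrable:
  fixes u :: "'a::euclidean_space \<Rightarrow> real" and v :: "'a \<Rightarrow> 'b::euclidean_space"
  assumes "L2 \<Omega> u" "L2 \<Omega> v"
  shows "integrable (lebesgue_on \<Omega>) (\<lambda>x. u x *\<^sub>R v x)"
proof (rule Bochner_Integration.integrable_bound)
  show "integrable (lebesgue_on \<Omega>) (\<lambda>x. (u x)\<^sup>2 + (norm (v x))\<^sup>2)"
    using assms by (auto simp: L2_def)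
  show "(\<lambda>x. u x *\<^sub>R v x) \<in> borel_measurable (lebesgue_on \<Omega>)"
    using assms by (auto simp: L2_def)
  have "\<bar>c\<bar> * d \<le> c\<^sup>2 + d\<^sup>2" if "0 \<le> d" for c d :: real
    using sum_squares_bound[of "\<bar>c\<bar>" d] that mult_nonneg_nonneg[OF abs_ge_zero[of c] that]
    unfolding power2_abs by linarith
  then show "AE x in lebesgue_on \<Omega>. norm (u x *\<^sub>R v x) \<le> norm ((u x)\<^sup>2 + (norm (v x))\<^sup>2)"
    by (intro AE_I2) (simp add: abs_of_nonneg)
qed

text \<open>Pairing the vector identity with a fixed \<open>w\<close> yields scalar identities, to
  which the calculus of \<open>ip\<close> applies and in which \<open>w\<close> can be chosen along
  a side.\<close>

lemma weak_gradient_iff: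
  fixes u :: "'a::euclidean_space \<Rightarrow> real" and g :: "'a \<Rightarrow> 'a"
  assumes "\<Omega> \<in> lmeasurable" "L2 \<Omega> u" "L2 \<Omega> g"
  shows "weak_gradient \<Omega> u g \<longleftrightarrow>
    (\<forall>\<phi> D\<phi>. test_function \<Omega> \<phi> \<longrightarrow> (\<forall>x. GDERIV \<phi> x :> D\<phi> x) \<longrightarrow>
      (\<forall>w. ip \<Omega> u (\<lambda>x. D\<phi> x \<bullet> w) = - ip \<Omega> (\<lambda>x. g x \<bullet> w) \<phi>))"
  unfolding weak_gradient_def
proof (intro all_cong1 imp_cong refl)
  fix \<phi> :: "'a \<Rightarrow> real" and D\<phi>
  assume \<phi>: "test_function \<Omega> \<phi>" "\<forall>x. GDERIV \<phi> x :> D\<phi> x"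
  let ?I = "LINT x|lebesgue_on \<Omega>. u x *\<^sub>R D\<phi> x" and ?J = "LINT x|lebesgue_on \<Omega>. \<phi> x *\<^sub>R g x"
  have L2: "L2 \<Omega> \<phi>" "L2 \<Omega> D\<phi>"
    using test_function_L2[OF assms(1) \<phi>(1)] \<phi>(2) by auto
  have "?I \<bullet> w = ip \<Omega> u (\<lambda>x. D\<phi> x \<bullet> w)" for w
    using integral_inner_left[of w "lebesgue_on \<Omega>" "\<lambda>x. u x *\<^sub>R D\<phi> x"]
      L2_scaleR_integrable[OF assms(2) L2(2)]
    by (simp add: ip_real)
  moreover have "?J \<bullet> w = ip \<Omega> (\<lambda>x. g x \<bullet> w) \<phi>" for w
    using integral_inner_left[of w "lebesgue_on \<Omega>" "\<lambda>x. \<phi> x *\<^sub>R g x"]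
      L2_scaleR_integrable[OF L2(1) assms(3)]
    by (simp add: ip_real mult.commute[of "g _ \<bullet> w"])
  moreover have "?I = - ?J \<longleftrightarrow> (\<forall>w. ?I \<bullet> w = - (?J \<bullet> w))"
    by (simp add: vector_eq_rdot[symmetric, of ?I "- ?J"] del: vector_eq_rdot)
  ultimately show "?I = - ?J \<longleftrightarrow> (\<forall>w. ip \<Omega> u (\<lambda>x. D\<phi> x \<bullet> w) = - ip \<Omega> (\<lambda>x. g x \<bullet> w) \<phi>)"
    by simp
qed

lemma H1_iff:
  assumes "\<Omega> \<in> lmeasurable"
  shows "H1 \<Omega> u g \<longleftrightarrow> L2 \<Omega> u \<and> L2 \<Omega> g \<and>
    (\<forall>\<phi> D\<phi>. test_function \<Omega> \<phi> \<longrightarrow> (\<forall>x. GDERIV \<phi> x :> D\<phi> x) \<longrightarrow>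
      (\<forall>w. ip \<Omega> u (\<lambda>x. D\<phi> x \<bullet> w) = - ip \<Omega> (\<lambda>x. g x \<bullet> w) \<phi>))"
  unfolding H1_def using weak_gradient_iff[OF assms] by blast

lemma H1_add:
  assumes \<Omega>: "\<Omega> \<in> lmeasurable" and "H1 \<Omega> u g" "H1 \<Omega> v h"
  shows "H1 \<Omega> (\<lambda>x. u x + v x) (\<lambda>x. g x + h x)"
  unfolding H1_iff[OF \<Omega>]
proof (intro conjI allI impI)
  have L2: "L2 \<Omega> u" "L2 \<Omega> g" "L2 \<Omega> v" "L2 \<Omega> h"
    using assms by (auto simp: H1_def)
  then show "L2 \<Omega> (\<lambda>x. u x + v x)" "L2 \<Omega> (\<lambda>x. g x + h x)"
    by (auto intro: L2_add)
  fix \<phi> D\<phi> w assume \<phi>: "test_function \<Omega> \<phi>" "\<forall>x. GDERIV \<phi> x :> D\<phi> x"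
  have \<phi>L2: "L2 \<Omega> \<phi>" "L2 \<Omega> (\<lambda>x. D\<phi> x \<bullet> w)"
    using test_function_L2[OF \<Omega> \<phi>(1)] \<phi>(2) by (auto intro: L2_inner_const)
  have "ip \<Omega> u (\<lambda>x. D\<phi> x \<bullet> w) = - ip \<Omega> (\<lambda>x. g x \<bullet> w) \<phi>"
    "ip \<Omega> v (\<lambda>x. D\<phi> x \<bullet> w) = - ip \<Omega> (\<lambda>x. h x \<bullet> w) \<phi>"
    using assms(2,3) \<phi> unfolding H1_iff[OF \<Omega>] by blast+
  then show "ip \<Omega> (\<lambda>x. u x + v x) (\<lambda>x. D\<phi> x \<bullet> w) = - ip \<Omega> (\<lambda>x. (g x + h x) \<bullet> w) \<phi>"
    using L2 \<phi>L2 by (simp add: inner_add_left ip_add_left L2_inner_const)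
qed

lemma H1_cmult:
  assumes \<Omega>: "\<Omega> \<in> lmeasurable" and "H1 \<Omega> u g"
  shows "H1 \<Omega> (\<lambda>x. c * u x) (\<lambda>x. c *\<^sub>R g x)"
  using assms(2) unfolding H1_iff[OF \<Omega>]
  by (auto intro!: L2_cmult L2_scaleR simp: ip_cmult_left)

lemma H1_diff:
  assumes \<Omega>: "\<Omega> \<in> lmeasurable" and "H1 \<Omega> u g" "H1 \<Omega> v h"
  shows "H1 \<Omega> (\<lambda>x. u x - v x) (\<lambda>x. g x - h x)"
  using H1_add[OF \<Omega> assms(2) H1_cmult[OF \<Omega> assms(3), of "-1"]] by simp

text \<open>For a fixed test function and direction both sides of the scalar identity are continuous
  in L2, so the identity survives the limit.\<close>

lemma H1_closed:
  assumes \<Omega>: "\<Omega> \<in> lmeasurable" and H: "\<And>k. H1 \<Omega> (u k) (g k)"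
    and u: "L2 \<Omega> v" "(\<lambda>k. LINT x|lebesgue_on \<Omega>. (norm (u k x - v x))\<^sup>2) \<longlonglongrightarrow> 0"
    and g: "L2 \<Omega> h" "(\<lambda>k. LINT x|lebesgue_on \<Omega>. (norm (g k x - h x))\<^sup>2) \<longlonglongrightarrow> 0"
  shows "H1 \<Omega> v h"
  unfolding H1_iff[OF \<Omega>]
proof (intro conjI allI impI u(1) g(1))
  fix \<phi> D\<phi> w assume \<phi>: "test_function \<Omega> \<phi>" "\<forall>x. GDERIV \<phi> x :> D\<phi> x"
  have L2: "\<And>k. L2 \<Omega> (u k)" "\<And>k. L2 \<Omega> (g k)"
    using H by (auto simp: H1_def)
  have \<phi>L2: "L2 \<Omega> \<phi>" "L2 \<Omega> D\<phi>"
    using test_function_L2[OF \<Omega> \<phi>(1)] \<phi>(2) by auto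
  have eq: "ip \<Omega> (u k) (\<lambda>x. D\<phi> x \<bullet> w) = - ip \<Omega> (\<lambda>x. g k x \<bullet> w) \<phi>" for k
    using H[of k] \<phi> unfolding H1_iff[OF \<Omega>] by blast
  have 1: "(\<lambda>k. ip \<Omega> (u k) (\<lambda>x. D\<phi> x \<bullet> w)) \<longlonglongrightarrow> ip \<Omega> v (\<lambda>x. D\<phi> x \<bullet> w)"
    using u L2 \<phi>L2 by (intro ip_tendsto_left L2_inner_const) (auto simp: ip_norm[symmetric])
  have "(\<lambda>k. ip \<Omega> (\<lambda>x. g k x \<bullet> w - h x \<bullet> w) (\<lambda>x. g k x \<bullet> w - h x \<bullet> w)) \<longlonglongrightarrow> 0"
  proof (rule tendsto_sandwich[OF _ _ tendsto_const])
    show "\<forall>\<^sub>F k in sequentially. ip \<Omega> (\<lambda>x. g k x \<bullet> w - h x \<bullet> w) (\<lambda>x. g k x \<bullet> w - h x \<bullet> w)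
        \<le> (norm w)\<^sup>2 * (LINT x|lebesgue_on \<Omega>. (norm (g k x - h x))\<^sup>2)"
    proof (intro always_eventually allI)
      fix k
      have d: "L2 \<Omega> (\<lambda>x. g k x - h x)" by (intro L2_diff L2 g)
      have "ip \<Omega> (\<lambda>x. (g k x - h x) \<bullet> w) (\<lambda>x. (g k x - h x) \<bullet> w)
          \<le> (LINT x|lebesgue_on \<Omega>. (norm w)\<^sup>2 * (norm (g k x - h x))\<^sup>2)"
        unfolding ip_real
      proof (rule integral_mono)
        show "integrable (lebesgue_on \<Omega>) (\<lambda>x. (g k x - h x) \<bullet> w * ((g k x - h x) \<bullet> w))"
          by (intro L2_mult_integrable L2_inner_const d)
        show "integrable (lebesgue_on \<Omega>) (\<lambda>x. (norm w)\<^sup>2 * (norm (g k x - h x))\<^sup>2)"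
          using d by (simp add: L2_def)
        show "(g k x - h x) \<bullet> w * ((g k x - h x) \<bullet> w) \<le> (norm w)\<^sup>2 * (norm (g k x - h x))\<^sup>2" for x
          using Cauchy_Schwarz_ineq[of "g k x - h x" w]
          by (simp only: power2_norm_eq_inner power2_eq_square[symmetric] mult.commute)
      qed
      then show "ip \<Omega> (\<lambda>x. g k x \<bullet> w - h x \<bullet> w) (\<lambda>x. g k x \<bullet> w - h x \<bullet> w)
        \<le> (norm w)\<^sup>2 * (LINT x|lebesgue_on \<Omega>. (norm (g k x - h x))\<^sup>2)"
        by (simp add: inner_diff_left)
    qed
    show "(\<lambda>k. (norm w)\<^sup>2 * (LINT x|lebesgue_on \<Omega>. (norm (g k x - h x))\<^sup>2)) \<longlonglongrightarrow> 0"
      using tendsto_mult_left[OF g(2), of "(norm w)\<^sup>2"] by simp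
  qed (simp add: ip_nonneg)
  then have "(\<lambda>k. ip \<Omega> (\<lambda>x. g k x \<bullet> w) \<phi>) \<longlonglongrightarrow> ip \<Omega> (\<lambda>x. h x \<bullet> w) \<phi>"
    using L2 g \<phi>L2 by (intro ip_tendsto_left L2_inner_const) auto
  from tendsto_minus[OF this] have 2: "(\<lambda>k. ip \<Omega> (u k) (\<lambda>x. D\<phi> x \<bullet> w)) \<longlonglongrightarrow> - ip \<Omega> (\<lambda>x. h x \<bullet> w) \<phi>"
    by (simp add: eq)
  from LIMSEQ_unique[OF 1 2] show "ip \<Omega> v (\<lambda>x. D\<phi> x \<bullet> w) = - ip \<Omega> (\<lambda>x. h x \<bullet> w) \<phi>" .
qed

text \<open>By translation invariance every difference quotient of \<open>\<psi>\<close> has integral 0.\<close>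

lemma integral_compact_support_derivative:
  fixes \<psi> :: "'a::euclidean_space \<Rightarrow> real"
  assumes D: "\<And>x. GDERIV \<psi> x :> D\<psi> x" and cont: "continuous_on UNIV D\<psi>"
    and K: "compact K" "\<And>x. x \<notin> K \<Longrightarrow> \<psi> x = 0"
  shows "(LINT x|lborel. D\<psi> x \<bullet> w) = 0"
proof -
  have \<psi>_cont: "continuous_on UNIV \<psi>" using D by (rule GDERIV_imp_continuous_on)
  have [measurable]: "\<psi> \<in> borel_measurable borel" "D\<psi> \<in> borel_measurable borel"
    using cont \<psi>_cont by (auto intro: borel_measurable_continuous_onI)
  have "\<And>x. x \<notin> K \<Longrightarrow> D\<psi> x = 0"
    using GDERIV_zero_outside[OF K D] by blast
  then obtain B where B: "0 \<le> B" "\<And>x. norm (D\<psi> x) \<le> B"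
    using compact_support_bounded[OF K(1) _ cont] by metis
  obtain R where R: "K \<subseteq> cball 0 R"
    using compact_imp_bounded[OF K(1)] unfolding bounded_iff by (auto simp: subset_iff)
  \<comment> \<open>Steps of size at most 1 keep all difference quotients supported in one ball,
    whose radius exceeds that of the support by \<open>norm w\<close>.\<close>
  define h where "h n = 1 / (real n + 1)" for n
  have h: "0 < h n" "h n \<le> 1" for n by (auto simp: h_def)
  have h_lim: "h \<longlonglongrightarrow> 0"
    unfolding h_def using LIMSEQ_inverse_real_of_nat by (simp add: inverse_eq_divide add.commute)
  define f where "f n x = (\<psi> (x + h n *\<^sub>R w) - \<psi> x) / h n" for n x
  have \<psi>_int: "integrable lborel \<psi>"
  proof -
    have "integrable lborel (\<lambda>x. indicator K x *\<^sub>R \<psi> x)"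
      using K(1) \<psi>_cont by (intro borel_integrable_compact) (auto intro: continuous_on_subset)
    moreover have "(\<lambda>x. indicator K x *\<^sub>R \<psi> x) = \<psi>"
      using K(2) by (auto simp: indicator_def fun_eq_iff)
    ultimately show ?thesis by simp
  qed
  have shift: "integrable lborel (\<lambda>x. \<psi> (x + c))" "(LINT x|lborel. \<psi> (x + c)) = (LINT x|lborel. \<psi> x)" for c
  proof -
    have "integrable (distr lborel borel ((+) c)) \<psi>"
      using \<psi>_int by (simp add: lborel_distr_plus)
    then show "integrable lborel (\<lambda>x. \<psi> (x + c))"
      by (subst (asm) integrable_distr_eq) (auto simp: add.commute)
    have "(LINT x|lborel. \<psi> x) = (LINT x|distr lborel borel ((+) c). \<psi> x)"
      by (simp add: lborel_distr_plus)
    also have "\<dots> = (LINT x|lborel. \<psi> (x + c))"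
      by (subst integral_distr) (auto simp: add.commute)
    finally show "(LINT x|lborel. \<psi> (x + c)) = (LINT x|lborel. \<psi> x)" by simp
  qed
  have f_zero: "(LINT x|lborel. f n x) = 0" for n
    unfolding f_def using shift \<psi>_int by simp
  have "(\<lambda>n. LINT x|lborel. f n x) \<longlonglongrightarrow> (LINT x|lborel. D\<psi> x \<bullet> w)"
  proof (rule integral_dominated_convergence)
    show "(\<lambda>x. D\<psi> x \<bullet> w) \<in> borel_measurable lborel" by measurable
    show "f n \<in> borel_measurable lborel" for n unfolding f_def[abs_def] by measurable
    show "integrable lborel (\<lambda>x. indicator (cball 0 (R + norm w)) x *\<^sub>R (B * norm w))"
      by (rule borel_integrable_compact) auto
    show "AE x in lborel. (\<lambda>n. f n x) \<longlonglongrightarrow> D\<psi> x \<bullet> w"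
    proof (rule AE_I2)
      fix x
      have "((\<lambda>r. \<psi> (x + r *\<^sub>R w)) has_derivative (\<lambda>r. (r *\<^sub>R w) \<bullet> D\<psi> x)) (at 0)"
      proof -
        have "((\<lambda>r. x + r *\<^sub>R w) has_derivative (\<lambda>r. r *\<^sub>R w)) (at 0)"
          by (auto intro!: derivative_eq_intros)
        moreover have "(\<psi> has_derivative (\<lambda>h. h \<bullet> D\<psi> x)) (at (x + 0 *\<^sub>R w))"
          using D[of x] by (simp add: gderiv_def)
        ultimately show ?thesis by (rule has_derivative_compose)
      qed
      then have "((\<lambda>r. \<psi> (x + r *\<^sub>R w)) has_real_derivative (D\<psi> x \<bullet> w)) (at 0)"
        unfolding has_field_derivative_def
        by (rule has_derivative_eq_rhs) (auto simp: fun_eq_iff inner_commute[of w "D\<psi> x"])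
      then have "((\<lambda>r. (\<psi> (x + r *\<^sub>R w) - \<psi> x) / r) \<longlongrightarrow> D\<psi> x \<bullet> w) (at 0)"
        by (simp add: has_field_derivative_iff)
      then show "(\<lambda>n. f n x) \<longlonglongrightarrow> D\<psi> x \<bullet> w"
        unfolding f_def
        by (rule filterlim_compose) (use h_lim h in \<open>auto simp: filterlim_at less_imp_neq[THEN not_sym]\<close>)
    qed
    show "AE x in lborel. norm (f n x) \<le> indicator (cball 0 (R + norm w)) x *\<^sub>R (B * norm w)" for n
    proof (rule AE_I2)
      fix x
      have "norm (\<psi> (x + h n *\<^sub>R w) - \<psi> x) \<le> B * norm (x + h n *\<^sub>R w - x)"
      proof (rule differentiable_bound[of UNIV])
        show "(\<psi> has_derivative (\<lambda>h. h \<bullet> D\<psi> y)) (at y within UNIV)" for y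
          using D[of y] by (simp add: gderiv_def)
        show "onorm (\<lambda>h. h \<bullet> D\<psi> y) \<le> B" for y
        proof (rule onorm_le)
          fix v
          have "norm (v \<bullet> D\<psi> y) \<le> norm v * norm (D\<psi> y)" by (simp add: Cauchy_Schwarz_ineq2)
          also have "\<dots> \<le> norm v * B" by (intro mult_left_mono B) auto
          finally show "norm (v \<bullet> D\<psi> y) \<le> B * norm v" by (simp add: mult.commute)
        qed
      qed auto
      then have le: "norm (f n x) \<le> B * norm w"
        using h[of n] by (simp add: f_def divide_le_eq mult_ac)
      show "norm (f n x) \<le> indicator (cball 0 (R + norm w)) x *\<^sub>R (B * norm w)"
      proof (cases "x \<in> cball 0 (R + norm w)")
        case False
        have "norm x \<le> norm (x + h n *\<^sub>R w) + norm (h n *\<^sub>R w)"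
          using norm_triangle_ineq4[of "x + h n *\<^sub>R w" "h n *\<^sub>R w"] by simp
        moreover have "norm (h n *\<^sub>R w) \<le> norm w"
          using h[of n] by (simp add: mult_left_le_one_le)
        ultimately have "x + h n *\<^sub>R w \<notin> cball 0 R" "x \<notin> cball 0 R"
          using False norm_ge_zero[of w] by (auto simp del: norm_ge_zero)
        then have "x + h n *\<^sub>R w \<notin> K" "x \<notin> K" using R by blast+
        then show ?thesis using K(2) False by (simp add: f_def)
      qed (use le in simp)
    qed
  qed
  then show ?thesis
    by (simp add: f_zero LIMSEQ_const_iff)
qed

lemma integral_lebesgue_on_support:
  fixes F :: "'a::euclidean_space \<Rightarrow> real"
  assumes "F \<in> borel_measurable borel" "\<Omega> \<in> sets lebesgue" "\<And>x. x \<notin> \<Omega> \<Longrightarrow> F x = 0"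
  shows "(LINT x|lebesgue_on \<Omega>. F x) = (LINT x|lborel. F x)"
proof -
  have "(LINT x|lebesgue_on \<Omega>. F x) = (LINT x|lebesgue. indicator \<Omega> x *\<^sub>R F x)"
    using assms(2) by (intro integral_restrict_space) auto
  also have "\<dots> = (LINT x|lebesgue. F x)"
    using assms(3) by (intro Bochner_Integration.integral_cong) (auto simp: indicator_def)
  also have "\<dots> = (LINT x|lborel. F x)"
    using assms(1) by (intro integral_completion) simp
  finally show ?thesis .
qed

text \<open>For a test function \<open>\<phi>\<close>, the product \<open>u * \<phi>\<close> is
  continuously differentiable with compact support, so its derivative integrates to 0; the product
  rule is then the weak gradient identity.\<close>

lemma H1_smooth:
  fixes u :: "'a::euclidean_space \<Rightarrow> real"
  assumes \<Omega>: "\<Omega> \<in> lmeasurable" "bounded \<Omega>"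
    and D: "\<And>x. GDERIV u x :> Du x" and cont: "continuous_on UNIV Du"
  shows "H1 \<Omega> u Du"
proof -
  have u_cont: "continuous_on UNIV u" using D by (rule GDERIV_imp_continuous_on)
  have L2: "L2 \<Omega> u" "L2 \<Omega> Du"
    using \<Omega> cont u_cont by (auto intro: L2_continuous)
  show ?thesis
    unfolding H1_iff[OF \<Omega>(1)]
  proof (intro conjI allI impI L2)
    fix \<phi> D\<phi> w assume \<phi>: "test_function \<Omega> \<phi>" "\<forall>x. GDERIV \<phi> x :> D\<phi> x"
    have \<phi>L2: "L2 \<Omega> \<phi>" "L2 \<Omega> D\<phi>"
      using test_function_L2[OF \<Omega>(1) \<phi>(1)] \<phi>(2) by auto
    have \<phi>cont: "continuous_on UNIV \<phi>" "continuous_on UNIV D\<phi>"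
      using test_function_regular[OF \<phi>(1)] \<phi>(2) by auto
    obtain K where K: "compact K" "K \<subseteq> \<Omega>" "\<And>x. x \<notin> K \<Longrightarrow> \<phi> x = 0"
      using \<phi>(1) by (auto simp: test_function_def)
    have D0: "x \<notin> K \<Longrightarrow> D\<phi> x = 0" for x
      using GDERIV_zero_outside[of K \<phi> x "D\<phi> x"] K \<phi>(2) by blast
    let ?D = "\<lambda>x. u x *\<^sub>R D\<phi> x + \<phi> x *\<^sub>R Du x"
    have D_cont: "continuous_on UNIV ?D"
      using u_cont \<phi>cont cont by (intro continuous_intros)
    have "(LINT x|lborel. ?D x \<bullet> w) = 0"
    proof (rule integral_compact_support_derivative[of "\<lambda>x. u x * \<phi> x"])
      show "GDERIV (\<lambda>x. u x * \<phi> x) x :> ?D x" for x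
        using D \<phi>(2) by (intro GDERIV_mult) auto
    qed (use K D_cont in auto)
    moreover have "(LINT x|lebesgue_on \<Omega>. ?D x \<bullet> w) = (LINT x|lborel. ?D x \<bullet> w)"
    proof (rule integral_lebesgue_on_support)
      show "(\<lambda>x. ?D x \<bullet> w) \<in> borel_measurable borel"
        by (intro borel_measurable_continuous_onI continuous_on_inner[OF D_cont continuous_on_const])
      show "\<Omega> \<in> sets lebesgue" using \<Omega>(1) by (rule fmeasurableD)
      show "?D x \<bullet> w = 0" if "x \<notin> \<Omega>" for x
      proof -
        have "x \<notin> K" using that K(2) by blast
        then show ?thesis using K(3) D0 by simp
      qed
    qed
    moreover have "(LINT x|lebesgue_on \<Omega>. ?D x \<bullet> w) = ip \<Omega> u (\<lambda>x. D\<phi> x \<bullet> w) + ip \<Omega> (\<lambda>x. Du x \<bullet> w) \<phi>"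
    proof -
      have "integrable (lebesgue_on \<Omega>) (\<lambda>x. u x * (D\<phi> x \<bullet> w))" "integrable (lebesgue_on \<Omega>) (\<lambda>x. (Du x \<bullet> w) * \<phi> x)"
        using L2 \<phi>L2 by (intro L2_mult_integrable L2_inner_const; simp)+
      then show ?thesis
        unfolding ip_real by (simp add: inner_add_left mult.commute[of "Du _ \<bullet> w"])
    qed
    ultimately show "ip \<Omega> u (\<lambda>x. D\<phi> x \<bullet> w) = - ip \<Omega> (\<lambda>x. Du x \<bullet> w) \<phi>"
      by linarith
  qed
qed

section \<open>Fourier coefficients of weak derivatives\<close>

lemma H1_test:
  assumes "\<Omega> \<in> lmeasurable" "H1 \<Omega> u g" "test_function \<Omega> \<phi>" "\<And>x. GDERIV \<phi> x :> D\<phi> x"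
  shows "ip \<Omega> u (\<lambda>x. D\<phi> x \<bullet> w) = - ip \<Omega> (\<lambda>x. g x \<bullet> w) \<phi>"
  using assms(2-4) unfolding H1_iff[OF assms(1)] by blast

lemma flat_continuous: "continuous_on S (flat j)"
proof -
  have "isCont (flat j) y" for y using flat_DERIV by (rule DERIV_isCont)
  then show ?thesis by (simp add: continuous_at_imp_continuous_on)
qed

lemma cutoff_continuous: "continuous_on S (cutoff k)" "continuous_on S (cutoff' k)"
proof -
  show "continuous_on S (cutoff k)"
    using cutoff_DERIV by (meson DERIV_continuous_on has_field_derivative_at_within)
  have "continuous_on S (\<lambda>y. flat j (k * y - 1))" "continuous_on S (\<lambda>y. flat j (k * (1 - y) - 1))" for j
    by (rule continuous_on_compose2[OF flat_continuous[of UNIV j]]; auto intro!: continuous_intros)+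
  then show "continuous_on S (cutoff' k)"
    unfolding cutoff'_def[abs_def] by (intro continuous_intros)
qed

text \<open>Linear vanishing at both ends, with the constant \<open>C = real m * pi\<close> required
  by \<open>cutoff'_bound\<close>; the second bound comes from the first by reflection.\<close>

lemma abs_sin_pi_bounds:
  assumes "0 \<le> y" "y \<le> 1"
  shows "\<bar>sin (real m * pi * y)\<bar> \<le> real m * pi * y" "\<bar>sin (real m * pi * y)\<bar> \<le> real m * pi * (1 - y)"
proof -
  show "\<bar>sin (real m * pi * y)\<bar> \<le> real m * pi * y"
    using abs_sin_x_le_abs_x[of "real m * pi * y"] assms by simp
  have "sin (real m * pi * y) = sin (real m * pi - real m * pi * (1 - y))"
    by (simp add: algebra_simps)
  then have "\<bar>sin (real m * pi * y)\<bar> = \<bar>sin (real m * pi * (1 - y))\<bar>"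
    by (simp add: sin_diff abs_mult cos_npi)
  also have "\<dots> \<le> real m * pi * (1 - y)"
    using abs_sin_x_le_abs_x[of "real m * pi * (1 - y)"] assms by simp
  finally show "\<bar>sin (real m * pi * y)\<bar> \<le> real m * pi * (1 - y)" .
qed

context pgram
begin

lemma dual_basis_commuted: "a' \<bullet> a = 1" "b' \<bullet> a = 0" "a' \<bullet> b = 0" "b' \<bullet> b = 1"
  using dual_basis by (simp_all add: inner_commute)

lemma test_function_tensor:
  assumes k: "k > 0" and \<alpha>: "\<And>j. C_k j \<alpha>" and \<beta>: "\<And>j. C_k j \<beta>"
  shows "test_function P (\<lambda>x. (\<alpha> (s x) * cutoff k (s x)) * (\<beta> (t x) * cutoff k (t x)))"
  unfolding test_function_def
proof (intro conjI allI)
  show "C_k j (\<lambda>x. (\<alpha> (s x) * cutoff k (s x)) * (\<beta> (t x) * cutoff k (t x)))" for j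
    unfolding s_def t_def by (intro C_k_mult C_k_compose_inner \<alpha> \<beta> C_k_cutoff)
  let ?K = "{x. 1 / k \<le> s x \<and> s x \<le> 1 - 1 / k \<and> 1 / k \<le> t x \<and> t x \<le> 1 - 1 / k}"
  have "?K \<subseteq> P"
  proof
    fix x assume "x \<in> ?K"
    moreover have "0 < 1 / real k" using k by simp
    ultimately have "0 < s x \<and> s x < 1 \<and> 0 < t x \<and> t x < 1" by (simp, linarith)
    then show "x \<in> P" by (simp add: P_eq)
  qed
  moreover have "(\<alpha> (s x) * cutoff k (s x)) * (\<beta> (t x) * cutoff k (t x)) = 0" if "x \<notin> ?K" for x
    using that cutoff_eq_0[of "s x" k] cutoff_eq_0[of "t x" k] k by auto
  ultimately show "\<exists>K. compact K \<and> K \<subseteq> P \<and>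
      (\<forall>x. x \<notin> K \<longrightarrow> (\<alpha> (s x) * cutoff k (s x)) * (\<beta> (t x) * cutoff k (t x)) = 0)"
    by (intro exI[of _ ?K] conjI allI impI P_subset_compact)
qed

lemma GDERIV_tensor:
  assumes "(\<alpha> has_real_derivative \<alpha>') (at (s x))" "(\<beta> has_real_derivative \<beta>') (at (t x))"
  shows "GDERIV (\<lambda>x. \<alpha> (s x) * \<beta> (t x)) x :> \<alpha> (s x) *\<^sub>R (\<beta>' *\<^sub>R b') + \<beta> (t x) *\<^sub>R (\<alpha>' *\<^sub>R a')"
  using assms unfolding s_def t_def by (intro GDERIV_mult GDERIV_compose_inner)

text \<open>Since \<open>b' \<bullet> a = 0\<close>, pairing the gradient of the test function with
  \<open>a\<close> removes every derivative in \<open>t\<close>. The only derivative of a cutoff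
  left is the one in \<open>s\<close>, multiplied by the sine.\<close>

lemma ibp_cutoff:
  assumes H: "H1 P u g" and k: "k > 0"
  shows "ip P u (\<lambda>x. (real m * pi * cos (real m * pi * s x) * cutoff k (s x)
        + sin (real m * pi * s x) * cutoff' k (s x)) * (cos (real n * pi * t x) * cutoff k (t x)))
    = - ip P (\<lambda>x. g x \<bullet> a) (\<lambda>x. (sin (real m * pi * s x) * cutoff k (s x)) * (cos (real n * pi * t x) * cutoff k (t x)))"
proof -
  define \<alpha> where "\<alpha> y = sin (real m * pi * y)" for y
  define \<beta> where "\<beta> y = cos (real n * pi * y)" for y
  define \<alpha>' where "\<alpha>' y = real m * pi * cos (real m * pi * y) * cutoff k y + sin (real m * pi * y) * cutoff' k y" for y
  define \<beta>' where "\<beta>' y = - (real n * pi * sin (real n * pi * y)) * cutoff k y + cos (real n * pi * y) * cutoff' k y" for y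
  have \<alpha>: "C_k j \<alpha>" and \<beta>: "C_k j \<beta>" for j
    using C_k_trig[of j 1 "real m * pi" 0] C_k_trig[of j 0 "real n * pi" 1]
    by (simp_all add: \<alpha>_def[abs_def] \<beta>_def[abs_def])
  have d\<alpha>: "((\<lambda>y. \<alpha> y * cutoff k y) has_real_derivative \<alpha>' y) (at y)" for y
    unfolding \<alpha>_def \<alpha>'_def by (auto intro!: derivative_eq_intros cutoff_DERIV)
  have d\<beta>: "((\<lambda>y. \<beta> y * cutoff k y) has_real_derivative \<beta>' y) (at y)" for y
    unfolding \<beta>_def \<beta>'_def by (auto intro!: derivative_eq_intros cutoff_DERIV)
  let ?\<phi> = "\<lambda>x. (\<alpha> (s x) * cutoff k (s x)) * (\<beta> (t x) * cutoff k (t x))"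
  let ?D = "\<lambda>x. (\<alpha> (s x) * cutoff k (s x)) *\<^sub>R (\<beta>' (t x) *\<^sub>R b') + (\<beta> (t x) * cutoff k (t x)) *\<^sub>R (\<alpha>' (s x) *\<^sub>R a')"
  have "test_function P ?\<phi>" by (rule test_function_tensor[OF k \<alpha> \<beta>])
  then have "ip P u (\<lambda>x. ?D x \<bullet> a) = - ip P (\<lambda>x. g x \<bullet> a) ?\<phi>"
    by (rule H1_test[OF P_lmeasurable H]) (rule GDERIV_tensor[OF d\<alpha> d\<beta>])
  moreover have "?D x \<bullet> a = \<alpha>' (s x) * (\<beta> (t x) * cutoff k (t x))" for x
    by (simp add: inner_add_left dual_basis_commuted)
  ultimately show ?thesis
    by (simp add: \<alpha>_def \<beta>_def \<alpha>'_def)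
qed

text \<open>The cutoffs are removed by dominated convergence on both sides of
  \<open>ibp_cutoff\<close>; no boundary term survives because sine times \<open>cutoff'\<close> is
  bounded and tends to 0.\<close>

lemma ibp_sin_cos_a:
  assumes H: "H1 P u g"
  shows "ip P (\<lambda>x. g x \<bullet> a) (e_sc i) = - (real (fst i) * pi) * ip P u (e_cc i)"
proof -
  obtain m n where i: "i = (m, n)" by (metis surj_pair)
  let ?f = "\<lambda>y. real m * pi * cos (real m * pi * y)" and ?F = "\<lambda>y. sin (real m * pi * y)"
    and ?h = "\<lambda>y. cos (real n * pi * y)"
  have L2: "L2 P u" "L2 P (\<lambda>x. g x \<bullet> a)"
    using H by (auto simp: H1_def intro: L2_inner_const)
  then have int: "integrable (lebesgue_on P) u" "integrable (lebesgue_on P) (\<lambda>x. g x \<bullet> a)"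
    by (auto intro: L2_integrable[OF P_lmeasurable])
  have um: "u \<in> borel_measurable (lebesgue_on P)" "(\<lambda>x. g x \<bullet> a) \<in> borel_measurable (lebesgue_on P)"
    using int by auto
  have meas: "F \<in> borel_measurable (lebesgue_on P)" if "continuous_on UNIV F" for F :: "real^2 \<Rightarrow> real"
    using that by (rule borel_measurable_lebesgue_on_continuous)
  have cont: "continuous_on UNIV (\<lambda>x. cutoff k (s x))" "continuous_on UNIV (\<lambda>x. cutoff k (t x))"
    "continuous_on UNIV (\<lambda>x. cutoff' k (s x))" for k
    by (rule continuous_on_compose2[OF cutoff_continuous(1)[of UNIV]] continuous_on_compose2[OF cutoff_continuous(2)[of UNIV]];
      use s_t_continuous in simp)+
  \<comment> \<open>The shift to \<open>Suc k\<close> keeps the cutoff index positive, as compact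
    support inside \<open>P\<close> requires.\<close>
  have tends1: "(\<lambda>k. ip P u (\<lambda>x. (?f (s x) * cutoff (Suc k) (s x)
        + ?F (s x) * cutoff' (Suc k) (s x)) * (?h (t x) * cutoff (Suc k) (t x))))
     \<longlonglongrightarrow> ip P u (\<lambda>x. ?f (s x) * ?h (t x))"
    unfolding ip_real
  proof (rule integral_dominated_convergence)
    show "(\<lambda>x. u x * (?f (s x) * ?h (t x))) \<in> borel_measurable (lebesgue_on P)"
      by (rule borel_measurable_times) (rule um, intro meas continuous_intros s_t_continuous)
    show "(\<lambda>x. u x * ((?f (s x) * cutoff (Suc k) (s x)
        + ?F (s x) * cutoff' (Suc k) (s x)) * (?h (t x) * cutoff (Suc k) (t x)))) \<in> borel_measurable (lebesgue_on P)" for k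
      by (rule borel_measurable_times) (rule um, intro meas continuous_intros s_t_continuous cont)
    \<comment> \<open>The factor 5 is 1 for the cosine term plus 4 from
      \<open>cutoff'_bound\<close>.\<close>
    show "integrable (lebesgue_on P) (\<lambda>x. 5 * (real m * pi) * \<bar>u x\<bar>)"
      using int by simp
    show "AE x in lebesgue_on P. (\<lambda>k. u x * ((?f (s x) * cutoff (Suc k) (s x)
        + ?F (s x) * cutoff' (Suc k) (s x)) * (?h (t x) * cutoff (Suc k) (t x))))
        \<longlonglongrightarrow> u x * (?f (s x) * ?h (t x))"
    proof (rule AE_I2)
      fix x assume "x \<in> space (lebesgue_on P)"
      then have x: "0 < s x" "s x < 1" "0 < t x" "t x < 1" by (auto simp: P_eq)
      have "(\<lambda>k. ?F (s x) * cutoff' k (s x)) \<longlonglongrightarrow> 0"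
        using x abs_sin_pi_bounds[of "s x" m] by (intro cutoff'_tendsto) auto
      with x have "(\<lambda>k. u x * ((?f (s x) * cutoff k (s x)
        + ?F (s x) * cutoff' k (s x)) * (?h (t x) * cutoff k (t x))))
        \<longlonglongrightarrow> u x * ((?f (s x) * 1 + 0) * (?h (t x) * 1))"
        by (intro tendsto_intros cutoff_tendsto)
      from LIMSEQ_Suc[OF this] show "(\<lambda>k. u x * ((?f (s x) * cutoff (Suc k) (s x)
        + ?F (s x) * cutoff' (Suc k) (s x)) * (?h (t x) * cutoff (Suc k) (t x))))
        \<longlonglongrightarrow> u x * (?f (s x) * ?h (t x))" by simp
    qed
    show "AE x in lebesgue_on P. norm (u x * ((?f (s x) * cutoff (Suc k) (s x)
        + ?F (s x) * cutoff' (Suc k) (s x)) * (?h (t x) * cutoff (Suc k) (t x)))) \<le> 5 * (real m * pi) * \<bar>u x\<bar>" for k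
    proof (rule AE_I2)
      fix x assume "x \<in> space (lebesgue_on P)"
      then have x: "0 < s x" "s x < 1" "0 < t x" "t x < 1" by (auto simp: P_eq)
      have 1: "\<bar>?F (s x) * cutoff' (Suc k) (s x)\<bar> \<le> 4 * (real m * pi)"
        using x abs_sin_pi_bounds[of "s x" m] by (intro cutoff'_bound(2)) auto
      have 2: "\<bar>?f (s x) * cutoff (Suc k) (s x)\<bar> \<le> (real m * pi * 1) * 1"
        unfolding abs_mult using cutoff_bounds[of "Suc k" "s x"]
        by (intro mult_mono) auto
      have 3: "\<bar>?h (t x) * cutoff (Suc k) (t x)\<bar> \<le> 1 * 1"
        unfolding abs_mult using cutoff_bounds[of "Suc k" "t x"]
        by (intro mult_mono) auto
      have "\<bar>?f (s x) * cutoff (Suc k) (s x) + ?F (s x) * cutoff' (Suc k) (s x)\<bar>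
          * \<bar>?h (t x) * cutoff (Suc k) (t x)\<bar> \<le> (5 * (real m * pi)) * 1"
        by (rule mult_mono) (use 1 2 3 in \<open>auto intro: order_trans[OF abs_triangle_ineq]\<close>)
      then have "\<bar>u x\<bar> * (\<bar>?f (s x) * cutoff (Suc k) (s x) + ?F (s x) * cutoff' (Suc k) (s x)\<bar>
          * \<bar>?h (t x) * cutoff (Suc k) (t x)\<bar>) \<le> \<bar>u x\<bar> * ((5 * (real m * pi)) * 1)"
        by (rule mult_left_mono) simp
      then show "norm (u x * ((?f (s x) * cutoff (Suc k) (s x)
        + ?F (s x) * cutoff' (Suc k) (s x)) * (?h (t x) * cutoff (Suc k) (t x)))) \<le> 5 * (real m * pi) * \<bar>u x\<bar>"
        by (simp only: real_norm_def abs_mult mult_1_right) (simp only: mult.commute[of "\<bar>u x\<bar>"])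
    qed
  qed
  have tends2: "(\<lambda>k. ip P (\<lambda>x. g x \<bullet> a) (\<lambda>x. (?F (s x) * cutoff (Suc k) (s x)) * (?h (t x) * cutoff (Suc k) (t x))))
     \<longlonglongrightarrow> ip P (\<lambda>x. g x \<bullet> a) (\<lambda>x. ?F (s x) * ?h (t x))"
    unfolding ip_real
  proof (rule integral_dominated_convergence)
    show "(\<lambda>x. (g x \<bullet> a) * (?F (s x) * ?h (t x))) \<in> borel_measurable (lebesgue_on P)"
      by (rule borel_measurable_times) (rule um, intro meas continuous_intros s_t_continuous)
    show "(\<lambda>x. (g x \<bullet> a) * ((?F (s x) * cutoff (Suc k) (s x)) * (?h (t x) * cutoff (Suc k) (t x)))) \<in> borel_measurable (lebesgue_on P)" for k
      by (rule borel_measurable_times) (rule um, intro meas continuous_intros s_t_continuous cont)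
    show "integrable (lebesgue_on P) (\<lambda>x. \<bar>g x \<bullet> a\<bar>)"
      using int by simp
    show "AE x in lebesgue_on P. (\<lambda>k. (g x \<bullet> a) * ((?F (s x) * cutoff (Suc k) (s x)) * (?h (t x) * cutoff (Suc k) (t x))))
        \<longlonglongrightarrow> (g x \<bullet> a) * (?F (s x) * ?h (t x))"
    proof (rule AE_I2)
      fix x assume "x \<in> space (lebesgue_on P)"
      then have x: "0 < s x" "s x < 1" "0 < t x" "t x < 1" by (auto simp: P_eq)
      then have "(\<lambda>k. (g x \<bullet> a) * ((?F (s x) * cutoff k (s x)) * (?h (t x) * cutoff k (t x))))
        \<longlonglongrightarrow> (g x \<bullet> a) * ((?F (s x) * 1) * (?h (t x) * 1))"
        by (intro tendsto_intros cutoff_tendsto)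
      from LIMSEQ_Suc[OF this] show "(\<lambda>k. (g x \<bullet> a) * ((?F (s x) * cutoff (Suc k) (s x)) * (?h (t x) * cutoff (Suc k) (t x))))
        \<longlonglongrightarrow> (g x \<bullet> a) * (?F (s x) * ?h (t x))" by simp
    qed
    show "AE x in lebesgue_on P. norm ((g x \<bullet> a) * ((?F (s x) * cutoff (Suc k) (s x)) * (?h (t x) * cutoff (Suc k) (t x)))) \<le> \<bar>g x \<bullet> a\<bar>" for k
    proof (rule AE_I2)
      fix x
      have "\<bar>?F (s x)\<bar> * \<bar>cutoff (Suc k) (s x)\<bar> \<le> 1" "\<bar>?h (t x)\<bar> * \<bar>cutoff (Suc k) (t x)\<bar> \<le> 1"
        using cutoff_bounds[of "Suc k"] by (intro mult_le_one; simp)+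
      from mult_le_one[OF this(1) _ this(2)]
      have "(\<bar>?F (s x)\<bar> * \<bar>cutoff (Suc k) (s x)\<bar>) * (\<bar>?h (t x)\<bar> * \<bar>cutoff (Suc k) (t x)\<bar>) \<le> 1"
        by simp
      from mult_left_mono[OF this abs_ge_zero[of "g x \<bullet> a"]]
      show "norm ((g x \<bullet> a) * ((?F (s x) * cutoff (Suc k) (s x)) * (?h (t x) * cutoff (Suc k) (t x)))) \<le> \<bar>g x \<bullet> a\<bar>"
        by (simp only: real_norm_def abs_mult mult_1_right)
    qed
  qed
  have "ip P u (\<lambda>x. ?f (s x) * ?h (t x)) = - ip P (\<lambda>x. g x \<bullet> a) (\<lambda>x. ?F (s x) * ?h (t x))"
  proof (rule LIMSEQ_unique[OF tends1])
    show "(\<lambda>k. ip P u (\<lambda>x. (?f (s x) * cutoff (Suc k) (s x)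
        + ?F (s x) * cutoff' (Suc k) (s x)) * (?h (t x) * cutoff (Suc k) (t x))))
     \<longlonglongrightarrow> - ip P (\<lambda>x. g x \<bullet> a) (\<lambda>x. ?F (s x) * ?h (t x))"
      unfolding ibp_cutoff[OF H zero_less_Suc] by (rule tendsto_minus[OF tends2])
  qed
  moreover have "(\<lambda>x. ?f (s x) * ?h (t x)) = (\<lambda>x. (real m * pi) * e_cc i x)"
    "(\<lambda>x. ?F (s x) * ?h (t x)) = e_sc i"
    by (auto simp: e_cc_def e_sc_def i fun_eq_iff)
  ultimately show ?thesis
    by (simp add: ip_cmult_right i)
qed

lemma swapped: "pgram b a"
  using noncollinear by unfold_locales (simp add: insert_commute)

text \<open>Exchanging the sides gives the same set, swaps \<open>s\<close> with \<open>t\<close>,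
  and carries \<open>e_sc\<close> at the swapped index to \<open>e_cs\<close>; the previous identity
  then applies verbatim.\<close>

lemma ibp_sin_cos_b:
  assumes H: "H1 P u g"
  shows "ip P (\<lambda>x. g x \<bullet> b) (e_cs i) = - (real (snd i) * pi) * ip P u (e_cc i)"
proof -
  interpret sw: pgram p b a by (rule swapped)
  have P: "sw.P = P"
  proof -
    have "p + c *\<^sub>R b + d *\<^sub>R a = p + d *\<^sub>R a + c *\<^sub>R b" for c d by simp
    then show ?thesis unfolding parallelogram_def by (metis (no_types, opaque_lifting))
  qed
  have D: "sw.D = D" by (simp add: sw.D_def D_def inner_commute mult.commute)
  have ab: "sw.a' = b'" "sw.b' = a'"
    by (simp_all add: sw.a'_def sw.b'_def a'_def b'_def D inner_commute[of b a])
  have st: "sw.s = t" "sw.t = s"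
    by (auto simp: sw.s_def sw.t_def s_def t_def ab)
  have e: "sw.e_sc (prod.swap i) = e_cs i" "sw.e_cc (prod.swap i) = e_cc i"
    by (auto simp: sw.e_sc_def e_cs_def sw.e_cc_def e_cc_def st fun_eq_iff)
  show ?thesis
    using sw.ibp_sin_cos_a[of u g "prod.swap i"] H by (simp add: P e)
qed

lemma H1_gap:
  assumes "H1 P u g" and "finite K" "\<And>i. i \<notin> K \<Longrightarrow> R \<le> (real (fst i))\<^sup>2 + (real (snd i))\<^sup>2" "0 < R"
  shows "ip P u u \<le> (\<Sum>i\<in>K. energy u i)
    + (ip P (\<lambda>x. g x \<bullet> a) (\<lambda>x. g x \<bullet> a) + ip P (\<lambda>x. g x \<bullet> b) (\<lambda>x. g x \<bullet> b)) / (pi\<^sup>2 * R)"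
  using assms by (intro spectral_gap ibp_sin_cos_a ibp_sin_cos_b) (auto simp: H1_def intro!: L2_inner_const)

end

section \<open>Minimizing the Rayleigh quotient\<close>

text \<open>Bolzano-Weierstrass iterated over \<open>K\<close>. It is applied to the finitely many
  low Fourier coefficients of a minimizing sequence.\<close>

lemma finite_family_convergent_subsequence:
  fixes X :: "'i \<Rightarrow> nat \<Rightarrow> real"
  assumes "finite K" "\<And>i. i \<in> K \<Longrightarrow> bounded (range (X i))"
  shows "\<exists>r l. strict_mono r \<and> (\<forall>i\<in>K. (\<lambda>k. X i (r k)) \<longlonglongrightarrow> l i)"
  using assms
proof (induction K rule: finite_induct)
  case empty
  show ?case by (rule exI[of _ "\<lambda>k. k"]) (auto simp: strict_mono_def)
next
  case (insert i K)
  then obtain r l where r: "strict_mono r" "\<forall>i\<in>K. (\<lambda>k. X i (r k)) \<longlonglongrightarrow> l i" by auto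
  have "bounded (range (\<lambda>k. X i (r k)))"
    by (rule bounded_subset[OF insert.prems[of i]]) auto
  then obtain m r' where r': "strict_mono r'" "((\<lambda>k. X i (r k)) \<circ> r') \<longlonglongrightarrow> m"
    using bounded_imp_convergent_subsequence by blast
  show ?case
  proof (intro exI conjI ballI)
    show "strict_mono (r \<circ> r')" using r(1) r'(1) by (rule strict_mono_o)
    fix j assume "j \<in> insert i K"
    then show "(\<lambda>k. X j ((r \<circ> r') k)) \<longlonglongrightarrow> (l(i := m)) j"
      using r'(2) LIMSEQ_subseq_LIMSEQ[OF r(2)[rule_format, of j] r'(1)] insert.hyps
      by (cases "j = i") (auto simp: o_def)
  qed
qed

lemma ip_sq_tendsto:
  assumes "\<And>k. L2 \<Omega> (u k)" "L2 \<Omega> v"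
    and lim: "(\<lambda>k. ip \<Omega> (\<lambda>x. u k x - v x) (\<lambda>x. u k x - v x)) \<longlonglongrightarrow> 0"
  shows "(\<lambda>k. ip \<Omega> (u k) (u k)) \<longlonglongrightarrow> ip \<Omega> v v"
proof -
  have "(\<lambda>k. ip \<Omega> (\<lambda>x. u k x - v x) (\<lambda>x. u k x - v x) + 2 * ip \<Omega> (u k) v - ip \<Omega> v v)
      \<longlonglongrightarrow> 0 + 2 * ip \<Omega> v v - ip \<Omega> v v"
    by (intro tendsto_intros lim ip_tendsto_left assms)
  then show ?thesis using assms by (simp add: ip_sq_diff)
qed

text \<open>Completeness in the form in which the minimizer estimates arrive, with a bound that
  splits into a null sequence in each index.\<close>

lemma L2_complete_ip:
  fixes u :: "nat \<Rightarrow> 'a::euclidean_space \<Rightarrow> 'b::euclidean_space"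
  assumes \<Omega>: "\<Omega> \<in> lmeasurable" and u: "\<And>k. L2 \<Omega> (u k)"
    and B: "\<And>m n. ip \<Omega> (\<lambda>x. u m x - u n x) (\<lambda>x. u m x - u n x) \<le> B m + B n" "B \<longlonglongrightarrow> 0"
  obtains v where "L2 \<Omega> v" "(\<lambda>n. ip \<Omega> (\<lambda>x. u n x - v x) (\<lambda>x. u n x - v x)) \<longlonglongrightarrow> 0"
proof -
  have "\<exists>N. \<forall>m\<ge>N. \<forall>n\<ge>N. (LINT x|lebesgue_on \<Omega>. (norm (u m x - u n x))\<^sup>2) < e" if "e > 0" for e
  proof -
    have "\<forall>\<^sub>F n in sequentially. B n < e / 2"
      using B(2) that by (intro order_tendstoD) auto
    then obtain N where N: "\<And>n. n \<ge> N \<Longrightarrow> B n < e / 2"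
      by (auto simp: eventually_sequentially)
    have "ip \<Omega> (\<lambda>x. u m x - u n x) (\<lambda>x. u m x - u n x) < e" if "m \<ge> N" "n \<ge> N" for m n
      using B(1)[of m n] N[OF that(1)] N[OF that(2)] by linarith
    then show ?thesis by (auto simp: ip_norm)
  qed
  from L2_complete[OF \<Omega> u this] obtain v where
    "L2 \<Omega> v" "(\<lambda>n. LINT x|lebesgue_on \<Omega>. (norm (u n x - v x))\<^sup>2) \<longlonglongrightarrow> 0" by blast
  then show ?thesis using that by (simp add: ip_norm)
qed

lemma ip_zero_imp_AE:
  fixes u :: "'a::euclidean_space \<Rightarrow> real"
  assumes "L2 \<Omega> u" "ip \<Omega> u u = 0"
  shows "AE x in lebesgue_on \<Omega>. u x = 0"
  using assms integral_nonneg_eq_0_iff_AE[of "lebesgue_on \<Omega>" "\<lambda>x. u x * u x"] L2_mult_integrable[of \<Omega> u u]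
  by (simp add: ip_real)

text \<open>The first variation principle: at a small \<open>r\<close> of sign opposite to
  \<open>d\<close> the linear term would dominate.\<close>

lemma quadratic_nonneg_imp_linear_zero:
  fixes c d :: real
  assumes "\<And>r. 0 \<le> 2 * r * d + r\<^sup>2 * c"
  shows "d = 0"
proof (rule ccontr)
  assume "d \<noteq> 0"
  have c: "0 \<le> c" using assms[of 1] assms[of "-1"] by simp
  \<comment> \<open>Dividing by \<open>c + 1\<close> instead of \<open>c\<close> also covers
    \<open>c = 0\<close>.\<close>
  define r where "r = - d / (c + 1)"
  have d: "d = - (r * (c + 1))" using c by (simp add: r_def)
  have "2 * r * (- (r * (c + 1))) + r\<^sup>2 * c = - (r\<^sup>2 * (c + 2))"
    by (simp add: power2_eq_square algebra_simps)
  then have "2 * r * d + r\<^sup>2 * c = - (r\<^sup>2 * (c + 2))"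
    by (simp only: d[symmetric])
  moreover have "0 < r\<^sup>2 * (c + 2)" using c \<open>d \<noteq> 0\<close> by (simp add: r_def)
  ultimately show False using assms[of r] by linarith
qed

context pgram
begin

lemma L2_const: "L2 P (\<lambda>x. c)"
  by (intro L2_continuous_P continuous_on_const)

lemma ip_one_one: "ip P (\<lambda>x. 1 :: real) (\<lambda>x. 1) = measure lebesgue P"
  using ip_e_cc[of "(0, 0)" "(0, 0)"] by (simp add: e_cc_def[abs_def] e_norm_def)

lemma H1_const: "H1 P (\<lambda>x. c) (\<lambda>x. 0)"
  by (rule H1_smooth[OF P_lmeasurable bounded_P]) (auto intro: GDERIV_const)

lemma H1_separable:
  assumes "\<And>y. (f has_real_derivative f' y) (at y)" "\<And>y. (h has_real_derivative h' y) (at y)"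
    and "continuous_on UNIV f'" "continuous_on UNIV h'"
  shows "H1 P (\<lambda>x. f (s x) + h (t x)) (\<lambda>x. f' (s x) *\<^sub>R a' + h' (t x) *\<^sub>R b')"
proof (rule H1_smooth[OF P_lmeasurable bounded_P])
  show "GDERIV (\<lambda>x. f (s x) + h (t x)) x :> f' (s x) *\<^sub>R a' + h' (t x) *\<^sub>R b'" for x
    unfolding s_def t_def by (intro GDERIV_add GDERIV_compose_inner assms)
  have "continuous_on UNIV (\<lambda>x. f' (s x))" "continuous_on UNIV (\<lambda>x. h' (t x))"
    by (rule continuous_on_compose2[OF assms(3)] continuous_on_compose2[OF assms(4)]; use s_t_continuous in simp)+
  then show "continuous_on UNIV (\<lambda>x. f' (s x) *\<^sub>R a' + h' (t x) *\<^sub>R b')"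
    by (intro continuous_intros)
qed

text \<open>Crude constant by which the energies along \<open>a\<close> and \<open>b\<close> are
  dominated by the full Dirichlet energy. It suffices for compactness and positivity; for the sharp
  bound on a square it would lose a factor 2, so \<open>lam_square_ge\<close> avoids it.\<close>

definition slen :: real where "slen = (norm a)\<^sup>2 + (norm b)\<^sup>2"

lemma slen_pos: "0 < slen"
  using a_b_nonzero by (simp add: slen_def add_pos_pos)

lemma ip_directional_le:
  assumes "L2 P g"
  shows "ip P (\<lambda>x. g x \<bullet> w) (\<lambda>x. g x \<bullet> w) \<le> (norm w)\<^sup>2 * ip P g g"
proof -
  have "ip P (\<lambda>x. g x \<bullet> w) (\<lambda>x. g x \<bullet> w) \<le> (LINT x|lebesgue_on P. (norm w)\<^sup>2 * (g x \<bullet> g x))"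
    unfolding ip_real
  proof (rule integral_mono)
    show "integrable (lebesgue_on P) (\<lambda>x. g x \<bullet> w * (g x \<bullet> w))"
      by (intro L2_mult_integrable L2_inner_const assms)
    show "integrable (lebesgue_on P) (\<lambda>x. (norm w)\<^sup>2 * (g x \<bullet> g x))"
      using L2_inner_integrable[OF assms assms] by simp
    show "g x \<bullet> w * (g x \<bullet> w) \<le> (norm w)\<^sup>2 * (g x \<bullet> g x)" for x
      using Cauchy_Schwarz_ineq[of "g x" w]
      by (simp only: power2_norm_eq_inner power2_eq_square[symmetric] mult.commute)
  qed
  then show ?thesis by (simp add: ip_def)
qed

lemma H1_gap_norm:
  assumes "H1 P u g" and "finite K" "\<And>i. i \<notin> K \<Longrightarrow> R \<le> (real (fst i))\<^sup>2 + (real (snd i))\<^sup>2" "0 < R"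
  shows "ip P u u \<le> (\<Sum>i\<in>K. energy u i) + slen / (pi\<^sup>2 * R) * ip P g g"
proof -
  have g: "L2 P g" using assms(1) by (simp add: H1_def)
  have "ip P (\<lambda>x. g x \<bullet> a) (\<lambda>x. g x \<bullet> a) + ip P (\<lambda>x. g x \<bullet> b) (\<lambda>x. g x \<bullet> b) \<le> slen * ip P g g"
    using ip_directional_le[OF g, of a] ip_directional_le[OF g, of b] by (simp add: slen_def algebra_simps)
  then have "(ip P (\<lambda>x. g x \<bullet> a) (\<lambda>x. g x \<bullet> a) + ip P (\<lambda>x. g x \<bullet> b) (\<lambda>x. g x \<bullet> b)) / (pi\<^sup>2 * R)
      \<le> slen * ip P g g / (pi\<^sup>2 * R)"
    using \<open>0 < R\<close> by (intro divide_right_mono) auto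
  with H1_gap[OF assms] show ?thesis by simp
qed

lemma energy_zero_mean: "ip P u (\<lambda>x. 1) = 0 \<Longrightarrow> energy u (0, 0) = 0"
  by (simp add: energy_def e_cc_def[abs_def])

lemma outside_zero_mode: "i \<notin> {(0, 0)} \<Longrightarrow> 1 \<le> (real (fst i))\<^sup>2 + (real (snd i))\<^sup>2"
  by (cases i; cases "fst i"; cases "snd i") (auto simp: power2_eq_square algebra_simps)

text \<open>The gap estimate with the zero mode as the only exception: mean zero makes its energy
  vanish, and all other modes have squared frequency at least 1.\<close>

lemma poincare:
  assumes "H1 P u g" "ip P u (\<lambda>x. 1) = 0"
  shows "ip P u u \<le> slen / pi\<^sup>2 * ip P g g"
  using H1_gap_norm[of u g "{(0, 0)}" 1, OF assms(1) _ outside_zero_mode] energy_zero_mean[OF assms(2)]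
  by simp

definition admissible :: "(real^2 \<Rightarrow> real) \<Rightarrow> (real^2 \<Rightarrow> real^2) \<Rightarrow> bool" where
  "admissible u g \<longleftrightarrow> H1 P u g \<and> ip P u (\<lambda>x. 1) = 0"

definition lam :: real where
  "lam = Inf {ip P g g |u g. admissible u g \<and> ip P u u = 1}"

lemma admissible_add: "admissible u g \<Longrightarrow> admissible v h \<Longrightarrow> admissible (\<lambda>x. u x + v x) (\<lambda>x. g x + h x)"
  unfolding admissible_def
proof (elim conjE, intro conjI)
  assume H: "H1 P u g" "H1 P v h" and mean: "ip P u (\<lambda>x. 1) = 0" "ip P v (\<lambda>x. 1) = 0"
  show "H1 P (\<lambda>x. u x + v x) (\<lambda>x. g x + h x)" by (rule H1_add[OF P_lmeasurable H])
  show "ip P (\<lambda>x. u x + v x) (\<lambda>x. 1) = 0"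
    using H mean by (simp add: ip_add_left L2_const H1_def)
qed

lemma admissible_cmult: "admissible u g \<Longrightarrow> admissible (\<lambda>x. c * u x) (\<lambda>x. c *\<^sub>R g x)"
  by (auto simp: admissible_def H1_cmult[OF P_lmeasurable] ip_cmult_left)

lemma admissible_diff: "admissible u g \<Longrightarrow> admissible v h \<Longrightarrow> admissible (\<lambda>x. u x - v x) (\<lambda>x. g x - h x)"
  using admissible_add[OF _ admissible_cmult, of u g v h "-1"] by simp

lemma admissible_L2: "admissible u g \<Longrightarrow> L2 P u" "admissible u g \<Longrightarrow> L2 P g"
  by (auto simp: admissible_def H1_def)

lemma lam_le:
  assumes "admissible u g"
  shows "lam * ip P u u \<le> ip P g g"
proof (cases "ip P u u = 0")
  case True
  then show ?thesis by (simp add: ip_nonneg)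
next
  case False
  then have pos: "0 < ip P u u" using ip_nonneg[of P u] by linarith
  define c where "c = 1 / sqrt (ip P u u)"
  have c: "c * (c * r) = r / ip P u u" for r
    using pos by (simp add: c_def)
  have "lam \<le> ip P (\<lambda>x. c *\<^sub>R g x) (\<lambda>x. c *\<^sub>R g x)"
    unfolding lam_def
  proof (rule cInf_lower)
    show "bdd_below {ip P g g |u g. admissible u g \<and> ip P u u = 1}"
      by (intro bdd_belowI[of _ 0]) (auto simp: ip_nonneg)
    have "ip P (\<lambda>x. c * u x) (\<lambda>x. c * u x) = 1"
      using pos by (simp add: ip_cmult_left ip_cmult_right c)
    then show "ip P (\<lambda>x. c *\<^sub>R g x) (\<lambda>x. c *\<^sub>R g x) \<in> {ip P g g |u g. admissible u g \<and> ip P u u = 1}"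
      using admissible_cmult[OF assms, of c] by blast
  qed
  then have "lam \<le> ip P g g / ip P u u"
    by (simp add: ip_scaleR_left ip_scaleR_right c)
  then show ?thesis using pos by (simp add: pos_le_divide_eq)
qed

text \<open>Ensures that the infimum defining \<open>lam\<close> runs over a nonempty set. The
  witness is the normalized mode (1, 0), whose mean vanishes by orthogonality to the constant
  mode.\<close>

lemma admissible_normalized_ex: "\<exists>u g. admissible u g \<and> ip P u u = 1"
proof -
  have "H1 P (\<lambda>x. cos (pi * s x) + 0) (\<lambda>x. (- sin (pi * s x) * pi) *\<^sub>R a' + 0 *\<^sub>R b')"
    by (rule H1_separable[where h = "\<lambda>_. 0" and h' = "\<lambda>_. 0"])
      (auto intro!: derivative_eq_intros continuous_intros)
  moreover have e: "e_cc (1, 0) = (\<lambda>x. cos (pi * s x) + 0)" "e_cc (0, 0) = (\<lambda>x. 1)"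
    by (auto simp: e_cc_def fun_eq_iff)
  ultimately obtain g where "admissible (e_cc (1, 0)) g"
    using ip_e_cc[of "(1, 0)" "(0, 0)"] by (auto simp: admissible_def)
  from admissible_cmult[OF this, of "1 / sqrt (e_norm (1, 0))"]
  have "admissible (\<lambda>x. 1 / sqrt (e_norm (1, 0)) * e_cc (1, 0) x)
     (\<lambda>x. (1 / sqrt (e_norm (1, 0))) *\<^sub>R g x)" .
  moreover have "ip P (\<lambda>x. 1 / sqrt (e_norm (1, 0)) * e_cc (1, 0) x) (\<lambda>x. 1 / sqrt (e_norm (1, 0)) * e_cc (1, 0) x) = 1"
    using e_norm_pos[of "(1, 0)"] unfolding ip_cmult_left ip_cmult_right by (simp add: ip_e_cc)
  ultimately show ?thesis by blast
qed

lemma minimizing_sequence_ex: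
  "\<exists>u g. \<forall>k::nat. admissible (u k) (g k) \<and> ip P (u k) (u k) = 1 \<and> ip P (g k) (g k) < lam + 1 / real (Suc k)"
proof -
  have "\<exists>u g. admissible u g \<and> ip P u u = 1 \<and> ip P g g < lam + 1 / real (Suc k)" for k :: nat
  proof -
    let ?A = "{ip P g g |u g. admissible u g \<and> ip P u u = 1}"
    have "?A \<noteq> {}" using admissible_normalized_ex by blast
    moreover have "Inf ?A < lam + 1 / real (Suc k)" by (simp add: lam_def[symmetric])
    ultimately obtain y where "y \<in> ?A" "y < lam + 1 / real (Suc k)"
      using cInf_lessD[of ?A] by blast
    then show ?thesis by blast
  qed
  then have "\<exists>v. admissible (fst v) (snd v) \<and> ip P (fst v) (fst v) = 1
      \<and> ip P (snd v) (snd v) < lam + 1 / real (Suc k)" for k :: nat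
    by (metis fst_conv snd_conv)
  then obtain v where "\<And>k :: nat. admissible (fst (v k)) (snd (v k)) \<and> ip P (fst (v k)) (fst (v k)) = 1
      \<and> ip P (snd (v k)) (snd (v k)) < lam + 1 / real (Suc k)"
    by metis
  then show ?thesis
    by (intro exI[of _ "\<lambda>k. fst (v k)"] exI[of _ "\<lambda>k. snd (v k)"]) blast
qed

lemma lam_nonneg: "0 \<le> lam"
  unfolding lam_def using admissible_normalized_ex
  by (intro cInf_greatest) (auto simp: ip_nonneg)

text \<open>The nonnegative quadratic form \<open>\<parallel>g\<parallel>\<^sup>2 - lam \<parallel>u\<parallel>\<^sup>2\<close> tends to 0 along a minimizing sequence, hence
  by the parallelogram law on its differences. As all but finitely many modes are dominated by
  \<open>\<parallel>g\<parallel>\<^sup>2 / (2 lam)\<close>, convergence of the remaining modes makes the sequence Cauchy in \<open>H\<^sup>1\<close>.\<close>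

lemma minimizer_ex: "\<exists>u g. admissible u g \<and> ip P u u = 1 \<and> ip P g g = lam"
proof -
  obtain u0 g0 where ug0: "\<And>k::nat. admissible (u0 k) (g0 k)" "\<And>k. ip P (u0 k) (u0 k) = 1"
    "\<And>k. ip P (g0 k) (g0 k) < lam + 1 / real (Suc k)"
    using minimizing_sequence_ex by blast
  \<comment> \<open>\<open>R\<close> is so large that \<open>lam\<close> times the gap constant is
    at most 1/2, which allows half of the gradient term to be absorbed in
    \<open>gw_le\<close>.\<close>
  define R where "R = 2 * lam * slen / pi\<^sup>2 + 1"
  have R: "0 < R" "lam * (slen / (pi\<^sup>2 * R)) \<le> 1 / 2"
  proof -
    show "0 < R" using lam_nonneg slen_pos by (simp add: R_def add_nonneg_pos)
    moreover have "2 * lam * slen / pi\<^sup>2 \<le> R" by (simp add: R_def)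
    ultimately show "lam * (slen / (pi\<^sup>2 * R)) \<le> 1 / 2"
      by (simp add: field_simps)
  qed
  define K where "K = {i :: nat \<times> nat. (real (fst i))\<^sup>2 + (real (snd i))\<^sup>2 < R}"
  have "K \<subseteq> {..nat \<lceil>R\<rceil>} \<times> {..nat \<lceil>R\<rceil>}"
  proof
    fix i assume "i \<in> K"
    then have i: "(real (fst i))\<^sup>2 + (real (snd i))\<^sup>2 < R" by (simp add: K_def)
    have sq: "real n \<le> (real n)\<^sup>2" for n by (cases n) (auto simp: power2_eq_square)
    have "real (fst i) \<le> R" "real (snd i) \<le> R"
      using i sq[of "fst i"] sq[of "snd i"] zero_le_power2[of "real (fst i)"] zero_le_power2[of "real (snd i)"]
      by linarith+
    then have "fst i \<le> nat \<lceil>R\<rceil>" "snd i \<le> nat \<lceil>R\<rceil>" by linarith+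
    then show "i \<in> {..nat \<lceil>R\<rceil>} \<times> {..nat \<lceil>R\<rceil>}" by (simp add: mem_Times_iff)
  qed
  then have K: "finite K" by (rule finite_subset) simp
  have "bounded (range (\<lambda>k. ip P (u0 k) (e_cc i)))" for i
  proof (rule boundedI[of _ "sqrt (e_norm i)"])
    fix y assume "y \<in> range (\<lambda>k. ip P (u0 k) (e_cc i))"
    then obtain k where y: "y = ip P (u0 k) (e_cc i)" by blast
    have "y\<^sup>2 \<le> e_norm i"
      using ip_Cauchy_Schwarz[OF admissible_L2(1)[OF ug0(1)] L2_e(1), of k i]
      by (simp add: y ug0(2) ip_e_cc)
    then show "norm y \<le> sqrt (e_norm i)"
      using real_sqrt_le_mono by fastforce
  qed
  then obtain r l where r: "strict_mono r"
    and l: "\<And>i. i \<in> K \<Longrightarrow> (\<lambda>k. ip P (u0 (r k)) (e_cc i)) \<longlonglongrightarrow> l i"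
    using finite_family_convergent_subsequence[OF K, of "\<lambda>i k. ip P (u0 k) (e_cc i)"] by blast
  define u where "u k = u0 (r k)" for k
  define g where "g k = g0 (r k)" for k
  have adm: "admissible (u k) (g k)" and norm1: "ip P (u k) (u k) = 1" for k
    using ug0 by (auto simp: u_def g_def)
  note L2 = admissible_L2[OF adm]
  define q where "q k = ip P (g k) (g k) - lam" for k
  have q_lim: "q \<longlonglongrightarrow> 0"
  proof (rule tendsto_sandwich[OF _ _ tendsto_const])
    show "\<forall>\<^sub>F k in sequentially. 0 \<le> q k"
      using lam_le[OF adm] norm1 by (simp add: q_def)
    show "\<forall>\<^sub>F k in sequentially. q k \<le> 1 / real (Suc (r k))"
      using ug0(3) by (intro always_eventually allI) (simp add: q_def g_def less_imp_le algebra_simps)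
    show "(\<lambda>k. 1 / real (Suc (r k))) \<longlonglongrightarrow> 0"
      using LIMSEQ_subseq_LIMSEQ[OF LIMSEQ_inverse_real_of_nat r] by (simp add: o_def inverse_eq_divide)
  qed
  define A where "A k = (\<Sum>i\<in>K. 2 * (ip P (u k) (e_cc i) - l i)\<^sup>2 / e_norm i)" for k
  have "A \<longlonglongrightarrow> (\<Sum>i\<in>K. 2 * (l i - l i)\<^sup>2 / e_norm i)"
    unfolding A_def[abs_def] u_def
    using e_norm_pos by (intro tendsto_intros l) (auto simp: less_imp_neq[THEN not_sym])
  then have A_lim: "A \<longlonglongrightarrow> 0" by simp
  let ?w = "\<lambda>m n x. u m x - u n x" and ?gw = "\<lambda>m n x. g m x - g n x"
  have low: "(\<Sum>i\<in>K. energy (?w m n) i) \<le> A m + A n" for m n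
    unfolding A_def sum.distrib[symmetric]
  proof (rule sum_mono)
    fix i assume "i \<in> K"
    let ?x = "ip P (u m) (e_cc i)" and ?y = "ip P (u n) (e_cc i)"
    have "0 \<le> (?x + ?y - 2 * l i)\<^sup>2" by simp
    then have "(?x - ?y)\<^sup>2 \<le> 2 * (?x - l i)\<^sup>2 + 2 * (?y - l i)\<^sup>2"
      by (simp add: power2_eq_square algebra_simps)
    then have "(?x - ?y)\<^sup>2 / e_norm i \<le> (2 * (?x - l i)\<^sup>2 + 2 * (?y - l i)\<^sup>2) / e_norm i"
      using e_norm_pos[of i] by (intro divide_right_mono) auto
    then show "energy (?w m n) i \<le> 2 * (?x - l i)\<^sup>2 / e_norm i + 2 * (?y - l i)\<^sup>2 / e_norm i"
      by (simp add: energy_def ip_diff_left L2 L2_e add_divide_distrib)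
  qed
  have gap: "ip P (?w m n) (?w m n) \<le> A m + A n + slen / (pi\<^sup>2 * R) * ip P (?gw m n) (?gw m n)" for m n
  proof -
    have "H1 P (?w m n) (?gw m n)"
      using admissible_diff[OF adm adm] by (simp add: admissible_def)
    from H1_gap_norm[OF this K _ R(1)] low[of m n] show ?thesis
      by (auto simp: K_def not_less)
  qed
  have form: "ip P (?gw m n) (?gw m n) - lam * ip P (?w m n) (?w m n) \<le> 2 * q m + 2 * q n" for m n
  proof -
    have "lam * ip P (\<lambda>x. u m x + u n x) (\<lambda>x. u m x + u n x) \<le> ip P (\<lambda>x. g m x + g n x) (\<lambda>x. g m x + g n x)"
      by (rule lam_le[OF admissible_add[OF adm adm]])
    moreover have "ip P (?gw m n) (?gw m n) + ip P (\<lambda>x. g m x + g n x) (\<lambda>x. g m x + g n x) = 2 * q m + 2 * q n + 4 * lam"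
      by (simp add: ip_sq_diff ip_sq_add L2 q_def)
    moreover have "ip P (?w m n) (?w m n) + ip P (\<lambda>x. u m x + u n x) (\<lambda>x. u m x + u n x) = 4"
      by (simp add: ip_sq_diff ip_sq_add L2 norm1)
    moreover have "G - lam * U \<le> 2 * q m + 2 * q n"
      if "lam * V \<le> H" "G + H = 2 * q m + 2 * q n + 4 * lam" "U + V = 4" for G H U V
    proof -
      have "lam * U + lam * V = 4 * lam"
        using that(3) by (metis distrib_left mult.commute)
      with that show ?thesis by linarith
    qed
    ultimately show ?thesis by blast
  qed
  \<comment> \<open>Inserting the gap estimate into \<open>form\<close> leaves half the gradient
    term against \<open>2 * q\<close> and \<open>lam * A\<close>; doubling gives
    \<open>B\<close>.\<close>
  define B where "B k = 4 * q k + 2 * lam * A k" for k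
  have B_lim: "B \<longlonglongrightarrow> 0"
    unfolding B_def[abs_def] using tendsto_add[OF tendsto_mult_left[OF q_lim, of 4] tendsto_mult_left[OF A_lim, of "2 * lam"]] by simp
  have gw_le: "ip P (?gw m n) (?gw m n) \<le> B m + B n" for m n
  proof -
    have "lam * ip P (?w m n) (?w m n) \<le> lam * (A m + A n) + lam * (slen / (pi\<^sup>2 * R)) * ip P (?gw m n) (?gw m n)"
      using mult_left_mono[OF gap[of m n] lam_nonneg] by (simp add: distrib_left mult.assoc)
    also have "\<dots> \<le> lam * (A m + A n) + 1 / 2 * ip P (?gw m n) (?gw m n)"
      using R(2) by (intro add_left_mono mult_right_mono ip_nonneg)
    finally show ?thesis using form[of m n] by (simp add: B_def algebra_simps)
  qed
  define T where "T = slen / (pi\<^sup>2 * R)"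
  have T: "0 \<le> T" using R slen_pos by (simp add: T_def)
  have w_le: "ip P (?w m n) (?w m n) \<le> (A m + T * B m) + (A n + T * B n)" for m n
    using gap[of m n] mult_left_mono[OF gw_le[of m n] T] by (simp add: T_def distrib_left)
  have AB_lim: "(\<lambda>k. A k + T * B k) \<longlonglongrightarrow> 0"
    using tendsto_add[OF A_lim tendsto_mult_left[OF B_lim, of T]] by simp
  obtain v where v: "L2 P v" "(\<lambda>n. ip P (\<lambda>x. u n x - v x) (\<lambda>x. u n x - v x)) \<longlonglongrightarrow> 0"
    using L2_complete_ip[OF P_lmeasurable L2(1) w_le AB_lim] by blast
  obtain h where h: "L2 P h" "(\<lambda>n. ip P (\<lambda>x. g n x - h x) (\<lambda>x. g n x - h x)) \<longlonglongrightarrow> 0"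
    using L2_complete_ip[OF P_lmeasurable L2(2) gw_le B_lim] by blast
  have "H1 P v h"
  proof (rule H1_closed[OF P_lmeasurable _ v(1) _ h(1)])
    show "H1 P (u k) (g k)" for k using adm by (simp add: admissible_def)
  qed (unfold ip_norm, fact v(2), fact h(2))
  moreover have "ip P v (\<lambda>x. 1) = 0"
    using ip_tendsto_left[OF L2(1) v(1) L2_const[of 1] v(2)] adm
    by (simp add: admissible_def LIMSEQ_const_iff)
  moreover have "ip P v v = 1"
    using ip_sq_tendsto[OF L2(1) v] by (simp add: norm1 LIMSEQ_const_iff)
  moreover have "ip P h h = lam"
  proof -
    have "(\<lambda>k. q k + lam) \<longlonglongrightarrow> 0 + lam" by (intro tendsto_intros q_lim)
    then show ?thesis
      using LIMSEQ_unique[OF ip_sq_tendsto[OF L2(2) h]] by (simp add: q_def)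
  qed
  ultimately show ?thesis by (auto simp: admissible_def)
qed

lemma lam_pos: "0 < lam"
proof -
  obtain u g where "admissible u g" "ip P u u = 1" "ip P g g = lam"
    using minimizer_ex by blast
  with poincare[of u g] have "1 \<le> slen / pi\<^sup>2 * lam" by (simp add: admissible_def)
  then have "lam \<noteq> 0" by auto
  with lam_nonneg show ?thesis by simp
qed

text \<open>Vanishing of the first variation. A competitor \<open>v\<close> of arbitrary mean is
  reduced to an admissible one by subtracting a constant, which changes neither its gradient nor, as
  \<open>u\<close> has mean zero, its pairing with \<open>u\<close>.\<close>

lemma euler_lagrange:
  assumes u: "admissible u g" "ip P g g = lam * ip P u u" and v: "H1 P v h"
  shows "ip P g h = lam * ip P u v"
proof -
  define c where "c = ip P v (\<lambda>x. 1) / measure lebesgue P"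
  let ?v = "\<lambda>x. v x - c * 1"
  have vL2: "L2 P v" "L2 P h" using v by (auto simp: H1_def)
  note L2 = admissible_L2[OF u(1)] vL2 L2_const
  have "ip P ?v (\<lambda>x. 1) = ip P v (\<lambda>x. 1) - c * measure lebesgue P"
    using ip_diff_left[OF vL2(1) L2_cmult[OF L2_const] L2_const, of c 1 1]
    by (simp only: ip_cmult_left ip_one_one)
  moreover have "H1 P ?v h"
    using H1_diff[OF P_lmeasurable v H1_const[of c]] by simp
  ultimately have v': "admissible ?v h"
    using measure_P_pos by (simp add: admissible_def c_def)
  have "0 \<le> 2 * r * (ip P g h - lam * ip P u ?v) + r\<^sup>2 * (ip P h h - lam * ip P ?v ?v)" for r
  proof -
    note L2' = admissible_L2(1)[OF v']
    have "lam * ip P (\<lambda>x. u x + r * ?v x) (\<lambda>x. u x + r * ?v x) \<le> ip P (\<lambda>x. g x + r *\<^sub>R h x) (\<lambda>x. g x + r *\<^sub>R h x)"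
      by (rule lam_le[OF admissible_add[OF u(1) admissible_cmult[OF v']]])
    also have "ip P (\<lambda>x. u x + r * ?v x) (\<lambda>x. u x + r * ?v x) = ip P u u + 2 * (r * ip P u ?v) + r * (r * ip P ?v ?v)"
      by (subst ip_sq_add[OF L2(1) L2_cmult[OF L2']]) (simp only: ip_cmult_left ip_cmult_right)
    also have "ip P (\<lambda>x. g x + r *\<^sub>R h x) (\<lambda>x. g x + r *\<^sub>R h x) = ip P g g + 2 * (r * ip P g h) + r * (r * ip P h h)"
      by (subst ip_sq_add[OF L2(2) L2_scaleR[OF L2(4)]]) (simp only: ip_scaleR_left ip_scaleR_right)
    finally show ?thesis using u(2) by (simp add: power2_eq_square algebra_simps)
  qed
  then have "ip P g h = lam * ip P u ?v"
    using quadratic_nonneg_imp_linear_zero by force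
  also have "ip P u ?v = ip P u v - c * ip P u (\<lambda>x. 1)"
    using ip_diff_right[OF vL2(1) L2_cmult[OF L2_const] L2(1), of c 1] by (simp only: ip_cmult_right)
  also have "ip P u (\<lambda>x. 1) = 0" using u(1) by (simp add: admissible_def)
  finally show ?thesis by simp
qed

end

section \<open>Counting eigenvalues\<close>

lemma ae_independent_imp_nonzero:
  assumes "ae_independent \<Omega> F" "finite F" "f \<in> F"
  shows "\<not> (AE x in lebesgue_on \<Omega>. f x = 0)"
proof
  assume f: "AE x in lebesgue_on \<Omega>. f x = 0"
  define c where "c h = (if h = f then 1 else 0 :: real)" for h
  have "(\<Sum>h\<in>F. c h * h x) = f x" for x
  proof -
    have "(\<Sum>h\<in>F. c h * h x) = (\<Sum>h\<in>{f}. c h * h x)"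
      using assms(2,3) by (intro sum.mono_neutral_right) (auto simp: c_def)
    then show ?thesis by (simp add: c_def)
  qed
  then have "AE x in lebesgue_on \<Omega>. (\<Sum>h\<in>F. c h * h x) = 0" using f by simp
  then have "c f = 0" using assms(1,3) unfolding ae_independent_def by blast
  then show False by (simp add: c_def)
qed

lemma ae_independent_singleton:
  assumes "\<not> (AE x in lebesgue_on \<Omega>. f x = 0)"
  shows "ae_independent \<Omega> {f}"
  unfolding ae_independent_def
proof (intro allI impI ballI)
  fix c h assume ae: "AE x in lebesgue_on \<Omega>. (\<Sum>h\<in>{f}. c h * h x) = 0" and "h \<in> {f}"
  show "c h = 0"
  proof (rule ccontr)
    assume "c h \<noteq> 0"
    then have "AE x in lebesgue_on \<Omega>. f x = 0" using ae \<open>h \<in> {f}\<close> by simp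
    with assms show False ..
  qed
qed

lemma neumann_multiplicity_ge_1:
  assumes "f \<in> neumann_eigenspace \<Omega> \<mu>" "\<not> (AE x in lebesgue_on \<Omega>. f x = 0)"
  shows "1 \<le> neumann_multiplicity \<Omega> \<mu>"
proof -
  have "enat (card {f}) \<le> neumann_multiplicity \<Omega> \<mu>"
    unfolding neumann_multiplicity_def
    by (rule SUP_upper) (use assms ae_independent_singleton in auto)
  then show ?thesis by (simp add: one_enat_def)
qed

lemma neumann_multiplicity_eq_0:
  assumes "\<And>f. f \<in> neumann_eigenspace \<Omega> \<mu> \<Longrightarrow> AE x in lebesgue_on \<Omega>. f x = 0"
  shows "neumann_multiplicity \<Omega> \<mu> = 0"
proof -
  have "enat (card F) \<le> 0" if "F \<in> {F. finite F \<and> F \<subseteq> neumann_eigenspace \<Omega> \<mu> \<and> ae_independent \<Omega> F}" for F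
  proof -
    have "F = {}" using that ae_independent_imp_nonzero assms by blast
    then show ?thesis by (simp add: zero_enat_def)
  qed
  then have "neumann_multiplicity \<Omega> \<mu> \<le> 0"
    unfolding neumann_multiplicity_def by (rule SUP_least)
  then show ?thesis by simp
qed

lemma neumann_laplacian_iff:
  "neumann_laplacian \<Omega> u f \<longleftrightarrow> L2 \<Omega> f \<and>
     (\<exists>g. H1 \<Omega> u g \<and> (\<forall>v h. H1 \<Omega> v h \<longrightarrow> ip \<Omega> g h = ip \<Omega> f v))"
  unfolding neumann_laplacian_def ip_real ip_def by simp

context pgram
begin

lemma not_AE_zero:
  fixes u :: "real^2 \<Rightarrow> real"
  assumes "ip P u u \<noteq> 0"
  shows "\<not> (AE x in lebesgue_on P. u x = 0)"
proof
  assume "AE x in lebesgue_on P. u x = 0"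
  then have "AE x in lebesgue_on P. u x * u x = 0" by eventually_elim simp
  then have "ip P u u = 0" unfolding ip_real by (rule integral_eq_zero_AE)
  with assms show False ..
qed

lemma eigenspace_gradient_ex:
  assumes "u \<in> neumann_eigenspace P \<mu>"
  shows "\<exists>g. H1 P u g \<and> (\<forall>v h. H1 P v h \<longrightarrow> ip P g h = \<mu> * ip P u v)"
  using assms by (auto simp: neumann_eigenspace_def neumann_laplacian_iff ip_cmult_left)

text \<open>Testing the eigenvalue equation with the constant 1 shows that \<open>u\<close> has mean
  zero, as \<open>\<mu>\<close> is nonzero; testing it with \<open>u\<close> then makes
  \<open>\<mu>\<close> an admissible Rayleigh quotient. Negative \<open>\<mu>\<close> are excluded
  by the same argument.\<close>

lemma eigenvalue_ge_lam:
  assumes u: "u \<in> neumann_eigenspace P \<mu>" "\<not> (AE x in lebesgue_on P. u x = 0)" and "\<mu> \<noteq> 0"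
  shows "lam \<le> \<mu>"
proof -
  obtain g where g: "H1 P u g" "\<And>v h. H1 P v h \<Longrightarrow> ip P g h = \<mu> * ip P u v"
    using eigenspace_gradient_ex[OF u(1)] by blast
  have "ip P g (\<lambda>x. 0) = \<mu> * ip P u (\<lambda>x. 1)" by (rule g(2)[OF H1_const])
  then have "admissible u g"
    using \<open>\<mu> \<noteq> 0\<close> g(1) by (simp add: ip_def admissible_def)
  then have "lam * ip P u u \<le> \<mu> * ip P u u"
    using lam_le g(2)[OF g(1)] by metis
  moreover have "0 < ip P u u"
    using u(2) ip_zero_imp_AE[of P u] g(1) ip_nonneg[of P u] by (force simp: H1_def)
  ultimately show ?thesis by simp
qed

text \<open>Testing with \<open>u\<close> itself makes its Dirichlet energy vanish; the Poincare
  inequality after subtraction of the mean does the rest.\<close>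

lemma zero_eigenspace_AE_const:
  assumes "u \<in> neumann_eigenspace P 0"
  shows "\<exists>m. AE x in lebesgue_on P. u x = m"
proof -
  obtain g where g: "H1 P u g" "\<And>v h. H1 P v h \<Longrightarrow> ip P g h = 0 * ip P u v"
    using eigenspace_gradient_ex[OF assms] by blast
  have uL2: "L2 P u" using g(1) by (simp add: H1_def)
  define m where "m = ip P u (\<lambda>x. 1) / measure lebesgue P"
  have H: "H1 P (\<lambda>x. u x - m * 1) g"
    using H1_diff[OF P_lmeasurable g(1) H1_const[of m]] by simp
  have "ip P (\<lambda>x. u x - m * 1) (\<lambda>x. 1) = ip P u (\<lambda>x. 1) - m * measure lebesgue P"
    using ip_diff_left[OF uL2 L2_cmult[OF L2_const] L2_const, of m 1 1]
    by (simp only: ip_cmult_left ip_one_one)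
  also have "\<dots> = 0" using measure_P_pos by (simp add: m_def)
  finally have "ip P (\<lambda>x. u x - m * 1) (\<lambda>x. u x - m * 1) \<le> slen / pi\<^sup>2 * ip P g g"
    by (rule poincare[OF H])
  also have "ip P g g = 0" using g(2)[OF g(1)] by simp
  finally have "ip P (\<lambda>x. u x - m * 1) (\<lambda>x. u x - m * 1) = 0"
    using ip_nonneg[of P "\<lambda>x. u x - m * 1"] by simp
  from ip_zero_imp_AE[OF _ this] H have "AE x in lebesgue_on P. u x - m * 1 = 0"
    by (simp add: H1_def)
  then show ?thesis by (intro exI[of _ m]) simp
qed

lemma multiplicity_zero: "neumann_multiplicity P 0 = 1"
proof (rule antisym)
  have "L2 P (\<lambda>x. 0 * 1 :: real)" using L2_zero by simp
  moreover have "ip P (\<lambda>x. 0) h = 0" for h :: "real^2 \<Rightarrow> real^2" by (simp add: ip_def)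
  ultimately have "(\<lambda>x. 1) \<in> neumann_eigenspace P 0"
    unfolding neumann_eigenspace_def neumann_laplacian_iff
    using H1_const[of 1] by (auto simp: ip_def)
  then show "1 \<le> neumann_multiplicity P 0"
    by (rule neumann_multiplicity_ge_1)
      (use not_AE_zero[of "\<lambda>x. 1"] measure_P_pos in \<open>simp only: ip_one_one\<close>, simp)
  show "neumann_multiplicity P 0 \<le> 1"
    unfolding neumann_multiplicity_def
  proof (rule SUP_least)
    fix F assume "F \<in> {F. finite F \<and> F \<subseteq> neumann_eigenspace P 0 \<and> ae_independent P F}"
    then have F: "finite F" "F \<subseteq> neumann_eigenspace P 0" "ae_independent P F" by auto
    have "f1 = f2" if f: "f1 \<in> F" "f2 \<in> F" for f1 f2
    proof (rule ccontr)
      assume ne: "f1 \<noteq> f2"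
      obtain m1 m2 where m: "AE x in lebesgue_on P. f1 x = m1" "AE x in lebesgue_on P. f2 x = m2"
        using zero_eigenspace_AE_const F(2) f by blast
      \<comment> \<open>The evident linear relation between two constants. Independence forces
        \<open>m1 = 0\<close>, so \<open>f1\<close> would vanish almost everywhere, which
        independence excludes as well.\<close>
      define c where "c = (\<lambda>f. if f = f1 then m2 else if f = f2 then - m1 else 0)"
      have sum_c: "(\<Sum>f\<in>F. c f * f x) = m2 * f1 x - m1 * f2 x" for x
      proof -
        have "(\<Sum>f\<in>F. c f * f x) = (\<Sum>f\<in>{f1, f2}. c f * f x)"
          using F(1) f by (intro sum.mono_neutral_right) (auto simp: c_def)
        then show ?thesis using ne by (simp add: c_def)
      qed
      have "AE x in lebesgue_on P. (\<Sum>f\<in>F. c f * f x) = 0"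
        unfolding sum_c using m by eventually_elim simp
      then have "c f2 = 0" using F(3) f(2) unfolding ae_independent_def by blast
      then have "m1 = 0" using ne by (simp add: c_def)
      with m(1) ae_independent_imp_nonzero[OF F(3,1) f(1)] show False by simp
    qed
    then have "card F \<le> 1"
      using F(1) by (simp add: card_le_Suc0_iff_eq)
    then show "enat (card F) \<le> 1" by (simp add: one_enat_def)
  qed
qed

lemma multiplicity_lam: "1 \<le> neumann_multiplicity P lam"
proof -
  obtain u g where u: "admissible u g" "ip P u u = 1" "ip P g g = lam"
    using minimizer_ex by blast
  have "u \<in> neumann_eigenspace P lam"
    unfolding neumann_eigenspace_def neumann_laplacian_iff
    using u(1) L2_cmult[OF admissible_L2(1)[OF u(1)], of lam] euler_lagrange[OF u(1)] u(2,3)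
    by (auto simp: admissible_def ip_cmult_left)
  then show ?thesis
    by (rule neumann_multiplicity_ge_1) (use not_AE_zero[of u] u(2) in simp)
qed

lemma multiplicity_below_lam:
  assumes "\<mu> < lam" "\<mu> \<noteq> 0"
  shows "neumann_multiplicity P \<mu> = 0"
  using eigenvalue_ge_lam[of _ \<mu>] assms by (intro neumann_multiplicity_eq_0) fastforce

text \<open>Below \<open>lam\<close> only 0 contributes, with multiplicity exactly 1, while
  \<open>lam\<close> itself adds at least 1. The simplicity of 0 is what makes the second eigenvalue
  positive.\<close>

lemma counting_ge_2_iff: "enat 2 \<le> neumann_counting P \<tau> \<longleftrightarrow> lam \<le> \<tau>"
proof
  assume "lam \<le> \<tau>"
  have "enat 2 = 1 + 1" by (simp add: one_enat_def)
  also have "\<dots> \<le> neumann_multiplicity P 0 + neumann_multiplicity P lam"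
    by (intro add_mono multiplicity_lam) (simp add: multiplicity_zero)
  also have "\<dots> = (\<Sum>\<mu>\<in>{0, lam}. neumann_multiplicity P \<mu>)"
    using lam_pos by simp
  also have "\<dots> \<le> neumann_counting P \<tau>"
    unfolding neumann_counting_def
    by (rule SUP_upper) (use \<open>lam \<le> \<tau>\<close> lam_pos in auto)
  finally show "enat 2 \<le> neumann_counting P \<tau>" .
next
  assume ge: "enat 2 \<le> neumann_counting P \<tau>"
  show "lam \<le> \<tau>"
  proof (rule ccontr)
    assume "\<not> lam \<le> \<tau>"
    have "neumann_counting P \<tau> \<le> 1"
      unfolding neumann_counting_def
    proof (rule SUP_least)
      fix S assume "S \<in> {S. finite S \<and> S \<subseteq> {..\<tau>}}"
      then have S: "finite S" "\<And>\<mu>. \<mu> \<in> S \<Longrightarrow> \<mu> < lam"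
        using \<open>\<not> lam \<le> \<tau>\<close> by auto
      \<comment> \<open>Adding 0 to \<open>S\<close> can only increase the sum and treats all
        \<open>S\<close> alike, including those without 0.\<close>
      have "(\<Sum>\<mu>\<in>S. neumann_multiplicity P \<mu>) \<le> (\<Sum>\<mu>\<in>insert 0 S. neumann_multiplicity P \<mu>)"
        using S(1) by (intro sum_mono2) auto
      also have "\<dots> = (\<Sum>\<mu>\<in>{0}. neumann_multiplicity P \<mu>)"
        using S multiplicity_below_lam by (intro sum.mono_neutral_right) auto
      finally show "(\<Sum>\<mu>\<in>S. neumann_multiplicity P \<mu>) \<le> 1"
        by (simp add: multiplicity_zero)
    qed
    with ge have "enat 2 \<le> 1" by (rule order_trans)
    then show False by (simp add: one_enat_def)
  qed
qed

lemma neumann_eigenvalue_eq_lam: "neumann_eigenvalue P 2 = lam"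
  unfolding neumann_eigenvalue_def counting_ge_2_iff by (rule Least_equality) auto

end

section \<open>Trial functions\<close>

text \<open>The right-hand side is twice the smaller eigenvalue of the symmetric matrix with
  diagonal \<open>p\<close>, \<open>w\<close> and off-diagonal entry \<open>- q\<close>. Subtracting
  \<open>X\<close> leaves a positive semidefinite form, whose determinant is nonnegative.\<close>

lemma quadratic_form_lower_bound:
  fixes X p q w :: real
  assumes "\<And>x y. X * (x\<^sup>2 + y\<^sup>2) \<le> p * x\<^sup>2 - 2 * q * (x * y) + w * y\<^sup>2"
  shows "2 * X \<le> p + w - sqrt ((p - w)\<^sup>2 + 4 * q\<^sup>2)"
proof -
  define \<alpha> \<beta> where "\<alpha> = p - X" and "\<beta> = w - X"
  have Q: "0 \<le> \<alpha> * x\<^sup>2 - 2 * q * (x * y) + \<beta> * y\<^sup>2" for x y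
    using assms[of x y] by (simp add: \<alpha>_def \<beta>_def algebra_simps)
  have nn: "0 \<le> \<alpha>" "0 \<le> \<beta>" using Q[of 1 0] Q[of 0 1] by auto
  have "q\<^sup>2 \<le> \<alpha> * \<beta>"
  proof (cases "\<alpha> = 0")
    case True
    have "0 \<le> 2 * r * (- q) + r\<^sup>2 * \<beta>" for r
      using Q[of 1 r] True by (simp add: mult_ac)
    then have "- q = 0" by (rule quadratic_nonneg_imp_linear_zero)
    with True show ?thesis by simp
  next
    case False
    \<comment> \<open>At the vector (q, \<alpha>) the form equals \<alpha> times its
      determinant.\<close>
    have "0 \<le> \<alpha> * (\<alpha> * \<beta> - q\<^sup>2)"
      using Q[of q \<alpha>] by (simp add: power2_eq_square algebra_simps)
    with False nn show ?thesis by (simp add: zero_le_mult_iff)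
  qed
  moreover have "(\<alpha> + \<beta>)\<^sup>2 = (p - w)\<^sup>2 + 4 * (\<alpha> * \<beta>)"
    by (simp add: \<alpha>_def \<beta>_def power2_eq_square algebra_simps)
  ultimately have "sqrt ((p - w)\<^sup>2 + 4 * q\<^sup>2) \<le> \<alpha> + \<beta>"
    using nn by (intro real_le_lsqrt) auto
  then show ?thesis by (simp add: \<alpha>_def \<beta>_def)
qed

text \<open>With \<open>\<sigma> = (A + B)\<^sup>2 / 4\<close> and \<open>d = (A - B)\<^sup>2 / 4\<close> the affine trial functions give
  \<open>\<mu> (\<sigma> + d + r) \<le> 12\<close> with \<open>r = sqrt (4 d \<sigma> + c\<^sup>2)\<close>, which suffices if \<open>r + d \<ge> \<sigma> / 2\<close>; the
  trigonometric ones cover the remaining parallelograms, which are close to squares.\<close>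

lemma trial_bounds_imp_perimeter_bound:
  fixes A B c \<mu> :: real
  assumes "0 < A" "0 < B" and D: "c\<^sup>2 < A\<^sup>2 * B\<^sup>2"
    and affine: "\<And>x y. \<mu> * (A\<^sup>2 * B\<^sup>2 - c\<^sup>2) * (x\<^sup>2 + y\<^sup>2) \<le> 12 * B\<^sup>2 * x\<^sup>2 - 2 * (12 * c) * (x * y) + 12 * A\<^sup>2 * y\<^sup>2"
    and trig: "\<And>x y. \<mu> * (A\<^sup>2 * B\<^sup>2 - c\<^sup>2) * (x\<^sup>2 + y\<^sup>2) \<le> pi\<^sup>2 * B\<^sup>2 * x\<^sup>2 - 2 * (8 * c) * (x * y) + pi\<^sup>2 * A\<^sup>2 * y\<^sup>2"
  shows "\<mu> * (A + B)\<^sup>2 \<le> 4 * pi\<^sup>2 \<and> (\<mu> * (A + B)\<^sup>2 = 4 * pi\<^sup>2 \<longrightarrow> A = B \<and> c = 0)"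
proof -
  define \<sigma> d where "\<sigma> = (A + B)\<^sup>2 / 4" and "d = (A - B)\<^sup>2 / 4"
  define r where "r = sqrt (4 * d * \<sigma> + c\<^sup>2)"
  define E where "E = A\<^sup>2 * B\<^sup>2 - c\<^sup>2"
  have \<sigma>: "0 < \<sigma>" and d: "0 \<le> d" using assms by (auto simp: \<sigma>_def d_def)
  have E: "0 < E" "E = (\<sigma> - d)\<^sup>2 - c\<^sup>2"
    using D by (auto simp: E_def \<sigma>_def d_def power2_eq_square field_simps)
  have sum: "A\<^sup>2 + B\<^sup>2 = 2 * (\<sigma> + d)" and diff: "(B\<^sup>2 - A\<^sup>2)\<^sup>2 = 16 * d * \<sigma>"
    by (auto simp: \<sigma>_def d_def power2_eq_square field_simps)
  have r_sq: "r\<^sup>2 = 4 * d * \<sigma> + c\<^sup>2" and r: "0 \<le> r"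
    using \<sigma> d by (auto simp: r_def)
  have pi4: "pi\<^sup>2 < 16" and pi3: "9 < pi\<^sup>2"
    using power_strict_mono[of pi 4 2] power_strict_mono[of 3 pi 2] pi_less_4 pi_gt3 by auto
  have main: "\<mu> * \<sigma> < pi\<^sup>2 \<or> (d = 0 \<and> c = 0 \<and> \<mu> * \<sigma> \<le> pi\<^sup>2)"
  proof (cases "\<sigma> / 2 \<le> r + d")
    case True
    have "2 * (\<mu> * E) \<le> 12 * B\<^sup>2 + 12 * A\<^sup>2 - sqrt ((12 * B\<^sup>2 - 12 * A\<^sup>2)\<^sup>2 + 4 * (12 * c)\<^sup>2)"
      using affine unfolding E_def by (rule quadratic_form_lower_bound)
    also have "(12 * B\<^sup>2 - 12 * A\<^sup>2)\<^sup>2 + 4 * (12 * c)\<^sup>2 = (24 * r)\<^sup>2"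
      unfolding power_mult_distrib r_sq using diff by (simp add: power2_eq_square algebra_simps)
    also have "sqrt ((24 * r)\<^sup>2) = 24 * r"
      using r by (simp only: real_sqrt_abs abs_of_nonneg mult_nonneg_nonneg zero_le_numeral)
    finally have "\<mu> * E \<le> 12 * (\<sigma> + d - r)" using sum by simp
    \<comment> \<open>The squared area is the product of the eigenvalues
      \<open>\<sigma> + d - r\<close> and \<open>\<sigma> + d + r\<close> of the Gram matrix, so the
      smaller one cancels.\<close>
    moreover have E_fact: "E = (\<sigma> + d - r) * (\<sigma> + d + r)"
      using r_sq unfolding E(2) by (simp add: power2_eq_square algebra_simps)
    moreover have pos: "0 < \<sigma> + d + r" using \<sigma> d r by simp
    ultimately have "\<mu> * (\<sigma> + d + r) * (\<sigma> + d - r) \<le> 12 * (\<sigma> + d - r)" "0 < \<sigma> + d - r"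
      using E(1) by (simp_all add: mult_ac zero_less_mult_iff)
    then have le12: "\<mu> * (\<sigma> + d + r) \<le> 12" by (rule mult_right_le_imp_le)
    show ?thesis
    proof (cases "\<mu> \<le> 0")
      case True
      then have "\<mu> * \<sigma> \<le> 0" using \<sigma> by (simp add: mult_nonpos_nonneg)
      then show ?thesis using pi3 by linarith
    next
      case False
      \<comment> \<open>The threshold enters here: 12 divided by 3/2 is 8, safely below 9 and hence
        below pi^2.\<close>
      have "\<mu> * (3 / 2 * \<sigma>) \<le> \<mu> * (\<sigma> + d + r)"
        using True False by (intro mult_left_mono) auto
      then have "\<mu> * \<sigma> \<le> 8" using le12 by simp
      then show ?thesis using pi3 by linarith
    qed
  next
    case False
    define R where "R = sqrt (4 * (pi\<^sup>2)\<^sup>2 * d * \<sigma> + 64 * c\<^sup>2)"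
    have R: "0 \<le> R" "R\<^sup>2 = 4 * (pi\<^sup>2)\<^sup>2 * d * \<sigma> + 64 * c\<^sup>2"
      using \<sigma> d by (auto simp: R_def)
    have "2 * (\<mu> * E) \<le> pi\<^sup>2 * B\<^sup>2 + pi\<^sup>2 * A\<^sup>2 - sqrt ((pi\<^sup>2 * B\<^sup>2 - pi\<^sup>2 * A\<^sup>2)\<^sup>2 + 4 * (8 * c)\<^sup>2)"
      using trig unfolding E_def by (rule quadratic_form_lower_bound)
    also have "(pi\<^sup>2 * B\<^sup>2 - pi\<^sup>2 * A\<^sup>2)\<^sup>2 + 4 * (8 * c)\<^sup>2 = (pi\<^sup>2)\<^sup>2 * (B\<^sup>2 - A\<^sup>2)\<^sup>2 + 256 * c\<^sup>2"
      unfolding right_diff_distrib[symmetric] power_mult_distrib by simp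
    also have "\<dots> = (2 * R)\<^sup>2"
      unfolding power_mult_distrib R(2) diff by simp
    also have "sqrt ((2 * R)\<^sup>2) = 2 * R"
      using R(1) by (simp only: real_sqrt_abs abs_of_nonneg mult_nonneg_nonneg zero_le_numeral)
    also have "pi\<^sup>2 * B\<^sup>2 + pi\<^sup>2 * A\<^sup>2 = 2 * (pi\<^sup>2 * (\<sigma> + d))"
      using sum by (metis add.commute distrib_left mult.left_commute)
    finally have le: "\<mu> * E \<le> pi\<^sup>2 * (\<sigma> + d) - R" by simp
    show ?thesis
    proof (cases "d = 0 \<and> c = 0")
      case True
      with le E have "\<mu> * \<sigma>\<^sup>2 \<le> pi\<^sup>2 * \<sigma>" by (simp add: R_def)
      then have "\<mu> * \<sigma> \<le> pi\<^sup>2" using \<sigma> by (simp add: power2_eq_square mult.assoc[symmetric])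
      with True show ?thesis by simp
    next
      case ne: False
      \<comment> \<open>Chosen such that \<sigma> (\<sigma> + d) = E + Z - d^2. The trigonometric
        bound multiplied by \<sigma> then beats pi^2 E as soon as pi^2 Z is less than \<sigma>
        R.\<close>
      define Z where "Z = 3 * \<sigma> * d + c\<^sup>2"
      have Z: "0 \<le> Z" using \<sigma> d by (simp add: Z_def)
      have "r\<^sup>2 < (\<sigma> / 2)\<^sup>2"
        using False r d by (intro power_strict_mono) auto
      moreover have "Z \<le> r\<^sup>2" unfolding Z_def r_sq using mult_nonneg_nonneg[OF d less_imp_le[OF \<sigma>]] by (simp add: mult_ac)
      ultimately have "Z \<le> \<sigma>\<^sup>2 / 4" by (simp add: power_divide)
      then have "Z * Z \<le> (\<sigma>\<^sup>2 / 4) * Z" using Z by (rule mult_right_mono)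
      then have "(pi\<^sup>2)\<^sup>2 * (Z * Z) \<le> (pi\<^sup>2)\<^sup>2 * ((\<sigma>\<^sup>2 / 4) * Z)" by (rule mult_left_mono) simp
      also have "\<dots> = \<sigma>\<^sup>2 * ((pi\<^sup>2)\<^sup>2 * (3 / 4) * (\<sigma> * d) + (pi\<^sup>2)\<^sup>2 / 4 * c\<^sup>2)"
        by (simp add: Z_def algebra_simps)
      also have "\<dots> < \<sigma>\<^sup>2 * ((pi\<^sup>2)\<^sup>2 * 4 * (\<sigma> * d) + 64 * c\<^sup>2)"
      proof (rule mult_strict_left_mono)
        \<comment> \<open>From pi < 4 one gets pi^4 / 4 < 64, where 64 is the square of the mixed
          coefficient 8. The \<sigma> d terms, with 3/4 against 4, have ample room.\<close>
        have p: "(pi\<^sup>2)\<^sup>2 < 256" using power_strict_mono[OF pi4, of 2] by simp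
        have nn: "0 \<le> (pi\<^sup>2)\<^sup>2 * (\<sigma> * d)" "0 \<le> c\<^sup>2" using \<sigma> d by auto
        have c: "(pi\<^sup>2)\<^sup>2 / 4 * c\<^sup>2 \<le> 64 * c\<^sup>2" using p by (intro mult_right_mono) auto
        show "(pi\<^sup>2)\<^sup>2 * (3 / 4) * (\<sigma> * d) + (pi\<^sup>2)\<^sup>2 / 4 * c\<^sup>2 < (pi\<^sup>2)\<^sup>2 * 4 * (\<sigma> * d) + 64 * c\<^sup>2"
        proof (cases "c = 0")
          case True
          with ne d have "0 < (pi\<^sup>2)\<^sup>2 * (\<sigma> * d)" using \<sigma> by simp
          then show ?thesis using c by linarith
        next
          case False
          then have "(pi\<^sup>2)\<^sup>2 / 4 * c\<^sup>2 < 64 * c\<^sup>2" using p by (intro mult_strict_right_mono) auto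
          then show ?thesis using nn by linarith
        qed
      qed (use \<sigma> in simp)
      also have "\<dots> = (\<sigma> * R)\<^sup>2"
        unfolding power_mult_distrib R(2) by (simp add: algebra_simps)
      finally have "(pi\<^sup>2 * Z)\<^sup>2 < (\<sigma> * R)\<^sup>2"
        by (simp add: power_mult_distrib power2_eq_square mult_ac)
      then have lt: "pi\<^sup>2 * Z < \<sigma> * R"
        by (rule power2_less_imp_less) (use \<sigma> R in simp)
      have "\<sigma> * (\<mu> * E) \<le> \<sigma> * (pi\<^sup>2 * (\<sigma> + d) - R)"
        using le \<sigma> by (intro mult_left_mono) auto
      also have "\<dots> = pi\<^sup>2 * (E + Z - d\<^sup>2) - \<sigma> * R"
        unfolding E(2) Z_def by (simp add: power2_eq_square algebra_simps)
      also have "\<dots> \<le> pi\<^sup>2 * (E + Z) - \<sigma> * R"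
        by (intro diff_right_mono mult_left_mono) auto
      also have "\<dots> < pi\<^sup>2 * E" using lt by (simp add: distrib_left)
      finally have "(\<mu> * \<sigma>) * E < pi\<^sup>2 * E" by (simp add: mult_ac)
      then show ?thesis using E(1) by simp
    qed
  qed
  have \<mu>\<sigma>: "\<mu> * (A + B)\<^sup>2 = 4 * (\<mu> * \<sigma>)" by (simp add: \<sigma>_def)
  show ?thesis
    unfolding \<mu>\<sigma> using main by (auto simp: d_def)
qed

lemma integral_eqI:
  assumes "\<And>y. (F has_real_derivative f y) (at y)" "F 1 - F 0 = v"
  shows "integral {0..1} f = v"
proof -
  have "(f has_integral (F 1 - F 0)) {0..1}"
    by (rule fundamental_theorem_of_calculus)
      (auto simp: has_real_derivative_iff_has_vector_derivative[symmetric]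
        intro: has_field_derivative_at_within assms(1))
  then show ?thesis using assms(2) by (simp add: integral_unique)
qed

section \<open>Rayleigh quotients of separated trial functions\<close>

context pgram
begin

lemma integral_s_t:
  assumes "continuous_on UNIV f"
  shows "(LINT x|lebesgue_on P. f (s x)) = measure lebesgue P * integral {0..1} f"
    and "(LINT x|lebesgue_on P. f (t x)) = measure lebesgue P * integral {0..1} f"
  using integral_tensor[of f "\<lambda>_. 1"] integral_tensor[of "\<lambda>_. 1" f] assms by simp_all

lemma integrable_tensor:
  fixes f h :: "real \<Rightarrow> real"
  assumes "continuous_on UNIV f" "continuous_on UNIV h"
  shows "integrable (lebesgue_on P) (\<lambda>x. f (s x) * h (t x))"
proof -
  have "continuous_on UNIV (\<lambda>x. f (s x))" "continuous_on UNIV (\<lambda>x. h (t x))"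
    by (rule continuous_on_compose2[OF assms(1)] continuous_on_compose2[OF assms(2)]; use s_t_continuous in simp)+
  then show ?thesis
    by (rule L2_mult_integrable[OF L2_continuous_P L2_continuous_P])
qed

lemma integral_quadratic_separable:
  fixes \<alpha> \<beta> \<gamma> :: real
  assumes f: "continuous_on UNIV f" and h: "continuous_on UNIV h"
  shows "(LINT x|lebesgue_on P. \<alpha> * (f (s x))\<^sup>2 + \<beta> * (f (s x) * h (t x)) + \<gamma> * (h (t x))\<^sup>2)
    = measure lebesgue P * (\<alpha> * integral {0..1} (\<lambda>y. (f y)\<^sup>2)
      + \<beta> * (integral {0..1} f * integral {0..1} h) + \<gamma> * integral {0..1} (\<lambda>y. (h y)\<^sup>2))"
proof -
  have c: "continuous_on UNIV (\<lambda>y. (f y)\<^sup>2)" "continuous_on UNIV (\<lambda>y. (h y)\<^sup>2)"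
    using f h by (auto intro: continuous_intros)
  have "integrable (lebesgue_on P) (\<lambda>x. (f (s x))\<^sup>2)" "integrable (lebesgue_on P) (\<lambda>x. (h (t x))\<^sup>2)"
    using integrable_tensor[of "\<lambda>y. (f y)\<^sup>2" "\<lambda>_. 1"] integrable_tensor[of "\<lambda>_. 1" "\<lambda>y. (h y)\<^sup>2"] c by simp_all
  then show ?thesis
    using integrable_tensor[OF f h] integral_s_t(1)[OF c(1)] integral_s_t(2)[OF c(2)] integral_tensor[OF f h]
    by (simp add: algebra_simps)
qed

text \<open>The variational inequality for f(s) + h(t). As both summands have mean zero, the mixed
  term drops out of the norm but survives in the energy, where f' and h' may have nonzero mean. The
  area cancels and the denominator \<open>D\<close> of the Dirichlet density is cleared.\<close>

lemma lam_trial: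
  assumes df: "\<And>y. (f has_real_derivative f' y) (at y)" and dh: "\<And>y. (h has_real_derivative h' y) (at y)"
    and f': "continuous_on UNIV f'" and h': "continuous_on UNIV h'"
    and mean: "integral {0..1} f = 0" "integral {0..1} h = 0"
  shows "lam * D * (integral {0..1} (\<lambda>y. (f y)\<^sup>2) + integral {0..1} (\<lambda>y. (h y)\<^sup>2))
    \<le> (norm b)\<^sup>2 * integral {0..1} (\<lambda>y. (f' y)\<^sup>2) - 2 * (a \<bullet> b) * (integral {0..1} f' * integral {0..1} h')
      + (norm a)\<^sup>2 * integral {0..1} (\<lambda>y. (h' y)\<^sup>2)"
proof -
  let ?u = "\<lambda>x. f (s x) + h (t x)" and ?g = "\<lambda>x. f' (s x) *\<^sub>R a' + h' (t x) *\<^sub>R b'"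
  let ?M = "measure lebesgue P"
  have f: "continuous_on UNIV f" and h: "continuous_on UNIV h"
    using df dh by (meson DERIV_isCont continuous_at_imp_continuous_on)+
  have "ip P ?u (\<lambda>x. 1) = ?M * integral {0..1} f + ?M * integral {0..1} h"
    using integrable_tensor[of f "\<lambda>_. 1"] integrable_tensor[of "\<lambda>_. 1" h] f h
    by (simp add: ip_real integral_s_t)
  then have "admissible ?u ?g"
    using H1_separable[OF df dh f' h'] mean by (simp add: admissible_def)
  then have "lam * ip P ?u ?u \<le> ip P ?g ?g" by (rule lam_le)
  also have "ip P ?u ?u = (LINT x|lebesgue_on P. 1 * (f (s x))\<^sup>2 + 2 * (f (s x) * h (t x)) + 1 * (h (t x))\<^sup>2)"
    unfolding ip_real by (intro Bochner_Integration.integral_cong refl) (simp add: power2_eq_square algebra_simps)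
  also have "\<dots> = ?M * (integral {0..1} (\<lambda>y. (f y)\<^sup>2) + integral {0..1} (\<lambda>y. (h y)\<^sup>2))"
    unfolding integral_quadratic_separable[OF f h] by (simp add: mean)
  also have "ip P ?g ?g = (LINT x|lebesgue_on P. (norm b)\<^sup>2 / D * (f' (s x))\<^sup>2
      + (- 2 * (a \<bullet> b) / D) * (f' (s x) * h' (t x)) + (norm a)\<^sup>2 / D * (h' (t x))\<^sup>2)"
    unfolding ip_def power2_norm_eq_inner[symmetric] norm_dual_comb
    by (intro Bochner_Integration.integral_cong refl)
      (simp add: add_divide_distrib diff_divide_distrib mult_ac)
  also have "\<dots> = ?M * (((norm b)\<^sup>2 * integral {0..1} (\<lambda>y. (f' y)\<^sup>2) - 2 * (a \<bullet> b) * (integral {0..1} f' * integral {0..1} h')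
      + (norm a)\<^sup>2 * integral {0..1} (\<lambda>y. (h' y)\<^sup>2)) / D)"
    unfolding integral_quadratic_separable[OF f' h'] by (simp add: add_divide_distrib diff_divide_distrib)
  finally have "?M * (lam * (integral {0..1} (\<lambda>y. (f y)\<^sup>2) + integral {0..1} (\<lambda>y. (h y)\<^sup>2)))
    \<le> ?M * (((norm b)\<^sup>2 * integral {0..1} (\<lambda>y. (f' y)\<^sup>2) - 2 * (a \<bullet> b) * (integral {0..1} f' * integral {0..1} h')
      + (norm a)\<^sup>2 * integral {0..1} (\<lambda>y. (h' y)\<^sup>2)) / D)" by (simp add: mult_ac)
  then show ?thesis
    using measure_P_pos D_pos by (simp add: pos_le_divide_eq mult_ac)
qed

text \<open>The constant 12 is the reciprocal of the integral of (z - 1/2)^2 over the unit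
  interval.\<close>

lemma lam_affine_trial:
  "lam * D * (x\<^sup>2 + y\<^sup>2) \<le> 12 * (norm b)\<^sup>2 * x\<^sup>2 - 2 * (12 * (a \<bullet> b)) * (x * y) + 12 * (norm a)\<^sup>2 * y\<^sup>2"
proof -
  have deriv: "((\<lambda>z. r * (z - 1 / 2)) has_real_derivative r) (at z)" for r z :: real
    by (auto intro!: derivative_eq_intros)
  have mean: "integral {0..1} (\<lambda>z. r * (z - 1 / 2)) = 0" for r :: real
    by (rule integral_eqI[where F = "\<lambda>z. r * (z\<^sup>2 / 2 - z / 2)"]) (auto intro!: derivative_eq_intros simp: algebra_simps)
  have sq: "integral {0..1} (\<lambda>z. (r * (z - 1 / 2))\<^sup>2) = r\<^sup>2 / 12" for r :: real
    by (rule integral_eqI[where F = "\<lambda>z. r\<^sup>2 * (z ^ 3 / 3 - z\<^sup>2 / 2 + z / 4)"])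
      (auto intro!: derivative_eq_intros simp: power2_eq_square algebra_simps)
  have const: "integral {0..1} (\<lambda>_::real. r) = r" for r :: real by simp
  have "lam * D * (x\<^sup>2 / 12 + y\<^sup>2 / 12) \<le> (norm b)\<^sup>2 * x\<^sup>2 - 2 * (a \<bullet> b) * (x * y) + (norm a)\<^sup>2 * y\<^sup>2"
    using lam_trial[OF deriv deriv continuous_on_const continuous_on_const mean mean, of x y]
    unfolding sq const .
  then show ?thesis by (simp add: algebra_simps)
qed

text \<open>The derivative of r cos (pi z) has mean -2 r, so the mixed means contribute 4 x y;
  dividing by the mean 1/2 of cos^2 turns this into the constant 8.\<close>

lemma lam_trig_trial:
  "lam * D * (x\<^sup>2 + y\<^sup>2) \<le> pi\<^sup>2 * (norm b)\<^sup>2 * x\<^sup>2 - 2 * (8 * (a \<bullet> b)) * (x * y) + pi\<^sup>2 * (norm a)\<^sup>2 * y\<^sup>2"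
proof -
  have deriv: "((\<lambda>z. r * cos (pi * z)) has_real_derivative - (r * (pi * sin (pi * z)))) (at z)" for r z :: real
    by (auto intro!: derivative_eq_intros)
  have cont: "continuous_on UNIV (\<lambda>z. - (r * (pi * sin (pi * z))))" for r :: real
    by (intro continuous_intros)
  have mean: "integral {0..1} (\<lambda>z. r * cos (pi * z)) = 0" for r :: real
    by (rule integral_eqI[where F = "\<lambda>z. r * sin (pi * z) / pi"]) (auto intro!: derivative_eq_intros)
  have sq: "integral {0..1} (\<lambda>z. (r * cos (pi * z))\<^sup>2) = r\<^sup>2 / 2" for r :: real
    using integral_cos_cos[of 1 1] by (simp add: power_mult_distrib power2_eq_square[of "cos _"])
  have mean': "integral {0..1} (\<lambda>z. - (r * (pi * sin (pi * z)))) = - 2 * r" for r :: real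
    by (rule integral_eqI[where F = "\<lambda>z. r * cos (pi * z)"]) (auto intro!: derivative_eq_intros)
  have sq': "integral {0..1} (\<lambda>z. (- (r * (pi * sin (pi * z))))\<^sup>2) = pi\<^sup>2 * r\<^sup>2 / 2" for r :: real
    using integral_sin_sin[of 1 1] by (simp add: power_mult_distrib power2_eq_square[of "sin _"])
  have "lam * D * (x\<^sup>2 / 2 + y\<^sup>2 / 2) \<le> (norm b)\<^sup>2 * (pi\<^sup>2 * x\<^sup>2 / 2)
      - 2 * (a \<bullet> b) * (- 2 * x * (- 2 * y)) + (norm a)\<^sup>2 * (pi\<^sup>2 * y\<^sup>2 / 2)"
    using lam_trial[OF deriv deriv cont cont mean mean, of x y]
    unfolding sq sq' mean' .
  then show ?thesis by (simp add: algebra_simps)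
qed

lemma lam_perimeter_bound:
  "lam * (norm a + norm b)\<^sup>2 \<le> 4 * pi\<^sup>2 \<and>
    (lam * (norm a + norm b)\<^sup>2 = 4 * pi\<^sup>2 \<longrightarrow> norm a = norm b \<and> a \<bullet> b = 0)"
  by (rule trial_bounds_imp_perimeter_bound)
    (use D_pos a_b_nonzero lam_affine_trial lam_trig_trial in \<open>auto simp: D_def\<close>)

text \<open>For orthogonal sides of equal length the energies along the sides add up exactly to the
  squared side length times the full energy, so the gap estimate for the minimizer, with the zero
  mode removed, is lossless.\<close>

lemma lam_square_ge:
  assumes "norm a = norm b" "a \<bullet> b = 0"
  shows "pi\<^sup>2 \<le> lam * (norm a)\<^sup>2"
proof -
  let ?l = "norm a"
  have l: "0 < ?l" using a_b_nonzero by simp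
  obtain u g where u: "admissible u g" "ip P u u = 1" "ip P g g = lam"
    using minimizer_ex by blast
  have g: "L2 P g" using admissible_L2[OF u(1)] by simp
  have D: "D = ?l\<^sup>2 * ?l\<^sup>2" using assms by (simp add: D_def)
  have pw: "(x \<bullet> a)\<^sup>2 + (x \<bullet> b)\<^sup>2 = ?l\<^sup>2 * (x \<bullet> x)" for x
  proof -
    have "x \<bullet> x = (norm ((x \<bullet> a) *\<^sub>R a' + (x \<bullet> b) *\<^sub>R b'))\<^sup>2"
      by (simp add: dual_decomposition power2_norm_eq_inner)
    also have "\<dots> = ((x \<bullet> a)\<^sup>2 * ?l\<^sup>2 + (x \<bullet> b)\<^sup>2 * ?l\<^sup>2) / (?l\<^sup>2 * ?l\<^sup>2)"
      unfolding norm_dual_comb D using assms by simp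
    also have "\<dots> = ((x \<bullet> a)\<^sup>2 + (x \<bullet> b)\<^sup>2) / ?l\<^sup>2"
      unfolding distrib_right[symmetric] using l by (intro mult_divide_mult_cancel_right) simp
    finally show ?thesis using l by simp
  qed
  have "ip P (\<lambda>x. g x \<bullet> a) (\<lambda>x. g x \<bullet> a) + ip P (\<lambda>x. g x \<bullet> b) (\<lambda>x. g x \<bullet> b)
      = (LINT x|lebesgue_on P. (g x \<bullet> a)\<^sup>2 + (g x \<bullet> b)\<^sup>2)"
    using L2_mult_integrable[OF L2_inner_const[OF g] L2_inner_const[OF g]]
    by (simp add: ip_real power2_eq_square)
  also have "\<dots> = ?l\<^sup>2 * lam"
    unfolding pw using u(3) by (simp add: ip_def)
  finally have "1 \<le> 0 + ?l\<^sup>2 * lam / (pi\<^sup>2 * 1)"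
    using H1_gap[of u g "{(0, 0)}" 1, OF _ _ outside_zero_mode] u energy_zero_mean[of u]
    by (simp add: admissible_def)
  then show ?thesis by (simp add: field_simps)
qed

end

theorem theorem3p7:
  fixes P :: "(real^2) set" and p a b :: "real^2"
  assumes "P = parallelogram p a b" and "\<not> collinear {0, a, b}"
  shows "neumann_eigenvalue P 2 * (parallelogram_perimeter a b)\<^sup>2 \<le> 16 * pi\<^sup>2 \<and>
    (neumann_eigenvalue P 2 * (parallelogram_perimeter a b)\<^sup>2 = 16 * pi\<^sup>2 \<longleftrightarrow> is_square P)"
proof -
  interpret pg: pgram p a b by unfold_locales (rule assms(2))
  let ?\<mu> = "neumann_eigenvalue P 2" and ?L = "norm a + norm b"
  have \<mu>: "?\<mu> = pg.lam"
    using pg.neumann_eigenvalue_eq_lam assms(1) by simp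
  have perimeter: "?\<mu> * (parallelogram_perimeter a b)\<^sup>2 = 4 * (?\<mu> * ?L\<^sup>2)"
    unfolding parallelogram_perimeter_def power_mult_distrib by simp
  have le: "?\<mu> * ?L\<^sup>2 \<le> 4 * pi\<^sup>2"
    using pg.lam_perimeter_bound \<mu> by simp
  have "is_square P" if "?\<mu> * ?L\<^sup>2 = 4 * pi\<^sup>2"
    using pg.lam_perimeter_bound that \<mu> pg.a_b_nonzero(1) assms(1) unfolding is_square_def by metis
  moreover have "?\<mu> * ?L\<^sup>2 = 4 * pi\<^sup>2" if square: "is_square P"
  proof -
    obtain p' a' b' where sq: "P = parallelogram p' a' b'" "a' \<noteq> 0" "norm a' = norm b'" "a' \<bullet> b' = 0"
      using square unfolding is_square_def by blast
    have "\<not> collinear {0, a', b'}"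
      using sq by (auto simp: norm_cauchy_schwarz_equal[symmetric])
    \<comment> \<open>The eigenvalue is a function of the set \<open>P\<close> alone, so the values
      of \<open>lam\<close> for the two descriptions agree.\<close>
    then interpret sq: pgram p' a' b' by unfold_locales
    have "?\<mu> = sq.lam"
      using sq.neumann_eigenvalue_eq_lam sq(1) by simp
    then have lower: "pi\<^sup>2 \<le> ?\<mu> * (norm a')\<^sup>2"
      using sq.lam_square_ge[OF sq(3,4)] by simp
    have "((norm a')\<^sup>2)\<^sup>2 = (measure lebesgue P)\<^sup>2"
      using measure_parallelogram_sq[of p' a' b'] sq by (simp add: power2_eq_square)
    also have "\<dots> \<le> (norm a * norm b)\<^sup>2"
      using measure_parallelogram_sq[of p a b] assms(1) by (simp add: power_mult_distrib)
    finally have "(norm a')\<^sup>2 \<le> norm a * norm b"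
      by (rule power2_le_imp_le) simp
    moreover have "4 * (norm a * norm b) \<le> ?L\<^sup>2"
      using zero_le_power2[of "norm a - norm b"] by (simp add: power2_eq_square algebra_simps)
    ultimately have "4 * (norm a')\<^sup>2 \<le> ?L\<^sup>2" by linarith
    then have "?\<mu> * (4 * (norm a')\<^sup>2) \<le> ?\<mu> * ?L\<^sup>2"
      by (rule mult_left_mono) (simp add: \<mu> pg.lam_nonneg)
    with lower le show ?thesis by simp
  qed
  ultimately show ?thesis
    unfolding perimeter using le by auto
qed

end
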